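(* Let $\mu$ be a (general, possibly complex) Radon measure on $\mathbb{R}^d$. Then the following properties are equivalent: (1) $\mu$ is slowly increasing; (2) $|\mu|$ is strongly tempered; (3) $|\mu|$ is tempered; (4) $|\psi|\in L^1(|\mu|)$ holds for all $\psi\in\mathcal{S}(\mathbb{R}^d)$; (5) $\mu$ is strongly tempered. Further, if $\mu$ is strongly tempered, it is tempered, while the converse need not hold, i.e. there exist Radon measures on $\mathbb{R}^d$ that are tempered but not strongly tempered.
   Context: $\mathcal{S}(\mathbb{R}^d)$ is the space of (complex-valued) Schwartz functions, $\mathcal{S}'(\mathbb{R}^d)$ the space of tempered distributions, and $C^\infty_{\mathsf{c}}(\mathbb{R}^d)$ the space of smooth functions with compact support. A Radon measure on $\mathbb{R}^d$ is in general complex and possibly unbounded (a continuous linear functional on $C_{\mathsf{c}}(\mathbb{R}^d)$ with its inductive limit topology); $|\mu|$ is its total variation measure (a positive Radon measure), and $\mu(\varphi)=\int \varphi \,\mathrm{d}\mu$. For a positive measure $\nu$, $L^1(\nu)=L^1(\mathbb{R}^d,\nu)$. Definitions, for a Radon measure $\mu$ on $\mathbb{R}^d$: - $\mu$ is tempered if there is some $T\in\mathcal{S}'(\mathbb{R}^d)$ with $\mu(\varphi)=T(\varphi)$ for all $\varphi\in C^\infty_{\mathsf{c}}(\mathbb{R}^d)$. - $\mu$ is strongly tempered if, for all $\psi\in\mathcal{S}(\mathbb{R}^d)$, $|\psi|\in L^1(|\mu|)$, and $\psi\mapsto\int_{\mathbb{R}^d}\psi(x)\,\mathrm{d}\mu(x)$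 defines a tempered distribution. - $\mu$ is slowly increasing if $\int_{\mathbb{R}^d}\frac{\mathrm{d}|\mu|(x)}{1+|P(x)|}<\infty$ for some polynomial $P\in\mathbb{C}[x_1,\ldots,x_d]$. *)

theory Defs
  imports "HOL-Analysis.Analysis" "HOL-Library.Poly_Mapping"
begin

definition clinear_on :: "('a \<Rightarrow> complex) set \<Rightarrow> (('a \<Rightarrow> complex) \<Rightarrow> complex) \<Rightarrow> bool" where
  "clinear_on V T \<longleftrightarrow>
     (\<forall>f\<in>V. \<forall>g\<in>V. \<forall>a b. T (\<lambda>x. a * f x + b * g x) = a * T f + b * T g)"


subsection \<open>Polynomials\<close>

definition monom_eval :: "('d::finite \<Rightarrow>\<^sub>0 nat) \<Rightarrow> real ^ 'd \<Rightarrow> complex" where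
  "monom_eval m x = (\<Prod>i\<in>UNIV. complex_of_real (x $ i) ^ Poly_Mapping.lookup m i)"

text \<open>
  A polynomial with complex coefficients in the variables indexed by \<open>'d\<close> is a finitely
  supported map from exponents to coefficients.
\<close>

definition poly_eval :: "(('d::finite \<Rightarrow>\<^sub>0 nat) \<Rightarrow>\<^sub>0 complex) \<Rightarrow> real ^ 'd \<Rightarrow> complex" where
  "poly_eval P x = (\<Sum>m\<in>Poly_Mapping.keys P. Poly_Mapping.lookup P m * monom_eval m x)"


subsection \<open>Schwartz functions and tempered distributions\<close>

definition partial :: "'d::finite \<Rightarrow> (real ^ 'd \<Rightarrow> complex) \<Rightarrow> real ^ 'd \<Rightarrow> complex" where
  "partial i f = (\<lambda>x. frechet_derivative f (at x) (axis i 1))"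

text \<open>
  Iterated partial derivatives are indexed by lists of directions instead of multi-indices, which
  avoids fixing an order on \<open>'d\<close>.  On smooth functions the order of the directions is irrelevant.
\<close>

definition iter_partial :: "'d::finite list \<Rightarrow> (real ^ 'd \<Rightarrow> complex) \<Rightarrow> real ^ 'd \<Rightarrow> complex" where
  "iter_partial is f = foldr partial is f"

definition smooth :: "(real ^ 'd::finite \<Rightarrow> complex) \<Rightarrow> bool" where
  "smooth f \<longleftrightarrow> (\<forall>is. iter_partial is f differentiable_on UNIV)"

definition schwartz :: "(real ^ 'd::finite \<Rightarrow> complex) set" where
  "schwartz = {\<psi>. smooth \<psi> \<and>
     (\<forall>m is. bounded (range (\<lambda>x. monom_eval m x * iter_partial is \<psi> x)))}"

definition schwartz_seminorm ::
    "('d::finite \<Rightarrow>\<^sub>0 nat) \<Rightarrow> 'd list \<Rightarrow> (real ^ 'd \<Rightarrow> complex) \<Rightarrow> real" where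
  "schwartz_seminorm m is \<psi> = (SUP x. cmod (monom_eval m x * iter_partial is \<psi> x))"

text \<open>The locally convex topology generated by the seminorms.\<close>

definition schwartz_nhd ::
    "(('d::finite \<Rightarrow>\<^sub>0 nat) \<times> 'd list) set \<Rightarrow> real \<Rightarrow> (real ^ 'd \<Rightarrow> complex) \<Rightarrow> (real ^ 'd \<Rightarrow> complex) set" where
  "schwartz_nhd F \<epsilon> \<psi> =
     {\<phi>\<in>schwartz. \<forall>(m, is)\<in>F. schwartz_seminorm m is (\<lambda>x. \<phi> x - \<psi> x) < \<epsilon>}"

definition schwartz_open :: "(real ^ 'd::finite \<Rightarrow> complex) set \<Rightarrow> bool" where
  "schwartz_open U \<longleftrightarrow> U \<subseteq> schwartz \<and>
     (\<forall>\<psi>\<in>U. \<exists>F \<epsilon>. finite F \<and> \<epsilon> > 0 \<and> schwartz_nhd F \<epsilon> \<psi> \<subseteq> U)"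

definition schwartz_topology :: "(real ^ 'd::finite \<Rightarrow> complex) topology" where
  "schwartz_topology = topology schwartz_open"

lemma istopology_schwartz_open: "istopology schwartz_open"
  unfolding istopology_def
proof (intro conjI allI impI)
  fix U V :: "(real ^ 'd \<Rightarrow> complex) set"
  assume U: "schwartz_open U" and V: "schwartz_open V"
  show "schwartz_open (U \<inter> V)"
    unfolding schwartz_open_def
  proof (intro conjI ballI)
    show "U \<inter> V \<subseteq> schwartz" using U unfolding schwartz_open_def by blast
    fix \<psi> assume \<psi>: "\<psi> \<in> U \<inter> V"
    obtain F \<epsilon> where F: "finite F" "\<epsilon> > 0" "schwartz_nhd F \<epsilon> \<psi> \<subseteq> U"
      using U \<psi> unfolding schwartz_open_def by blast
    obtain G \<delta> where G: "finite G" "\<delta> > 0" "schwartz_nhd G \<delta> \<psi> \<subseteq> V"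
      using V \<psi> unfolding schwartz_open_def by blast
    have "schwartz_nhd (F \<union> G) (min \<epsilon> \<delta>) \<psi> \<subseteq> schwartz_nhd F \<epsilon> \<psi> \<inter> schwartz_nhd G \<delta> \<psi>"
      unfolding schwartz_nhd_def by auto
    with F G show "\<exists>H \<eta>. finite H \<and> \<eta> > 0 \<and> schwartz_nhd H \<eta> \<psi> \<subseteq> U \<inter> V"
      by (intro exI[of _ "F \<union> G"] exI[of _ "min \<epsilon> \<delta>"]) auto
  qed
next
  fix \<U> :: "(real ^ 'd \<Rightarrow> complex) set set"
  assume a: "\<forall>U\<in>\<U>. schwartz_open U"
  show "schwartz_open (\<Union>\<U>)"
    unfolding schwartz_open_def
  proof (intro conjI ballI)
    show "\<Union>\<U> \<subseteq> schwartz" using a unfolding schwartz_open_def by blast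
    fix \<psi> assume "\<psi> \<in> \<Union>\<U>"
    then obtain U where U: "U \<in> \<U>" "\<psi> \<in> U" by blast
    then obtain F \<epsilon> where F: "finite F" "\<epsilon> > 0" "schwartz_nhd F \<epsilon> \<psi> \<subseteq> U"
      using a unfolding schwartz_open_def by blast
    moreover from F(3) U(1) have "schwartz_nhd F \<epsilon> \<psi> \<subseteq> \<Union>\<U>" by blast
    ultimately show "\<exists>F \<epsilon>. finite F \<and> \<epsilon> > 0 \<and> schwartz_nhd F \<epsilon> \<psi> \<subseteq> \<Union>\<U>" by blast
  qed
qed

lemma openin_schwartz_topology: "openin schwartz_topology = schwartz_open"
  unfolding schwartz_topology_def by (rule topology_inverse'[OF istopology_schwartz_open])

lemma topspace_schwartz_topology: "topspace schwartz_topology = schwartz"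
proof
  have "schwartz_nhd {} 1 \<psi> \<subseteq> schwartz" for \<psi> :: "real ^ 'd \<Rightarrow> complex"
    unfolding schwartz_nhd_def by blast
  then have "\<exists>F \<epsilon>. finite F \<and> \<epsilon> > 0 \<and> schwartz_nhd F \<epsilon> \<psi> \<subseteq> schwartz"
    for \<psi> :: "real ^ 'd \<Rightarrow> complex"
    by (intro exI[of _ "{}"] exI[of _ "1::real"]) simp
  then have "schwartz_open (schwartz :: (real ^ 'd \<Rightarrow> complex) set)"
    unfolding schwartz_open_def by (intro conjI ballI order_refl)
  then show "(schwartz :: (real ^ 'd \<Rightarrow> complex) set) \<subseteq> topspace schwartz_topology"
    by (intro openin_subset) (simp add: openin_schwartz_topology)
  have "schwartz_open (topspace schwartz_topology :: (real ^ 'd \<Rightarrow> complex) set)"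
    using openin_topspace[of schwartz_topology] by (simp only: openin_schwartz_topology)
  then show "topspace schwartz_topology \<subseteq> (schwartz :: (real ^ 'd \<Rightarrow> complex) set)"
    unfolding schwartz_open_def by (rule conjunct1)
qed

definition tempered_distribution :: "((real ^ 'd::finite \<Rightarrow> complex) \<Rightarrow> complex) \<Rightarrow> bool" where
  "tempered_distribution T \<longleftrightarrow>
     clinear_on schwartz T \<and> continuous_map schwartz_topology euclidean T"


subsection \<open>Radon measures\<close>

definition fun_support :: "('a::topological_space \<Rightarrow> complex) \<Rightarrow> 'a set" where
  "fun_support f = closure {x. f x \<noteq> 0}"

definition Cc :: "('a::topological_space \<Rightarrow> complex) set" where
  "Cc = {f. continuous_on UNIV f \<and> compact (fun_support f)}"

definition Cc_smooth :: "(real ^ 'd::finite \<Rightarrow> complex) set" where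
  "Cc_smooth = {f. smooth f \<and> compact (fun_support f)}"

definition absolutely_convex :: "('a \<Rightarrow> complex) set \<Rightarrow> bool" where
  "absolutely_convex V \<longleftrightarrow>
     (\<forall>f\<in>V. \<forall>g\<in>V. \<forall>a b. cmod a + cmod b \<le> 1 \<longrightarrow> (\<lambda>x. a * f x + b * g x) \<in> V)"

text \<open>
  The locally convex inductive limit of the spaces of functions in \<^term>\<open>Cc\<close> supported in a fixed
  compact set \<open>K\<close>, each with the supremum norm: the basic neighbourhoods of \<open>0\<close> are the absolutely
  convex sets whose trace on each of these spaces is a neighbourhood of \<open>0\<close> there.
\<close>

definition Cc_zero_nhd :: "('a::topological_space \<Rightarrow> complex) set \<Rightarrow> bool" where
  "Cc_zero_nhd V \<longleftrightarrow> V \<subseteq> Cc \<and> absolutely_convex V \<and>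
     (\<forall>K. compact K \<longrightarrow>
        (\<exists>\<epsilon>>0. \<forall>f\<in>Cc. fun_support f \<subseteq> K \<and> (\<forall>x. cmod (f x) \<le> \<epsilon>) \<longrightarrow> f \<in> V))"

definition Cc_open :: "('a::topological_space \<Rightarrow> complex) set \<Rightarrow> bool" where
  "Cc_open U \<longleftrightarrow> U \<subseteq> Cc \<and>
     (\<forall>f\<in>U. \<exists>V. Cc_zero_nhd V \<and> (\<forall>g\<in>V. (\<lambda>x. f x + g x) \<in> U))"

definition Cc_topology :: "('a::topological_space \<Rightarrow> complex) topology" where
  "Cc_topology = topology Cc_open"

lemma absolutely_convex_Int:
  assumes V: "absolutely_convex V" and W: "absolutely_convex W"
  shows "absolutely_convex (V \<inter> W)"
  unfolding absolutely_convex_def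
proof (intro ballI allI impI)
  fix f g and a b :: complex
  assume fg: "f \<in> V \<inter> W" "g \<in> V \<inter> W" and ab: "cmod a + cmod b \<le> 1"
  have "(\<lambda>x. a * f x + b * g x) \<in> V"
    using V[unfolded absolutely_convex_def, rule_format, OF IntD1[OF fg(1)] IntD1[OF fg(2)] ab] .
  moreover have "(\<lambda>x. a * f x + b * g x) \<in> W"
    using W[unfolded absolutely_convex_def, rule_format, OF IntD2[OF fg(1)] IntD2[OF fg(2)] ab] .
  ultimately show "(\<lambda>x. a * f x + b * g x) \<in> V \<inter> W" by (rule IntI)
qed

lemma Cc_zero_nhd_Int:
  assumes "Cc_zero_nhd V" "Cc_zero_nhd W"
  shows "Cc_zero_nhd (V \<inter> W)"
  unfolding Cc_zero_nhd_def
proof (intro conjI allI impI)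
  show "V \<inter> W \<subseteq> Cc" using assms unfolding Cc_zero_nhd_def by blast
  show "absolutely_convex (V \<inter> W)"
    using assms unfolding Cc_zero_nhd_def by (intro absolutely_convex_Int) simp_all
  fix K :: "'a set" assume K: "compact K"
  have "\<exists>\<epsilon>>0. \<forall>f\<in>Cc. fun_support f \<subseteq> K \<and> (\<forall>x. cmod (f x) \<le> \<epsilon>) \<longrightarrow> f \<in> V"
    using assms(1) K unfolding Cc_zero_nhd_def by simp
  then obtain \<epsilon> where e: "\<epsilon> > 0" "\<forall>f\<in>Cc. fun_support f \<subseteq> K \<and> (\<forall>x. cmod (f x) \<le> \<epsilon>) \<longrightarrow> f \<in> V" by (elim exE conjE)
  have "\<exists>\<epsilon>>0. \<forall>f\<in>Cc. fun_support f \<subseteq> K \<and> (\<forall>x. cmod (f x) \<le> \<epsilon>) \<longrightarrow> f \<in> W"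
    using assms(2) K unfolding Cc_zero_nhd_def by simp
  then obtain \<delta> where d: "\<delta> > 0" "\<forall>f\<in>Cc. fun_support f \<subseteq> K \<and> (\<forall>x. cmod (f x) \<le> \<delta>) \<longrightarrow> f \<in> W" by (elim exE conjE)
  have "\<forall>f\<in>Cc. fun_support f \<subseteq> K \<and> (\<forall>x. cmod (f x) \<le> min \<epsilon> \<delta>) \<longrightarrow> f \<in> V \<inter> W"
  proof (intro ballI impI)
    fix f :: "'a \<Rightarrow> complex"
    assume f: "f \<in> Cc" and le: "fun_support f \<subseteq> K \<and> (\<forall>x. cmod (f x) \<le> min \<epsilon> \<delta>)"
    have "f \<in> V" using bspec[OF e(2) f] le by simp
    moreover have "f \<in> W" using bspec[OF d(2) f] le by simp
    ultimately show "f \<in> V \<inter> W" by (rule IntI)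
  qed
  with e(1) d(1) show "\<exists>\<eta>>0. \<forall>f\<in>Cc. fun_support f \<subseteq> K \<and> (\<forall>x. cmod (f x) \<le> \<eta>) \<longrightarrow> f \<in> V \<inter> W"
    by (intro exI[of _ "min \<epsilon> \<delta>"]) (rule conjI, simp)
qed

lemma istopology_Cc_open: "istopology Cc_open"
  unfolding istopology_def
proof (intro conjI allI impI)
  fix U V :: "('a \<Rightarrow> complex) set"
  assume U: "Cc_open U" and V: "Cc_open V"
  show "Cc_open (U \<inter> V)"
    unfolding Cc_open_def
  proof (intro conjI ballI)
    show "U \<inter> V \<subseteq> Cc" using U unfolding Cc_open_def by blast
    fix f assume f: "f \<in> U \<inter> V"
    obtain A where A: "Cc_zero_nhd A" "\<And>g. g \<in> A \<Longrightarrow> (\<lambda>x. f x + g x) \<in> U"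
      using U f unfolding Cc_open_def by blast
    obtain B where B: "Cc_zero_nhd B" "\<And>g. g \<in> B \<Longrightarrow> (\<lambda>x. f x + g x) \<in> V"
      using V f unfolding Cc_open_def by blast
    show "\<exists>W. Cc_zero_nhd W \<and> (\<forall>g\<in>W. (\<lambda>x. f x + g x) \<in> U \<inter> V)"
      using A B Cc_zero_nhd_Int by (intro exI[of _ "A \<inter> B"]) blast
  qed
next
  fix \<U> :: "('a \<Rightarrow> complex) set set"
  assume a: "\<forall>U\<in>\<U>. Cc_open U"
  show "Cc_open (\<Union>\<U>)"
    unfolding Cc_open_def
  proof (intro conjI ballI)
    show "\<Union>\<U> \<subseteq> Cc" using a unfolding Cc_open_def by blast
    fix f assume "f \<in> \<Union>\<U>"
    then obtain U where U: "U \<in> \<U>" "f \<in> U" by blast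
    have "Cc_open U" using a U(1) by (rule bspec)
    then have "\<forall>f\<in>U. \<exists>V. Cc_zero_nhd V \<and> (\<forall>g\<in>V. (\<lambda>x. f x + g x) \<in> U)"
      unfolding Cc_open_def by (rule conjunct2)
    then obtain V where V: "Cc_zero_nhd V" "\<forall>g\<in>V. (\<lambda>x. f x + g x) \<in> U"
      using U(2) by (auto dest: bspec)
    have "\<forall>g\<in>V. (\<lambda>x. f x + g x) \<in> \<Union>\<U>"
    proof
      fix g assume "g \<in> V"
      with V(2) have "(\<lambda>x. f x + g x) \<in> U" by (rule bspec)
      with U(1) show "(\<lambda>x. f x + g x) \<in> \<Union>\<U>" by (rule UnionI)
    qed
    with V(1) have "Cc_zero_nhd V \<and> (\<forall>g\<in>V. (\<lambda>x. f x + g x) \<in> \<Union>\<U>)" by (rule conjI)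
    then show "\<exists>V. Cc_zero_nhd V \<and> (\<forall>g\<in>V. (\<lambda>x. f x + g x) \<in> \<Union>\<U>)" by (rule exI)
  qed
qed

lemma openin_Cc_topology: "openin Cc_topology = Cc_open"
  unfolding Cc_topology_def by (rule topology_inverse'[OF istopology_Cc_open])

text \<open>
  A Radon measure is a functional on \<^term>\<open>Cc\<close>; its values at other functions are irrelevant
  and enter none of the notions below.
\<close>

definition radon_measure :: "(('a::topological_space \<Rightarrow> complex) \<Rightarrow> complex) \<Rightarrow> bool" where
  "radon_measure \<mu> \<longleftrightarrow> clinear_on Cc \<mu> \<and> continuous_map Cc_topology euclidean \<mu>"

text \<open>
  The total variation of \<open>\<mu>\<close> is given at \<open>0 \<le> g\<close> by the supremum of \<open>\<bar>\<mu>(f)\<bar>\<close> over \<open>\<bar>f\<bar> \<le> g\<close>,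
  and is extended to complex-valued functions by linearity.
\<close>

definition variation_at ::
    "(('a::topological_space \<Rightarrow> complex) \<Rightarrow> complex) \<Rightarrow> ('a \<Rightarrow> real) \<Rightarrow> real" where
  "variation_at \<mu> g = (SUP f\<in>{f\<in>Cc. \<forall>x. cmod (f x) \<le> g x}. cmod (\<mu> f))"

definition total_variation ::
    "(('a::topological_space \<Rightarrow> complex) \<Rightarrow> complex) \<Rightarrow> ('a \<Rightarrow> complex) \<Rightarrow> complex" where
  "total_variation \<mu> \<phi> = Complex
     (variation_at \<mu> (\<lambda>x. max 0 (Re (\<phi> x))) - variation_at \<mu> (\<lambda>x. max 0 (- Re (\<phi> x))))
     (variation_at \<mu> (\<lambda>x. max 0 (Im (\<phi> x))) - variation_at \<mu> (\<lambda>x. max 0 (- Im (\<phi> x))))"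

text \<open>
  The Borel measure that represents a positive Radon measure by the Riesz representation theorem.
\<close>

definition riesz_measure :: "(('a::topological_space \<Rightarrow> complex) \<Rightarrow> complex) \<Rightarrow> 'a measure" where
  "riesz_measure \<nu> = (THE M. sets M = sets borel \<and> (\<forall>K. compact K \<longrightarrow> emeasure M K < \<infinity>) \<and>
     (\<forall>f\<in>Cc. \<nu> f = (\<integral>x. f x \<partial>M)))"

abbreviation variation_measure ::
    "(('a::topological_space \<Rightarrow> complex) \<Rightarrow> complex) \<Rightarrow> 'a measure" where
  "variation_measure \<mu> \<equiv> riesz_measure (total_variation \<mu>)"

text \<open>
  The integral of an \<open>L\<^sup>1(\<bar>\<mu>\<bar>)\<close> function \<open>\<psi>\<close> with respect to \<open>\<mu>\<close> is the value at \<open>\<psi>\<close> of the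
  continuous extension of \<open>\<mu>\<close> from \<^term>\<open>Cc\<close>, which is dense in \<open>L\<^sup>1(\<bar>\<mu>\<bar>)\<close>.
\<close>

definition radon_integral ::
    "(('a::topological_space \<Rightarrow> complex) \<Rightarrow> complex) \<Rightarrow> ('a \<Rightarrow> complex) \<Rightarrow> complex" where
  "radon_integral \<mu> \<psi> = (THE z. \<forall>f :: nat \<Rightarrow> 'a \<Rightarrow> complex.
     (\<forall>n. f n \<in> Cc) \<and>
     (\<lambda>n. \<integral>\<^sup>+x. ennreal (cmod (\<psi> x - f n x)) \<partial>variation_measure \<mu>) \<longlonglongrightarrow> 0 \<longrightarrow>
     (\<lambda>n. \<mu> (f n)) \<longlonglongrightarrow> z)"


subsection \<open>Temperedness conditions\<close>

definition tempered :: "((real ^ 'd::finite \<Rightarrow> complex) \<Rightarrow> complex) \<Rightarrow> bool" where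
  "tempered \<mu> \<longleftrightarrow> (\<exists>T. tempered_distribution T \<and> (\<forall>\<phi>\<in>Cc_smooth. \<mu> \<phi> = T \<phi>))"

definition strongly_tempered :: "((real ^ 'd::finite \<Rightarrow> complex) \<Rightarrow> complex) \<Rightarrow> bool" where
  "strongly_tempered \<mu> \<longleftrightarrow>
     (\<forall>\<psi>\<in>schwartz. integrable (variation_measure \<mu>) (\<lambda>x. cmod (\<psi> x))) \<and>
     tempered_distribution (\<lambda>\<psi>. radon_integral \<mu> \<psi>)"

definition slowly_increasing :: "((real ^ 'd::finite \<Rightarrow> complex) \<Rightarrow> complex) \<Rightarrow> bool" where
  "slowly_increasing \<mu> \<longleftrightarrow>
     (\<exists>P. (\<integral>\<^sup>+x. ennreal (1 / (1 + cmod (poly_eval P x))) \<partial>variation_measure \<mu>) < \<infinity>)"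

end

theory Submission
  imports Defs
begin

text \<open>
  Let \<open>M\<close> be the Borel measure that represents \<open>\<bar>\<mu>\<bar>\<close>.  All five conditions are equivalent to one
  statement about the masses of balls: \<open>M (cball 0 R)\<close> is bounded by a polynomial in \<open>R \<ge> 1\<close>
  (\<open>polynomial_growth\<close>).

  \<^item> Polynomial growth makes \<open>1 / (1 + \<Sum>\<^sub>i x\<^sub>i\<^bsup>2L\<^esup>)\<close> integrable for large \<open>L\<close>, by summing over the shells
    \<open>k \<le> \<bar>x\<bar> \<le> k + 1\<close>; so \<open>\<mu>\<close> is slowly increasing.  As \<open>(1 + \<Sum>\<^sub>i x\<^sub>i\<^bsup>2L\<^esup>) \<psi>\<close> is bounded by finitely
    many seminorms of a Schwartz function \<open>\<psi>\<close>, also \<open>\<integral>\<bar>\<psi>\<bar> dM\<close> is bounded by these seminorms.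
    This gives the integrability of every \<open>\<bar>\<psi>\<bar>\<close>, and both \<open>\<mu>\<close> and \<open>\<bar>\<mu>\<bar>\<close> are strongly tempered because
    their integrals are dominated by \<open>\<integral>\<bar>\<psi>\<bar> dM\<close>.

  \<^item> If \<open>\<mu>\<close> is slowly increasing, a polynomial is at most \<open>A R\<^sup>N\<close> on the ball of radius \<open>R\<close>, which
    bounds the mass of that ball.

  \<^item> If \<open>\<bar>\<mu>\<bar>\<close> is tempered, it is tested on the dilates \<open>h(x / R)\<close> of a smooth bump function \<open>h \<ge> 0\<close>:
    their integrals bound the masses of balls from above, and their seminorms grow polynomially in \<open>R\<close>
    (\<open>tempered_imp_polynomial_growth\<close>).

  \<^item> If the growth is not polynomial, there are radii \<open>R\<^sub>j\<close> with \<open>M (cball 0 R\<^sub>j) > (2 R\<^sub>j)\<^sup>j\<close>, and the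
    superposition \<open>\<Sum>\<^sub>j (2 R\<^sub>j)\<^bsup>-j\<^esup> h(x / R\<^sub>j)\<close> is a Schwartz function that is not integrable
    (\<open>schwartz_integrable_imp_polynomial_growth\<close>).

  A strongly tempered \<open>\<mu>\<close> is tempered, since its extension to Schwartz functions agrees with \<open>\<mu>\<close> on test
  functions.  The converse fails for the sum of the dipoles \<open>2\<^sup>n (\<delta>\<^sub>y - \<delta>\<^sub>z)\<close>, where \<open>y\<close> and \<open>z\<close> are the
  points \<open>n\<close> and \<open>n + 2\<^bsup>-n\<^esup>\<close> on a coordinate axis: by the mean value theorem each dipole is controlled
  by a first derivative, while the total variation has mass at least \<open>2\<^sup>n\<close> near \<open>y\<close>.

  That \<open>M\<close> exists is the Riesz representation theorem, applied to the functional \<open>variation_at \<mu>\<close>, which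
  is additive on nonnegative functions in \<^term>\<open>Cc\<close>.
\<close>

section \<open>Nonnegative continuous functions of compact support\<close>

definition Cc_nonneg :: "('a::euclidean_space \<Rightarrow> real) set" where
  "Cc_nonneg = {g. continuous_on UNIV g \<and> (\<forall>x. 0 \<le> g x) \<and> bounded {x. g x \<noteq> 0}}"

lemma Cc_nonnegD:
  assumes "g \<in> Cc_nonneg"
  shows "continuous_on UNIV g" "0 \<le> g x" "bounded {x. g x \<noteq> 0}"
  using assms by (auto simp: Cc_nonneg_def)

lemma Cc_nonneg_dominatedI:
  assumes "f \<in> Cc_nonneg" "continuous_on UNIV g" "\<And>x. 0 \<le> g x" "\<And>x. f x = 0 \<Longrightarrow> g x = 0"
  shows "g \<in> Cc_nonneg"
proof -
  have "bounded {x. g x \<noteq> 0}"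
    by (rule bounded_subset[OF Cc_nonnegD(3)[OF assms(1)]]) (use assms(4) in auto)
  then show ?thesis using assms by (simp add: Cc_nonneg_def)
qed

lemma Cc_nonneg_zero: "(\<lambda>x. 0) \<in> Cc_nonneg"
  by (simp add: Cc_nonneg_def)

lemma Cc_nonneg_add:
  assumes "f \<in> Cc_nonneg" "g \<in> Cc_nonneg"
  shows "(\<lambda>x. f x + g x) \<in> Cc_nonneg"
proof -
  have "bounded ({x. f x \<noteq> 0} \<union> {x. g x \<noteq> 0})"
    using assms by (simp add: Cc_nonnegD)
  then have "bounded {x. f x + g x \<noteq> 0}" by (rule bounded_subset) auto
  then show ?thesis
    using assms by (auto simp: Cc_nonneg_def intro!: continuous_intros)
qed

lemma Cc_nonneg_scale:
  assumes "f \<in> Cc_nonneg" "0 \<le> c"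
  shows "(\<lambda>x. c * f x) \<in> Cc_nonneg"
  using assms by (intro Cc_nonneg_dominatedI[OF assms(1)]) (auto simp: Cc_nonnegD intro!: continuous_intros)

lemma Cc_nonneg_sum:
  assumes "\<And>i. i \<in> I \<Longrightarrow> f i \<in> Cc_nonneg"
  shows "(\<lambda>x. \<Sum>i\<in>I. f i x) \<in> Cc_nonneg"
  using assms
  by (induction I rule: infinite_finite_induct) (auto intro: Cc_nonneg_zero Cc_nonneg_add)

lemma Cc_nonneg_bounded_above:
  fixes g :: "'a::euclidean_space \<Rightarrow> real"
  assumes "g \<in> Cc_nonneg"
  obtains B where "0 < B" "\<And>x. g x \<le> B"
proof -
  let ?K = "closure {x. g x \<noteq> 0}"
  have "compact ?K" using assms by (simp add: Cc_nonnegD)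
  then have "bounded (g ` ?K)"
    by (intro compact_imp_bounded compact_continuous_image)
       (auto intro: continuous_on_subset[OF Cc_nonnegD(1)[OF assms]])
  then obtain B where B: "0 < B" "\<And>y. y \<in> g ` ?K \<Longrightarrow> norm y \<le> B" by (auto simp: bounded_pos)
  have "g x \<le> B" for x
  proof (cases "g x = 0")
    case False
    then have "x \<in> ?K" using closure_subset by fastforce
    then show ?thesis using B(2)[of "g x"] by auto
  qed (use B in auto)
  with B(1) show ?thesis by (rule that)
qed

definition cutoff :: "real \<Rightarrow> 'a::euclidean_space \<Rightarrow> real" where
  "cutoff R x = max 0 (min 1 (R + 1 - norm x))"

lemma cutoff_bounds: "0 \<le> cutoff R x" "cutoff R x \<le> 1"
  by (auto simp: cutoff_def)

lemma cutoff_eq_1: "norm x \<le> R \<Longrightarrow> cutoff R x = 1"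
  by (auto simp: cutoff_def)

lemma cutoff_eq_0: "R + 1 \<le> norm x \<Longrightarrow> cutoff R x = 0"
  by (auto simp: cutoff_def)

lemma continuous_on_cutoff: "continuous_on A (cutoff R)"
  unfolding cutoff_def[abs_def] by (intro continuous_intros)

lemma cutoff_in_Cc_nonneg: "cutoff R \<in> Cc_nonneg"
proof -
  have "bounded {x. cutoff R x \<noteq> 0}"
    by (rule bounded_subset[of "cball 0 (R + 1)"])
       (auto simp: bounded_cball dist_norm intro: cutoff_eq_0 ccontr)
  then show ?thesis by (simp add: Cc_nonneg_def cutoff_bounds continuous_on_cutoff)
qed

lemma Cc_nonneg_support_radius:
  fixes g :: "'a::euclidean_space \<Rightarrow> real"
  assumes "g \<in> Cc_nonneg"
  obtains R where "0 < R" "\<And>x. g x \<noteq> 0 \<Longrightarrow> norm x \<le> R"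
  using Cc_nonnegD(3)[OF assms] unfolding bounded_pos by auto

section \<open>The Riesz representation theorem\<close>

text \<open>
  The cone of nonnegative functions is enough: additivity there determines the linear extension, and
  the variation of a Radon measure is naturally given on this cone.
\<close>

locale positive_functional =
  fixes V :: "('a::euclidean_space \<Rightarrow> real) \<Rightarrow> real"
  assumes V_nonneg: "g \<in> Cc_nonneg \<Longrightarrow> 0 \<le> V g"
    and V_add: "f \<in> Cc_nonneg \<Longrightarrow> g \<in> Cc_nonneg \<Longrightarrow> V (\<lambda>x. f x + g x) = V f + V g"
    and V_scale: "g \<in> Cc_nonneg \<Longrightarrow> 0 \<le> c \<Longrightarrow> V (\<lambda>x. c * g x) = c * V g"
begin

lemma V_zero: "V (\<lambda>x. 0) = 0"
  using V_scale[OF Cc_nonneg_zero, of 0] by simp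

lemma V_mono:
  assumes "f \<in> Cc_nonneg" "g \<in> Cc_nonneg" "\<And>x. f x \<le> g x"
  shows "V f \<le> V g"
proof -
  have "(\<lambda>x. g x - f x) \<in> Cc_nonneg"
  proof (rule Cc_nonneg_dominatedI[OF assms(2)])
    show "g x - f x = 0" if "g x = 0" for x
      using that assms(3)[of x] Cc_nonnegD(2)[OF assms(1), of x] by simp
  qed (use assms in \<open>auto simp: Cc_nonnegD intro!: continuous_intros\<close>)
  then show ?thesis
    using V_add[OF assms(1), of "\<lambda>x. g x - f x"] V_nonneg[of "\<lambda>x. g x - f x"] by simp
qed

lemma V_sum:
  assumes "finite I" "\<And>i. i \<in> I \<Longrightarrow> f i \<in> Cc_nonneg"
  shows "V (\<lambda>x. \<Sum>i\<in>I. f i x) = (\<Sum>i\<in>I. V (f i))"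
  using assms
  by (induction I) (auto simp: V_zero V_add Cc_nonneg_sum)

text \<open>
  By Dini's theorem the convergence is uniform on a ball that supports the limit; multiplying the
  uniform error by a cutoff function turns it into an error for the functional.  This continuity
  is the only form in which compactness enters the construction of the measure on open sets.
\<close>

lemma V_monotone_limit:
  fixes f :: "nat \<Rightarrow> 'a \<Rightarrow> real"
  assumes g: "g \<in> Cc_nonneg" and f: "\<And>n. f n \<in> Cc_nonneg"
    and inc: "\<And>n x. f n x \<le> f (Suc n) x"
    and lim: "\<And>x. (\<lambda>n. f n x) \<longlonglongrightarrow> g x"
  shows "(\<lambda>n. V (f n)) \<longlonglongrightarrow> V g"
proof -
  obtain R where R: "0 < R" "\<And>x. g x \<noteq> 0 \<Longrightarrow> norm x \<le> R"
    using Cc_nonneg_support_radius[OF g] by blast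
  have inc': "f m x \<le> f n x" if "m \<le> n" for m n x
    using that inc by (rule lift_Suc_mono_le[of "\<lambda>n. f n x", rotated])
  have le: "f n x \<le> g x" for n x
    by (rule incseq_le[OF _ lim]) (auto simp: incseq_def inc')
  have Vle: "V (f n) \<le> V g" for n
    using V_mono[OF f g le] .
  let ?\<chi> = "cutoff R :: 'a \<Rightarrow> real"
  \<comment> \<open>The summand 1 only makes the denominator of d positive.\<close>
  let ?B = "V ?\<chi> + 1"
  have B: "0 < ?B" using V_nonneg[OF cutoff_in_Cc_nonneg[of R]] by simp
  show ?thesis
  proof (rule LIMSEQ_I)
    fix e :: real assume e: "0 < e"
    define d where "d = e / ?B"
    have d: "0 < d" using e B by (simp add: d_def)
    define D where "D n = {x. g x - f n x < d}" for n
    have "open (D n)" for n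
      unfolding D_def
      by (intro open_Collect_less continuous_intros Cc_nonnegD(1)[OF g] Cc_nonnegD(1)[OF f])
    moreover have "cball 0 R \<subseteq> (\<Union>n. D n)"
    proof
      fix x :: 'a
      obtain n where "norm (f n x - g x) < d" using LIMSEQ_D[OF lim[of x] d] by blast
      then have "x \<in> D n" by (simp add: D_def)
      then show "x \<in> (\<Union>n. D n)" by blast
    qed
    ultimately obtain C where C: "finite C" "cball 0 R \<subseteq> (\<Union>n\<in>C. D n)"
      using compactE_image[OF compact_cball, of UNIV D 0 R] by auto
    define N where "N = Max (insert 0 C)"
    have "V g - V (f n) < e" if "N \<le> n" for n
    proof -
      have "g x \<le> f n x + d * ?\<chi> x" for x
      proof (cases "norm x \<le> R")
        case True
        then obtain k where k: "k \<in> C" "x \<in> D k" using C by auto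
        then have "k \<le> n" using C(1) that by (auto simp: N_def)
        then show ?thesis using k(2) inc'[of k n x] True by (simp add: D_def cutoff_eq_1)
      next
        case False
        then have "g x = 0" using R by blast
        then show ?thesis using Cc_nonnegD(2)[OF f] d cutoff_bounds(1)[of R x] by simp
      qed
      then have "V g \<le> V (\<lambda>x. f n x + d * ?\<chi> x)"
        using d by (intro V_mono g Cc_nonneg_add f Cc_nonneg_scale cutoff_in_Cc_nonneg) auto
      also have "\<dots> = V (f n) + d * V ?\<chi>"
        using d by (simp add: V_add f V_scale Cc_nonneg_scale cutoff_in_Cc_nonneg)
      also have "d * V ?\<chi> < d * ?B" using d by simp
      also have "d * ?B = e" using B by (simp add: d_def)
      finally show ?thesis by simp
    qed
    then have "norm (V (f n) - V g) < e" if "N \<le> n" for n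
      using that Vle[of n] by simp
    then show "\<exists>N. \<forall>n\<ge>N. norm (V (f n) - V g) < e" by blast
  qed
qed

definition open_content :: "'a set \<Rightarrow> ennreal" where
  "open_content U = (SUP g\<in>{g\<in>Cc_nonneg. \<forall>x. g x \<le> indicator U x}. ennreal (V g))"

lemma open_content_upper:
  "g \<in> Cc_nonneg \<Longrightarrow> (\<And>x. g x \<le> indicator U x) \<Longrightarrow> ennreal (V g) \<le> open_content U"
  unfolding open_content_def by (rule SUP_upper) auto

lemma open_content_least:
  assumes "\<And>g. g \<in> Cc_nonneg \<Longrightarrow> (\<And>x. g x \<le> indicator U x) \<Longrightarrow> ennreal (V g) \<le> c"
  shows "open_content U \<le> c"
  unfolding open_content_def using assms by (intro SUP_least) auto

lemma open_content_mono:
  assumes "A \<subseteq> B"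
  shows "open_content A \<le> open_content B"
proof (intro open_content_least open_content_upper)
  fix g :: "'a \<Rightarrow> real" and x
  assume "\<And>x. g x \<le> indicator A x"
  moreover have "indicator A x \<le> (indicator B x :: real)"
    using assms by (auto simp: indicator_def)
  ultimately show "g x \<le> indicator B x" by (rule order_trans)
qed

lemma open_content_empty: "open_content {} = 0"
proof -
  have "open_content {} \<le> 0"
  proof (rule open_content_least)
    fix g :: "'a \<Rightarrow> real" assume "g \<in> Cc_nonneg" "\<And>x. g x \<le> indicator {} x"
    then have "g = (\<lambda>x. 0)" by (auto simp: fun_eq_iff intro!: antisym dest: Cc_nonnegD(2))
    then show "ennreal (V g) \<le> 0" by (simp add: V_zero)
  qed
  then show ?thesis by simp
qed

text \<open>
  With \<open>h\<^sub>i\<close> positive exactly on \<open>U\<^sub>i\<close>, the functions \<open>g min(1, n \<Sum>\<^bsub>i<n\<^esub> h\<^sub>i)\<close> increase to \<open>g\<close>, and each of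
  them is at most the sum of the functions \<open>g min(1, n h\<^sub>i)\<close>, which live on single sets \<open>U\<^sub>i\<close>.
\<close>

lemma open_content_countably_subadditive:
  fixes U :: "nat \<Rightarrow> 'a set"
  assumes U: "\<And>i. open (U i)"
  shows "open_content (\<Union>i. U i) \<le> (suminf (\<lambda>i. open_content (U i)))"
proof (rule open_content_least)
  fix g :: "'a \<Rightarrow> real"
  assume g: "g \<in> Cc_nonneg" and gU: "\<And>x. g x \<le> indicator (\<Union>i. U i) x"
  \<comment> \<open>The distance to the empty set is 0 by default, hence the separate case.\<close>
  define h where "h i x = (if U i = UNIV then 1 else infdist x (- U i))" for i x
  have h_cont: "continuous_on UNIV (h i)" for i
    unfolding h_def[abs_def] by (cases "U i = UNIV") (auto intro!: continuous_intros)
  have h_nonneg: "0 \<le> h i x" for i x by (simp add: h_def infdist_nonneg)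
  have h_pos: "0 < h i x" if "x \<in> U i" for i x
  proof (cases "U i = UNIV")
    case False
    then have "infdist x (- U i) \<noteq> 0"
      using that U[of i] in_closed_iff_infdist_zero[of "- U i" x] by (auto simp: closed_Compl)
    then show ?thesis using False infdist_nonneg[of x "- U i"] by (simp add: h_def)
  qed (simp add: h_def)
  have h_zero: "h i x = 0" if "x \<notin> U i" for i x
    using that by (auto simp: h_def)
  define f where "f n x = g x * min 1 (real n * (\<Sum>i<n. h i x))" for n x
  have f_in: "f n \<in> Cc_nonneg" for n
    by (rule Cc_nonneg_dominatedI[OF g])
       (auto simp: f_def[abs_def] Cc_nonnegD[OF g] h_nonneg
             intro!: continuous_intros mult_nonneg_nonneg sum_nonneg Cc_nonnegD[OF g]
                     continuous_on_subset[OF h_cont])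
  have "(\<lambda>n. V (f n)) \<longlonglongrightarrow> V g"
  proof (rule V_monotone_limit[OF g f_in])
    show "f n x \<le> f (Suc n) x" for n x
    proof -
      have "real n * (\<Sum>i<n. h i x) \<le> real (Suc n) * (\<Sum>i<Suc n. h i x)"
        by (intro mult_mono) (auto simp: h_nonneg sum_nonneg)
      then show ?thesis
        unfolding f_def by (intro mult_left_mono Cc_nonnegD(2)[OF g]) auto
    qed
    show "(\<lambda>n. f n x) \<longlonglongrightarrow> g x" for x
    proof (cases "g x = 0")
      case False
      then have "x \<in> (\<Union>i. U i)" using gU[of x] Cc_nonnegD(2)[OF g, of x]
        by (cases "x \<in> (\<Union>i. U i)") simp_all
      then obtain k where k: "x \<in> U k" by blast
      obtain m where m: "1 \<le> real m * h k x"
        using reals_Archimedean3[OF h_pos[OF k]] by (metis less_imp_le)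
      have "f n x = g x" if "max m (Suc k) \<le> n" for n
      proof -
        have "real m * h k x \<le> real n * h k x"
          using that h_nonneg by (intro mult_right_mono) auto
        also have "h k x \<le> (\<Sum>i<n. h i x)"
          using that h_nonneg by (intro member_le_sum) auto
        finally have "1 \<le> real n * (\<Sum>i<n. h i x)" using m by (simp add: mult_left_mono)
        then show ?thesis by (simp add: f_def)
      qed
      then have "\<forall>\<^sub>F n in sequentially. f n x = g x"
        unfolding eventually_sequentially by blast
      then show ?thesis by (rule tendsto_eventually)
    qed (simp add: f_def)
  qed
  then have *: "(\<lambda>n. ennreal (V (f n))) \<longlonglongrightarrow> ennreal (V g)"
    by (rule tendsto_ennrealI)
  have "ennreal (V (f n)) \<le> (suminf (\<lambda>i. open_content (U i)))" for n
  proof -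
    let ?p = "\<lambda>i x. g x * min 1 (real n * h i x)"
    have p_in: "?p i \<in> Cc_nonneg" for i
      by (rule Cc_nonneg_dominatedI[OF g])
         (auto simp: Cc_nonnegD[OF g] h_nonneg
               intro!: continuous_intros mult_nonneg_nonneg Cc_nonnegD[OF g]
                     continuous_on_subset[OF h_cont])
    have sub: "min 1 (\<Sum>i\<in>I. a i) \<le> (\<Sum>i\<in>I. min 1 (a i))"
      if "finite I" "\<And>i. 0 \<le> a i" for I :: "nat set" and a :: "nat \<Rightarrow> real"
      using that(1)
    proof (induction I)
      case (insert i I)
      have "0 \<le> (\<Sum>i\<in>I. min 1 (a i))" using that(2) by (intro sum_nonneg) auto
      then show ?case using insert that(2)[of i] by (auto simp: min_def split: if_splits)
    qed simp
    have "f n x \<le> (\<Sum>i<n. ?p i x)" for x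
      using mult_left_mono[OF sub[of "{..<n}" "\<lambda>i. real n * h i x"] Cc_nonnegD(2)[OF g, of x]]
      by (simp add: f_def sum_distrib_left h_nonneg)
    then have "V (f n) \<le> V (\<lambda>x. \<Sum>i<n. ?p i x)"
      by (intro V_mono f_in Cc_nonneg_sum p_in)
    also have "\<dots> = (\<Sum>i<n. V (?p i))" by (intro V_sum p_in) auto
    finally have "ennreal (V (f n)) \<le> ennreal (\<Sum>i<n. V (?p i))" by (rule ennreal_leI)
    also have "\<dots> = (\<Sum>i<n. ennreal (V (?p i)))"
      by (rule sum_ennreal[symmetric]) (rule V_nonneg[OF p_in])
    also have "\<dots> \<le> (\<Sum>i<n. open_content (U i))"
    proof (intro sum_mono open_content_upper p_in)
      fix i x
      have "g x \<le> 1" by (rule order_trans[OF gU indicator_le_1])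
      then show "?p i x \<le> indicator (U i) x"
        using Cc_nonnegD(2)[OF g, of x] h_nonneg[of i x] h_zero[of x i]
        by (auto simp: indicator_def intro!: mult_le_one)
    qed
    also have "\<dots> \<le> (suminf (\<lambda>i. open_content (U i)))" by (rule sum_le_suminf) auto
    finally show ?thesis .
  qed
  with * show "ennreal (V g) \<le> (suminf (\<lambda>i. open_content (U i)))"
    by (intro LIMSEQ_le_const2[OF *]) auto
qed

definition outer_content :: "'a set \<Rightarrow> ennreal" where
  "outer_content A = (INF U\<in>{U. open U \<and> A \<subseteq> U}. open_content U)"

lemma outer_content_lower: "open U \<Longrightarrow> A \<subseteq> U \<Longrightarrow> outer_content A \<le> open_content U"
  unfolding outer_content_def by (rule INF_lower) auto

lemma outer_content_greatest:
  assumes "\<And>U. open U \<Longrightarrow> A \<subseteq> U \<Longrightarrow> c \<le> open_content U"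
  shows "c \<le> outer_content A"
  unfolding outer_content_def using assms by (intro INF_greatest) auto

lemma outer_content_open: "open U \<Longrightarrow> outer_content U = open_content U"
  by (intro antisym outer_content_lower outer_content_greatest open_content_mono) auto

lemma outer_content_mono: "A \<subseteq> B \<Longrightarrow> outer_content A \<le> outer_content B"
  by (intro outer_content_greatest outer_content_lower) auto

lemma outer_measure_space_outer_content: "outer_measure_space (Pow UNIV) outer_content"
  unfolding outer_measure_space_def
proof (intro conjI)
  show "positive (Pow UNIV) outer_content"
    by (simp add: positive_def outer_content_open open_content_empty)
  show "increasing (Pow UNIV) outer_content"
    by (auto simp: increasing_def intro: outer_content_mono)
  show "countably_subadditive (Pow UNIV) outer_content"
    unfolding countably_subadditive_def
  proof (intro allI impI)
    fix A :: "nat \<Rightarrow> 'a set"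
    show "outer_content (\<Union>i. A i) \<le> (suminf (\<lambda>i. outer_content (A i)))"
    proof (rule ennreal_le_epsilon)
      fix e :: real assume e: "0 < e" and fin: "(suminf (\<lambda>i. outer_content (A i))) < top"
      have "\<exists>U. open U \<and> A i \<subseteq> U \<and> open_content U \<le> outer_content (A i) + ennreal (e * (1/2) ^ Suc i)" for i
      proof -
        have "outer_content (A i) < top"
          using fin by (rule ennreal_suminf_lessD)
        then have "outer_content (A i) < outer_content (A i) + ennreal (e * (1/2) ^ Suc i)"
          using e by (cases "outer_content (A i)") (auto simp: ennreal_less_iff simp flip: ennreal_plus)
        then show ?thesis
          unfolding outer_content_def INF_less_iff by (auto intro: less_imp_le)
      qed
      then obtain U where U: "\<And>i. open (U i)" "\<And>i. A i \<subseteq> U i"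
          "\<And>i. open_content (U i) \<le> outer_content (A i) + ennreal (e * (1/2) ^ Suc i)"
        by metis
      have "outer_content (\<Union>i. A i) \<le> open_content (\<Union>i. U i)"
        using U by (intro outer_content_lower) auto
      also have "\<dots> \<le> (suminf (\<lambda>i. open_content (U i)))" by (rule open_content_countably_subadditive[OF U(1)])
      also have "\<dots> \<le> (suminf (\<lambda>i. outer_content (A i) + ennreal (e * (1/2) ^ Suc i)))"
        by (intro suminf_le U) auto
      also have "\<dots> = (suminf (\<lambda>i. outer_content (A i))) + (suminf (\<lambda>i. ennreal (e * (1/2) ^ Suc i)))"
        by (rule suminf_add[symmetric]) auto
      also have "(suminf (\<lambda>i. ennreal (e * (1/2) ^ Suc i))) = ennreal e"
      proof -
        have "(\<lambda>i. e * (1/2) ^ Suc i) sums (e * 1)"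
          by (rule sums_mult[OF power_half_series])
        then show ?thesis using e by (intro suminf_ennreal_eq) auto
      qed
      finally show "outer_content (\<Union>i. A i) \<le> (suminf (\<lambda>i. outer_content (A i))) + ennreal e" .
    qed
  qed
qed

text \<open>
  The point is the inequality for open \<open>W\<close>.  A function \<open>g\<close> below the indicator of \<open>U \<inter> W\<close> is replaced by its
  truncation \<open>max 0 (g - 1/(n+1))\<close>, which vanishes on the open set \<open>W' = W \<inter> {g < 1/(n+1)}\<close>.  As \<open>W'\<close>
  contains \<open>W - U\<close>, functions that compete for the content of \<open>W'\<close> may be added to the truncation
  without exceeding the indicator of \<open>W\<close>.
\<close>

lemma open_in_lambda_system:
  assumes U: "open U"
  shows "U \<in> lambda_system UNIV (Pow UNIV) outer_content"
proof -
  have sub: "outer_content A \<le> outer_content (U \<inter> A) + outer_content ((UNIV - U) \<inter> A)" for A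
  proof -
    have sa: "subadditive (Pow UNIV) outer_content"
      using outer_measure_space_outer_content
      by (intro ring_of_sets.countably_subadditive_subadditive[OF ring_of_sets_Pow])
         (auto simp: outer_measure_space_def)
    have "outer_content ((U \<inter> A) \<union> ((UNIV - U) \<inter> A))
        \<le> outer_content (U \<inter> A) + outer_content ((UNIV - U) \<inter> A)"
      using sa by (rule subadditiveD) auto
    moreover have "(U \<inter> A) \<union> ((UNIV - U) \<inter> A) = A" by blast
    ultimately show ?thesis by simp
  qed
  have open_case: "open_content (U \<inter> W) + outer_content ((UNIV - U) \<inter> W) \<le> open_content W"
    if W: "open W" for W
  proof -
    let ?c = "outer_content ((UNIV - U) \<inter> W)"
    have "ennreal (V g) + ?c \<le> open_content W"
      if g: "g \<in> Cc_nonneg" "\<And>x. g x \<le> indicator (U \<inter> W) x" for g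
    proof -
      define t where "t n x = max 0 (g x - inverse (real (Suc n)))" for n x
      have t_in: "t n \<in> Cc_nonneg" for n
        by (rule Cc_nonneg_dominatedI[OF g(1)])
           (auto simp: t_def[abs_def] intro!: continuous_intros Cc_nonnegD[OF g(1)])
      have "ennreal (V (t n)) + ?c \<le> open_content W" for n
      proof -
        define W' where "W' = W \<inter> {x. g x < inverse (real (Suc n))}"
        have W': "open W'"
          unfolding W'_def by (intro open_Int W open_Collect_less continuous_intros Cc_nonnegD[OF g(1)])
        have "?c \<le> open_content W'"
        proof (rule outer_content_lower[OF W'])
          have "g x < inverse (real (Suc n))" if "x \<notin> U" for x
          proof -
            have "g x \<le> 0" using g(2)[of x] that by simp
            also have "0 < inverse (real (Suc n))" by simp
            finally show ?thesis .
          qed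
          then show "(UNIV - U) \<inter> W \<subseteq> W'" by (auto simp: W'_def)
        qed
        then have "ennreal (V (t n)) + ?c \<le> ennreal (V (t n)) + open_content W'"
          by (rule add_left_mono)
        also have "\<dots> = (SUP k\<in>{k\<in>Cc_nonneg. \<forall>x. k x \<le> indicator W' x}. ennreal (V (t n)) + ennreal (V k))"
          unfolding open_content_def
          by (subst ennreal_SUP_add_right) (auto intro!: exI[of _ "\<lambda>x. 0"] Cc_nonneg_zero)
        also have "\<dots> \<le> open_content W"
        proof (rule SUP_least)
          fix k assume "k \<in> {k\<in>Cc_nonneg. \<forall>x. k x \<le> indicator W' x}"
          then have k: "k \<in> Cc_nonneg" "\<And>x. k x \<le> indicator W' x" by auto
          have "ennreal (V (t n)) + ennreal (V k) = ennreal (V (\<lambda>x. t n x + k x))"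
            using V_nonneg[OF t_in, of n] V_nonneg[OF k(1)] by (simp add: V_add t_in k)
          also have "\<dots> \<le> open_content W"
          proof (rule open_content_upper[OF Cc_nonneg_add[OF t_in k(1)]])
            fix x
            show "t n x + k x \<le> indicator W x"
            proof (cases "x \<in> W'")
              case True
              then show ?thesis using k(2)[of x] by (simp add: t_def W'_def)
            next
              case False
              have "t n x \<le> g x" using Cc_nonnegD(2)[OF g(1), of x] by (simp add: t_def)
              also have "\<dots> \<le> indicator (U \<inter> W) x" by (rule g)
              also have "\<dots> \<le> indicator W x" by (simp add: indicator_def)
              finally show ?thesis using k(2)[of x] False by simp
            qed
          qed
          finally show "ennreal (V (t n)) + ennreal (V k) \<le> open_content W" .
        qed
        finally show ?thesis .
      qed
      moreover have "(\<lambda>n. ennreal (V (t n)) + ?c) \<longlonglongrightarrow> ennreal (V g) + ?c"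
      proof (intro tendsto_add tendsto_const tendsto_ennrealI V_monotone_limit[OF g(1) t_in])
        show "t n x \<le> t (Suc n) x" for n x
        proof -
          have "inverse (real (Suc (Suc n))) \<le> inverse (real (Suc n))"
            by (intro le_imp_inverse_le) auto
          then show ?thesis unfolding t_def by (intro max.mono) auto
        qed
        show "(\<lambda>n. t n x) \<longlonglongrightarrow> g x" for x
        proof -
          have "(\<lambda>n. t n x) \<longlonglongrightarrow> max 0 (g x - 0)"
            unfolding t_def by (intro tendsto_intros LIMSEQ_inverse_real_of_nat)
          then show ?thesis
            using Cc_nonnegD(2)[OF g(1), of x] by (simp add: max_absorb2)
        qed
      qed
      ultimately show ?thesis by (intro LIMSEQ_le_const2) auto
    qed
    then have "(SUP g\<in>{g\<in>Cc_nonneg. \<forall>x. g x \<le> indicator (U \<inter> W) x}. ennreal (V g) + ?c) \<le> open_content W"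
      by (intro SUP_least) auto
    then show ?thesis
      unfolding open_content_def[of "U \<inter> W"]
      by (subst (asm) ennreal_SUP_add_left) (auto intro!: exI[of _ "\<lambda>x. 0"] Cc_nonneg_zero)
  qed
  have "outer_content (U \<inter> A) + outer_content ((UNIV - U) \<inter> A) \<le> outer_content A" for A
  proof (rule outer_content_greatest)
    fix W assume W: "open W" "A \<subseteq> W"
    have "outer_content (U \<inter> A) + outer_content ((UNIV - U) \<inter> A)
        \<le> open_content (U \<inter> W) + outer_content ((UNIV - U) \<inter> W)"
      using W U by (intro add_mono outer_content_lower outer_content_mono) auto
    also have "\<dots> \<le> open_content W" by (rule open_case[OF W(1)])
    finally show "outer_content (U \<inter> A) + outer_content ((UNIV - U) \<inter> A) \<le> open_content W" .
  qed
  with sub show ?thesis by (auto simp: lambda_system_def intro: antisym)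
qed

definition content_measure :: "'a measure" where
  "content_measure = measure_of UNIV (sets borel) outer_content"

lemma sets_content_measure [measurable_cong]: "sets content_measure = sets borel"
  using sets.sigma_sets_eq[of "borel :: 'a measure"]
  by (simp add: content_measure_def sets_measure_of)

lemma emeasure_content_measure_open:
  assumes "open U"
  shows "emeasure content_measure U = open_content U"
proof -
  let ?L = "lambda_system UNIV (Pow UNIV) outer_content"
  have L: "measure_space UNIV ?L outer_content"
    by (rule sigma_algebra.caratheodory_lemma[OF sigma_algebra_Pow outer_measure_space_outer_content])
  have "sigma_sets UNIV {S. open S} \<subseteq> ?L"
    using L open_in_lambda_system
    by (intro sigma_algebra.sigma_sets_subset) (auto simp: measure_space_def)
  then have bL: "sets borel \<subseteq> ?L"
    by (simp add: sets_borel)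
  have "emeasure (measure_of UNIV (sets borel) outer_content) U = outer_content U"
  proof (rule emeasure_measure_of_sigma)
    show "sigma_algebra UNIV (sets borel :: 'a set set)"
      using sets.sigma_algebra_axioms[of borel] by simp
    show "positive (sets borel) outer_content"
      using L by (auto simp: measure_space_def positive_def)
    show "countably_additive (sets borel) outer_content"
      using L bL unfolding measure_space_def countably_additive_def by blast
    show "U \<in> sets borel" using assms by simp
  qed
  then show ?thesis
    using assms by (simp add: content_measure_def outer_content_open)
qed

lemma content_measure_bounded_finite:
  assumes "bounded A" "A \<in> sets borel"
  shows "emeasure content_measure A < \<infinity>"
proof -
  obtain R where R: "0 < R" "\<And>x. x \<in> A \<Longrightarrow> norm x < R"
    using assms(1) by (auto simp: bounded_pos_less)
  have "emeasure content_measure A \<le> emeasure content_measure (ball 0 R)"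
    using R assms by (intro emeasure_mono) (auto simp: sets_content_measure)
  also have "\<dots> = open_content (ball 0 R)" by (simp add: emeasure_content_measure_open)
  also have "\<dots> \<le> ennreal (V (cutoff R))"
  proof (rule open_content_least)
    fix g :: "'a \<Rightarrow> real" assume g: "g \<in> Cc_nonneg" "\<And>x. g x \<le> indicator (ball 0 R) x"
    have "g x \<le> cutoff R x" for x
      using g(2)[of x] cutoff_eq_1[of x R] cutoff_bounds(1)[of R x]
      by (cases "norm x < R") auto
    then show "ennreal (V g) \<le> ennreal (V (cutoff R))"
      by (intro ennreal_leI V_mono g cutoff_in_Cc_nonneg)
  qed
  also have "\<dots> < \<infinity>" by simp
  finally show ?thesis .
qed

end

text \<open>
  The summands are the parts of \<open>g\<close> between the heights \<open>k d\<close> and \<open>(k + 1) d\<close>.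
\<close>

lemma layer_sum:
  fixes g :: real
  assumes "0 \<le> g" "0 < d"
  shows "(\<Sum>k<N. min (max (g - real k * d) 0) d) = min g (real N * d)"
proof (induction N)
  case (Suc N)
  then show ?case using assms by (auto simp: min_def max_def algebra_simps)
qed (use assms in auto)

text \<open>
  Divided by \<open>d\<close>, a layer of \<open>g\<close> lies between the indicators of two consecutive superlevel sets.  So any
  functional that respects such sandwiches lies between two Riemann sums of the layer cake formula; the
  representation theorem compares the given functional and the integral in this way.
\<close>

lemma (in positive_functional) layer_estimate:
  fixes d :: real
  assumes g: "g \<in> Cc_nonneg" and d: "0 < d" and N: "\<And>x. g x \<le> real N * d"
    and sandwich: "\<And>f U W. f \<in> Cc_nonneg \<Longrightarrow> open U \<Longrightarrow> bounded U \<Longrightarrow> open W \<Longrightarrow> bounded W \<Longrightarrow>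
      (\<And>x. indicator W x \<le> f x) \<Longrightarrow> (\<And>x. f x \<le> indicator U x) \<Longrightarrow>
      measure M W \<le> V f \<and> V f \<le> measure M U"
  shows "(\<Sum>k<N. d * measure M {x. real (Suc k) * d < g x}) \<le> V g"
    and "V g \<le> (\<Sum>k<N. d * measure M {x. real k * d < g x})"
proof -
  let ?l = "\<lambda>k x. min (max (g x - real k * d) 0) d"
  let ?s = "\<lambda>k::nat. {x. real k * d < g x}"
  have l_in: "?l k \<in> Cc_nonneg" for k
    using d by (intro Cc_nonneg_dominatedI[OF g])
       (auto intro!: continuous_intros Cc_nonnegD[OF g])
  have op: "open (?s k)" for k
    by (intro open_Collect_less continuous_intros Cc_nonnegD[OF g])
  have bd: "bounded (?s k)" for k
    by (rule bounded_subset[OF Cc_nonnegD(3)[OF g]]) (use d in \<open>auto simp: not_less mult_less_0_iff\<close>)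
  have "V g = V (\<lambda>x. \<Sum>k<N. ?l k x)"
    using layer_sum[OF Cc_nonnegD(2)[OF g] d] N by (simp add: min_def)
  also have "\<dots> = (\<Sum>k<N. V (?l k))" by (intro V_sum l_in) auto
  finally have Vg: "V g = (\<Sum>k<N. V (?l k))" .
  have *: "measure M (?s (Suc k)) \<le> V (\<lambda>x. inverse d * ?l k x) \<and>
      V (\<lambda>x. inverse d * ?l k x) \<le> measure M (?s k)" for k
  proof (rule sandwich[OF _ op bd op bd])
    show "(\<lambda>x. inverse d * ?l k x) \<in> Cc_nonneg"
      using d by (intro Cc_nonneg_scale l_in) auto
    show "indicator (?s (Suc k)) x \<le> inverse d * ?l k x" for x
      using d by (cases "x \<in> ?s (Suc k)") (auto simp: min_def max_def field_simps)
    show "inverse d * ?l k x \<le> indicator (?s k) x" for x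
      using d by (cases "x \<in> ?s k") (auto simp: min_def max_def field_simps)
  qed
  have **: "d * measure M (?s (Suc k)) \<le> V (?l k) \<and> V (?l k) \<le> d * measure M (?s k)" for k
  proof -
    have "V (\<lambda>x. inverse d * ?l k x) = V (?l k) / d"
      using d by (subst V_scale[OF l_in]) (auto simp: divide_inverse mult.commute)
    with *[of k] show ?thesis
      using d by (simp only: pos_le_divide_eq pos_divide_le_eq mult.commute)
  qed
  show "(\<Sum>k<N. d * measure M (?s (Suc k))) \<le> V g" "V g \<le> (\<Sum>k<N. d * measure M (?s k))"
    unfolding Vg using ** by (auto intro: sum_mono)
qed

lemma Cc_nonneg_integrable:
  fixes g :: "'a::euclidean_space \<Rightarrow> real"
  assumes M: "sets M = sets borel" "\<And>K. compact K \<Longrightarrow> emeasure M K < \<infinity>" and g: "g \<in> Cc_nonneg"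
  shows "integrable M g"
proof -
  obtain B where B: "0 < B" "\<And>x. g x \<le> B" using Cc_nonneg_bounded_above[OF g] by blast
  obtain R where R: "0 < R" "\<And>x. g x \<noteq> 0 \<Longrightarrow> norm x \<le> R"
    using Cc_nonneg_support_radius[OF g] by blast
  have [measurable]: "g \<in> borel_measurable M"
    using borel_measurable_continuous_onI[OF Cc_nonnegD(1)[OF g]] M(1)
    by (simp cong: measurable_cong_sets)
  have "integrable M (\<lambda>x. B * indicator (cball 0 R) x :: real)"
    using M(2)[of "cball 0 R"] by (simp add: M(1))
  then show ?thesis
  proof (rule Bochner_Integration.integrable_bound)
    show "AE x in M. norm (g x) \<le> norm (B * indicator (cball 0 R) x)"
    proof (rule AE_I2)
      fix x
      show "norm (g x) \<le> norm (B * indicator (cball 0 R) x)"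
        using B R(2)[of x] Cc_nonnegD(2)[OF g, of x] by (cases "g x = 0") auto
    qed
  qed simp
qed

lemma positive_functional_integral:
  fixes M :: "'a::euclidean_space measure"
  assumes M: "sets M = sets borel" "\<And>K. compact K \<Longrightarrow> emeasure M K < \<infinity>"
  shows "positive_functional (\<lambda>g. \<integral>x. g x \<partial>M)"
proof
  have int: "integrable M g" if "g \<in> Cc_nonneg" for g :: "'a \<Rightarrow> real"
    by (rule Cc_nonneg_integrable[OF M that])
  fix f g :: "'a \<Rightarrow> real" and c :: real
  assume g: "g \<in> Cc_nonneg"
  show "0 \<le> (\<integral>x. g x \<partial>M)" using Cc_nonnegD(2)[OF g] by simp
  show "(\<integral>x. c * g x \<partial>M) = c * (\<integral>x. g x \<partial>M)" by simp
  show "(\<integral>x. f x + g x \<partial>M) = (\<integral>x. f x \<partial>M) + (\<integral>x. g x \<partial>M)" if "f \<in> Cc_nonneg"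
    using int[OF that] int[OF g] by simp
qed

theorem (in positive_functional) riesz_representation:
  "\<exists>M. sets M = sets borel \<and> (\<forall>K. compact K \<longrightarrow> emeasure M K < \<infinity>) \<and>
       (\<forall>g\<in>Cc_nonneg. V g = (\<integral>x. g x \<partial>M))"
proof (intro exI conjI allI impI ballI)
  let ?M = content_measure
  show sets: "sets ?M = sets borel" by (rule sets_content_measure)
  show fin: "emeasure ?M K < \<infinity>" if "compact K" for K
    using that by (intro content_measure_bounded_finite) (auto simp: compact_imp_bounded compact_imp_closed borel_closed)
  interpret I: positive_functional "\<lambda>g. \<integral>x. g x \<partial>?M"
    by (rule positive_functional_integral[OF sets fin])
  have em: "emeasure ?M U = ennreal (measure ?M U)" if "open U" "bounded U" for U
    using content_measure_bounded_finite[of U] that by (intro emeasure_eq_ennreal_measure) auto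
  have sandwich_V: "measure ?M W \<le> V f \<and> V f \<le> measure ?M U"
    if f: "f \<in> Cc_nonneg" and U: "open U" "bounded U" and W: "open W" "bounded W"
      and le: "\<And>x. indicator W x \<le> f x" "\<And>x. f x \<le> indicator U x" for f U W
  proof
    have "ennreal (measure ?M W) = open_content W"
      using em[OF W] emeasure_content_measure_open[OF W(1)] by simp
    also have "\<dots> \<le> ennreal (V f)"
      by (rule open_content_least) (intro ennreal_leI V_mono f, assumption, rule order_trans[OF _ le(1)])
    finally show "measure ?M W \<le> V f" using V_nonneg[OF f] by simp
    have "ennreal (V f) \<le> open_content U" by (rule open_content_upper[OF f le(2)])
    also have "\<dots> = ennreal (measure ?M U)"
      using em[OF U] emeasure_content_measure_open[OF U(1)] by simp
    finally show "V f \<le> measure ?M U" by simp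
  qed
  have sandwich_I: "measure ?M W \<le> (\<integral>x. f x \<partial>?M) \<and> (\<integral>x. f x \<partial>?M) \<le> measure ?M U"
    if f: "f \<in> Cc_nonneg" and U: "open U" "bounded U" and W: "open W" "bounded W"
      and le: "\<And>x. indicator W x \<le> f x" "\<And>x. f x \<le> indicator U x" for f U W
  proof
    have int: "integrable ?M f" by (rule Cc_nonneg_integrable[OF sets fin f])
    have ind: "integrable ?M (indicator A :: 'a \<Rightarrow> real)" "(\<integral>x. indicator A x \<partial>?M) = measure ?M A"
      if "open A" "bounded A" for A
      using content_measure_bounded_finite[of A] that by (auto simp: sets)
    show "measure ?M W \<le> (\<integral>x. f x \<partial>?M)"
      unfolding ind(2)[OF W, symmetric] by (intro integral_mono ind W int le)
    show "(\<integral>x. f x \<partial>?M) \<le> measure ?M U"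
      unfolding ind(2)[OF U, symmetric] by (intro integral_mono ind U int le)
  qed
  fix g :: "'a \<Rightarrow> real" assume g: "g \<in> Cc_nonneg"
  obtain B where B: "0 < B" "\<And>x. g x \<le> B" using Cc_nonneg_bounded_above[OF g] by blast
  let ?m = "measure ?M {x. 0 < g x}"
  \<comment> \<open>The upper and the lower Riemann sum differ by a telescoping sum.\<close>
  have est: "\<bar>V g - (\<integral>x. g x \<partial>?M)\<bar> \<le> d * ?m" if d: "0 < d" for d
  proof -
    obtain N where "B / d < real N" using reals_Archimedean2 by blast
    then have "B < real N * d" using d by (simp add: field_simps)
    then have N: "g x \<le> real N * d" for x using B(2)[of x] by simp
    let ?s = "\<lambda>k::nat. d * measure ?M {x. real k * d < g x}"
    have V: "(\<Sum>k<N. ?s (Suc k)) \<le> V g" "V g \<le> (\<Sum>k<N. ?s k)"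
      by (rule layer_estimate[OF g d N], rule sandwich_V; assumption)+
    have I: "(\<Sum>k<N. ?s (Suc k)) \<le> (\<integral>x. g x \<partial>?M)" "(\<integral>x. g x \<partial>?M) \<le> (\<Sum>k<N. ?s k)"
      by (rule I.layer_estimate[OF g d N], rule sandwich_I; assumption)+
    have "\<bar>V g - (\<integral>x. g x \<partial>?M)\<bar> \<le> (\<Sum>k<N. ?s k) - (\<Sum>k<N. ?s (Suc k))"
      using V I by simp
    also have "\<dots> = (\<Sum>k<N. ?s k - ?s (Suc k))" by (simp add: sum_subtractf)
    also have "\<dots> = ?s 0 - ?s N" by (rule sum_lessThan_telescope')
    also have "\<dots> \<le> d * ?m" using d by simp
    finally show ?thesis .
  qed
  have "\<bar>V g - (\<integral>x. g x \<partial>?M)\<bar> \<le> 0 + e" if e: "0 < e" for e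
  proof -
    have "\<bar>V g - (\<integral>x. g x \<partial>?M)\<bar> \<le> e / (?m + 1) * ?m"
      using e by (intro est divide_pos_pos) (auto intro: add_nonneg_pos)
    also have "\<dots> = e * (?m / (?m + 1))" by simp
    also have "\<dots> \<le> e * 1"
      using e by (intro mult_left_mono) (auto simp: divide_le_eq_1 add_nonneg_pos)
    finally show ?thesis by simp
  qed
  then have "\<bar>V g - (\<integral>x. g x \<partial>?M)\<bar> \<le> 0" by (rule field_le_epsilon)
  then show "V g = (\<integral>x. g x \<partial>?M)" by simp
qed

text \<open>
  The indicator of a compact set is a decreasing limit of functions of compact support, so the
  integrals determine the masses of compact sets, and these generate the Borel sets.
\<close>

lemma measure_eqI_Cc_nonneg:
  fixes M N :: "'a::euclidean_space measure"
  assumes M: "sets M = sets borel" "\<And>K. compact K \<Longrightarrow> emeasure M K < \<infinity>"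
    and N: "sets N = sets borel" "\<And>K. compact K \<Longrightarrow> emeasure N K < \<infinity>"
    and eq: "\<And>g. g \<in> Cc_nonneg \<Longrightarrow> (\<integral>x. g x \<partial>M) = (\<integral>x. g x \<partial>N)"
  shows "M = N"
proof (rule measure_eqI_generator_eq[where E = "{K. compact K}" and \<Omega> = UNIV and A = "\<lambda>n. cball 0 (real n)"])
  show "Int_stable {K::'a set. compact K}" by (auto simp: Int_stable_def)
  have "sigma_sets UNIV {K::'a set. compact K} = sets borel"
  proof
    show "sigma_sets UNIV {K::'a set. compact K} \<subseteq> sets borel"
      using sets.sigma_sets_subset[of "{K::'a set. compact K}" borel] borel_compact by auto
    have "sigma_sets UNIV {C::'a set. closed C} \<subseteq> sigma_sets UNIV {K::'a set. compact K}"
    proof (rule sigma_sets_mono, rule subsetI)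
      fix C :: "'a set" assume "C \<in> {C. closed C}"
      then have "compact (C \<inter> cball 0 (real n))" for n by (auto intro: closed_Int_compact)
      then have "(\<Union>n. C \<inter> cball 0 (real n)) \<in> sigma_sets UNIV {K::'a set. compact K}"
        by (intro sigma_sets.Union sigma_sets.Basic) auto
      moreover have "(\<Union>n. C \<inter> cball 0 (real n)) = C" by (auto intro: real_arch_simple)
      ultimately show "C \<in> sigma_sets UNIV {K::'a set. compact K}" by simp
    qed
    then show "sets borel \<subseteq> sigma_sets UNIV {K::'a set. compact K}"
      by (simp add: borel_eq_closed)
  qed
  then show "sets M = sigma_sets UNIV {K. compact K}" "sets N = sigma_sets UNIV {K. compact K}"
    using M N by auto
  show "range (\<lambda>n. cball (0::'a) (real n)) \<subseteq> {K. compact K}" by auto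
  show "(\<Union>n. cball (0::'a) (real n)) = UNIV" by (auto intro: real_arch_simple)
  show "emeasure M (cball 0 (real n)) \<noteq> \<infinity>" for n using M(2)[OF compact_cball, of 0 "real n"] by auto
  fix K :: "'a set" assume "K \<in> {K. compact K}"
  then have K: "compact K" by simp
  show "emeasure M K = emeasure N K"
  proof (cases "K = {}")
    case False
    obtain R where R: "0 < R" "\<And>x. x \<in> K \<Longrightarrow> norm x \<le> R"
      using compact_imp_bounded[OF K] by (auto simp: bounded_pos)
    define f where "f n x = cutoff R x * max 0 (1 - real n * infdist x K)" for n x
    have f_in: "f n \<in> Cc_nonneg" for n
      by (rule Cc_nonneg_dominatedI[OF cutoff_in_Cc_nonneg[of R]])
         (auto simp: f_def[abs_def] cutoff_bounds intro!: continuous_intros continuous_on_cutoff)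
    have lim: "(\<lambda>n. f n x) \<longlonglongrightarrow> indicator K x" for x
    proof (cases "x \<in> K")
      case True
      then show ?thesis using R by (simp add: f_def cutoff_eq_1)
    next
      case False
      then have "infdist x K \<noteq> 0"
        using in_closed_iff_infdist_zero[OF compact_imp_closed[OF K] \<open>K \<noteq> {}\<close>] by auto
      then have "0 < infdist x K" using infdist_nonneg[of x K] by simp
      then obtain m where m: "1 < real m * infdist x K" using reals_Archimedean3 by blast
      have "f n x = 0" if "m \<le> n" for n
      proof -
        have "real m * infdist x K \<le> real n * infdist x K"
          using that infdist_nonneg by (intro mult_right_mono) auto
        then show ?thesis using m by (simp add: f_def)
      qed
      then have "\<forall>\<^sub>F n in sequentially. f n x = 0" unfolding eventually_sequentially by blast
      then show ?thesis using False by (simp add: tendsto_eventually)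
    qed
    have "(\<lambda>n. \<integral>x. f n x \<partial>L) \<longlonglongrightarrow> measure L K"
      if L: "sets L = sets borel" "\<And>K. compact K \<Longrightarrow> emeasure L K < \<infinity>" for L
    proof -
      have KL: "K \<in> sets L" using K by (simp add: L compact_imp_closed borel_closed)
      have "(\<lambda>n. \<integral>x. f n x \<partial>L) \<longlonglongrightarrow> (\<integral>x. indicator K x \<partial>L)"
      proof (rule integral_dominated_convergence[where w = "cutoff R"])
        show "integrable L (cutoff R :: 'a \<Rightarrow> real)"
          by (rule Cc_nonneg_integrable[OF L cutoff_in_Cc_nonneg])
        show "f n \<in> borel_measurable L" for n
          using Cc_nonneg_integrable[OF L f_in] by auto
        show "(indicator K :: 'a \<Rightarrow> real) \<in> borel_measurable L" using KL by simp
        show "AE x in L. (\<lambda>n. f n x) \<longlonglongrightarrow> indicator K x" using lim by simp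
        show "AE x in L. norm (f n x) \<le> cutoff R x" for n
          using infdist_nonneg[of _ K]
          by (intro AE_I2) (auto simp: f_def abs_mult cutoff_bounds intro!: mult_left_le)
      qed
      then show ?thesis using KL L(2)[OF K] by simp
    qed
    from this[OF M] this[OF N] have "measure M K = measure N K"
      by (simp add: eq[OF f_in]) (rule LIMSEQ_unique)
    then show ?thesis
      using M(2)[OF K] N(2)[OF K] by (simp add: emeasure_eq_ennreal_measure)
  qed simp
qed auto

section \<open>The total variation of a Radon measure\<close>

lemma Cc_iff:
  fixes f :: "'a::euclidean_space \<Rightarrow> complex"
  shows "f \<in> Cc \<longleftrightarrow> continuous_on UNIV f \<and> bounded {x. f x \<noteq> 0}"
  by (simp add: Cc_def fun_support_def)

lemma CcD:
  fixes f :: "'a::euclidean_space \<Rightarrow> complex"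
  assumes "f \<in> Cc"
  shows "continuous_on UNIV f" "bounded {x. f x \<noteq> 0}"
  using assms by (auto simp: Cc_iff)

lemma Cc_zero: "(\<lambda>x::'a::euclidean_space. 0) \<in> Cc"
  by (simp add: Cc_iff)

lemma Cc_lincomb:
  fixes f g :: "'a::euclidean_space \<Rightarrow> complex"
  assumes "f \<in> Cc" "g \<in> Cc"
  shows "(\<lambda>x. a * f x + b * g x) \<in> Cc"
proof -
  have "bounded ({x. f x \<noteq> 0} \<union> {x. g x \<noteq> 0})" using assms by (simp add: CcD)
  then have "bounded {x. a * f x + b * g x \<noteq> 0}" by (rule bounded_subset) auto
  then show ?thesis using assms by (simp add: Cc_iff continuous_intros)
qed

lemma Cc_of_Cc_nonneg: "g \<in> Cc_nonneg \<Longrightarrow> (\<lambda>x. complex_of_real (g x)) \<in> Cc"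
  by (auto simp: Cc_iff Cc_nonneg_def intro!: continuous_intros)

lemma Cc_nonneg_of_Cc:
  fixes f :: "'a::euclidean_space \<Rightarrow> complex"
  assumes "f \<in> Cc" "continuous_on UNIV g" "\<And>x. 0 \<le> g x" "\<And>x. f x = 0 \<Longrightarrow> g x = 0"
  shows "g \<in> Cc_nonneg"
proof -
  have "bounded {x. g x \<noteq> 0}"
    by (rule bounded_subset[OF CcD(2)[OF assms(1)]]) (use assms(4) in auto)
  then show ?thesis using assms by (simp add: Cc_nonneg_def)
qed

lemma Cc_nonneg_parts:
  fixes f :: "'a::euclidean_space \<Rightarrow> complex"
  assumes "f \<in> Cc"
  shows "(\<lambda>x. cmod (f x)) \<in> Cc_nonneg"
    and "(\<lambda>x. max 0 (Re (f x))) \<in> Cc_nonneg" "(\<lambda>x. max 0 (- Re (f x))) \<in> Cc_nonneg"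
    and "(\<lambda>x. max 0 (Im (f x))) \<in> Cc_nonneg" "(\<lambda>x. max 0 (- Im (f x))) \<in> Cc_nonneg"
  by (rule Cc_nonneg_of_Cc[OF assms]; auto intro!: continuous_intros CcD(1)[OF assms])+

lemma Cc_times_continuous:
  fixes f :: "'a::euclidean_space \<Rightarrow> complex"
  assumes "f \<in> Cc" "continuous_on UNIV h"
  shows "(\<lambda>x. h x * f x) \<in> Cc"
proof -
  have "bounded {x. h x * f x \<noteq> 0}"
    by (rule bounded_subset[OF CcD(2)[OF assms(1)]]) auto
  then show ?thesis using assms by (simp add: Cc_iff continuous_intros)
qed

lemma cutoff_mult_in_Cc:
  fixes \<psi> :: "'a::euclidean_space \<Rightarrow> complex"
  assumes "continuous_on UNIV \<psi>"
  shows "(\<lambda>x. complex_of_real (cutoff R x) * \<psi> x) \<in> Cc"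
  using Cc_times_continuous[OF Cc_of_Cc_nonneg[OF cutoff_in_Cc_nonneg] assms]
  by (simp add: mult.commute)

lemma clinear_onD:
  "clinear_on S T \<Longrightarrow> f \<in> S \<Longrightarrow> g \<in> S \<Longrightarrow> T (\<lambda>x. a * f x + b * g x) = a * T f + b * T g"
  unfolding clinear_on_def by blast

lemma clinear_on_scale: "clinear_on S T \<Longrightarrow> f \<in> S \<Longrightarrow> T (\<lambda>x. a * f x) = a * T f"
  using clinear_onD[of S T f f a 0] by simp

lemma clinear_on_add: "clinear_on S T \<Longrightarrow> f \<in> S \<Longrightarrow> g \<in> S \<Longrightarrow> T (\<lambda>x. f x + g x) = T f + T g"
  using clinear_onD[of S T f g 1 1] by simp

lemma clinear_on_diff: "clinear_on S T \<Longrightarrow> f \<in> S \<Longrightarrow> g \<in> S \<Longrightarrow> T (\<lambda>x. f x - g x) = T f - T g"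
  using clinear_onD[of S T f g 1 "-1"] by simp

lemma clinear_on_zero: "clinear_on S T \<Longrightarrow> f \<in> S \<Longrightarrow> T (\<lambda>x. 0) = 0"
  using clinear_on_scale[of S T f 0] by simp

lemma Cc_zero_nhd_Cc: "Cc_zero_nhd (Cc :: ('a::euclidean_space \<Rightarrow> complex) set)"
  unfolding Cc_zero_nhd_def absolutely_convex_def
  by (auto intro: Cc_lincomb exI[of _ 1])

lemma topspace_Cc_topology: "topspace Cc_topology = (Cc :: ('a::euclidean_space \<Rightarrow> complex) set)"
proof
  have "Cc_open (Cc :: ('a \<Rightarrow> complex) set)"
    unfolding Cc_open_def
  proof (intro conjI ballI order_refl exI)
    fix f g :: "'a \<Rightarrow> complex" assume "f \<in> Cc" "g \<in> Cc"
    then show "(\<lambda>x. f x + g x) \<in> Cc" using Cc_lincomb[of f g 1 1] by simp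
  qed (rule Cc_zero_nhd_Cc)
  then show "(Cc :: ('a \<Rightarrow> complex) set) \<subseteq> topspace Cc_topology"
    by (intro openin_subset) (simp add: openin_Cc_topology)
  have "Cc_open (topspace Cc_topology :: ('a \<Rightarrow> complex) set)"
    using openin_topspace[of Cc_topology] by (simp only: openin_Cc_topology)
  then show "topspace Cc_topology \<subseteq> (Cc :: ('a \<Rightarrow> complex) set)"
    unfolding Cc_open_def by (rule conjunct1)
qed

text \<open>
  A neighbourhood of \<open>0\<close> on which \<open>\<bar>\<mu>\<bar> < 1\<close> contains all small functions supported in the ball; rescaling
  gives the bound.  This is the only use of the inductive limit topology for a given measure.
\<close>

lemma radon_measure_bounded_on_cball:
  fixes \<mu> :: "('a::euclidean_space \<Rightarrow> complex) \<Rightarrow> complex"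
  assumes "radon_measure \<mu>"
  obtains C where "0 < C"
    "\<And>f b. f \<in> Cc \<Longrightarrow> (\<And>x. f x \<noteq> 0 \<Longrightarrow> norm x \<le> R) \<Longrightarrow> (\<And>x. cmod (f x) \<le> b) \<Longrightarrow> cmod (\<mu> f) \<le> C * b"
proof -
  have lin: "clinear_on Cc \<mu>" and cont: "continuous_map Cc_topology euclidean \<mu>"
    using assms by (auto simp: radon_measure_def)
  have "openin Cc_topology {f \<in> topspace Cc_topology. \<mu> f \<in> ball 0 1}"
    by (rule openin_continuous_map_preimage[OF cont]) simp
  then have op: "Cc_open {f \<in> Cc. \<mu> f \<in> ball 0 1}"
    by (simp add: openin_Cc_topology topspace_Cc_topology)
  have zero: "(\<lambda>x. 0) \<in> {f \<in> Cc. \<mu> f \<in> ball 0 1}"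
    using clinear_on_zero[OF lin Cc_zero] by (simp add: Cc_zero)
  from bspec[OF conjunct2[OF op[unfolded Cc_open_def]] zero] obtain N where N: "Cc_zero_nhd N"
      "\<forall>g\<in>N. (\<lambda>x. 0 + g x) \<in> {f \<in> Cc. \<mu> f \<in> ball 0 1}"
    by (elim exE conjE)
  have "compact (cball (0::'a) R)" by simp
  then have "\<exists>e>0. \<forall>f\<in>Cc. fun_support f \<subseteq> cball 0 R \<and> (\<forall>x. cmod (f x) \<le> e) \<longrightarrow> f \<in> N"
    using N(1) by (simp add: Cc_zero_nhd_def)
  then obtain e where e: "0 < e"
      "\<And>f. f \<in> Cc \<Longrightarrow> fun_support f \<subseteq> cball 0 R \<Longrightarrow> (\<And>x. cmod (f x) \<le> e) \<Longrightarrow> f \<in> N"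
    by blast
  show thesis
  proof (rule that[of "1 / e"])
    fix f :: "'a \<Rightarrow> complex" and b :: real
    assume f: "f \<in> Cc" "\<And>x. f x \<noteq> 0 \<Longrightarrow> norm x \<le> R" "\<And>x. cmod (f x) \<le> b"
    have "0 \<le> cmod (f 0)" by simp
    also have "\<dots> \<le> b" by (rule f)
    finally consider "b = 0" | "0 < b" by linarith
    then show "cmod (\<mu> f) \<le> 1 / e * b"
    proof cases
      case 1
      then have "f = (\<lambda>x. 0)" using f(3) by (simp add: fun_eq_iff)
      then show ?thesis using 1 clinear_on_zero[OF lin Cc_zero] by simp
    next
      case 2
      define c where "c = complex_of_real (e / b)"
      have "(\<lambda>x. c * f x) \<in> N"
      proof (rule e(2))
        show "(\<lambda>x. c * f x) \<in> Cc" using Cc_lincomb[OF f(1) f(1), of c 0] by simp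
        show "fun_support (\<lambda>x. c * f x) \<subseteq> cball 0 R"
          unfolding fun_support_def by (rule closure_minimal) (use f(2) in auto)
        show "cmod (c * f x) \<le> e" for x
          using f(3)[of x] 2 e(1) by (simp add: c_def norm_mult norm_divide field_simps)
      qed
      from bspec[OF N(2) this] have "cmod (\<mu> (\<lambda>x. c * f x)) < 1" by simp
      then have "cmod (c * \<mu> f) < 1" by (simp only: clinear_on_scale[OF lin f(1)])
      then show ?thesis
        using 2 e(1) by (simp add: c_def norm_mult norm_divide field_simps)
    qed
  qed (use e in simp)
qed

lemma exists_unit_rotation: "\<exists>a. cmod a = 1 \<and> a * z = complex_of_real (cmod z)"
proof (cases "z = 0")
  case False
  let ?a = "cnj z / complex_of_real (cmod z)"
  have "?a * z = complex_of_real ((cmod z)\<^sup>2) / complex_of_real (cmod z)"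
    unfolding complex_norm_square by (simp add: mult.commute)
  also have "\<dots> = complex_of_real (cmod z)" using False by (simp add: power2_eq_square)
  finally have "?a * z = complex_of_real (cmod z)" .
  moreover have "cmod ?a = 1" using False by (simp add: norm_divide)
  ultimately show ?thesis by blast
qed (auto intro: exI[of _ 1])

locale radon =
  fixes \<mu> :: "('a::euclidean_space \<Rightarrow> complex) \<Rightarrow> complex"
  assumes radon: "radon_measure \<mu>"
begin

lemma clinear: "clinear_on Cc \<mu>"
  using radon by (simp add: radon_measure_def)

lemma variation_bdd_above:
  assumes g: "g \<in> Cc_nonneg"
  shows "bdd_above ((\<lambda>f. cmod (\<mu> f)) ` {f\<in>Cc. \<forall>x. cmod (f x) \<le> g x})"
proof -
  obtain R where R: "0 < R" "\<And>x. g x \<noteq> 0 \<Longrightarrow> norm x \<le> R" using Cc_nonneg_support_radius[OF g] by blast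
  obtain B where B: "0 < B" "\<And>x. g x \<le> B" using Cc_nonneg_bounded_above[OF g] by blast
  obtain C where C: "0 < C"
    "\<And>f b. f \<in> Cc \<Longrightarrow> (\<And>x. f x \<noteq> 0 \<Longrightarrow> norm x \<le> R) \<Longrightarrow> (\<And>x. cmod (f x) \<le> b) \<Longrightarrow> cmod (\<mu> f) \<le> C * b"
    using radon_measure_bounded_on_cball[OF radon] by blast
  show ?thesis
  proof (rule bdd_aboveI2)
    fix f assume "f \<in> {f\<in>Cc. \<forall>x. cmod (f x) \<le> g x}"
    then have f: "f \<in> Cc" "\<And>x. cmod (f x) \<le> g x" by auto
    show "cmod (\<mu> f) \<le> C * B"
    proof (rule C(2)[OF f(1)])
      show "norm x \<le> R" if "f x \<noteq> 0" for x
      proof (rule R(2))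
        have "0 < cmod (f x)" using that by simp
        then show "g x \<noteq> 0" using f(2)[of x] by linarith
      qed
      show "cmod (f x) \<le> B" for x using f(2) B(2) by (rule order_trans)
    qed
  qed
qed

lemma variation_upper:
  assumes "g \<in> Cc_nonneg" "f \<in> Cc" "\<And>x. cmod (f x) \<le> g x"
  shows "cmod (\<mu> f) \<le> variation_at \<mu> g"
  unfolding variation_at_def using assms by (intro cSUP_upper variation_bdd_above) auto

lemma variation_least:
  assumes "g \<in> Cc_nonneg" "\<And>f. f \<in> Cc \<Longrightarrow> (\<And>x. cmod (f x) \<le> g x) \<Longrightarrow> cmod (\<mu> f) \<le> c"
  shows "variation_at \<mu> g \<le> c"
  unfolding variation_at_def
proof (rule cSUP_least)
  show "{f \<in> Cc. \<forall>x. cmod (f x) \<le> g x} \<noteq> {}"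
    using Cc_nonnegD(2)[OF assms(1)] Cc_zero by auto
qed (use assms in auto)

text \<open>
  The competitors \<open>f\<^sub>1\<close> and \<open>f\<^sub>2\<close> are multiplied by unimodular constants that make \<open>\<mu> f\<^sub>1\<close> and \<open>\<mu> f\<^sub>2\<close>
  nonnegative; then \<open>\<bar>\<mu> f\<^sub>1\<bar> + \<bar>\<mu> f\<^sub>2\<bar>\<close> is the value of \<open>\<mu>\<close> at a single competitor for \<open>g\<^sub>1 + g\<^sub>2\<close>.
\<close>

lemma variation_superadditive:
  assumes g: "g1 \<in> Cc_nonneg" "g2 \<in> Cc_nonneg"
  shows "variation_at \<mu> g1 + variation_at \<mu> g2 \<le> variation_at \<mu> (\<lambda>x. g1 x + g2 x)"
proof -
  let ?v = "variation_at \<mu> (\<lambda>x. g1 x + g2 x)"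
  have *: "cmod (\<mu> f1) + cmod (\<mu> f2) \<le> ?v"
    if f1: "f1 \<in> Cc" "\<And>x. cmod (f1 x) \<le> g1 x" and f2: "f2 \<in> Cc" "\<And>x. cmod (f2 x) \<le> g2 x" for f1 f2
  proof -
    obtain a where a: "cmod a = 1" "a * \<mu> f1 = complex_of_real (cmod (\<mu> f1))"
      using exists_unit_rotation by blast
    obtain b where b: "cmod b = 1" "b * \<mu> f2 = complex_of_real (cmod (\<mu> f2))"
      using exists_unit_rotation by blast
    have "\<mu> (\<lambda>x. a * f1 x + b * f2 x) = complex_of_real (cmod (\<mu> f1) + cmod (\<mu> f2))"
      using clinear_onD[OF clinear f1(1) f2(1)] a b by simp
    then have "cmod (\<mu> f1) + cmod (\<mu> f2) = cmod (\<mu> (\<lambda>x. a * f1 x + b * f2 x))"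
      by (simp only: norm_of_real) simp
    also have "\<dots> \<le> ?v"
    proof (intro variation_upper Cc_nonneg_add g Cc_lincomb f1 f2)
      fix x
      show "cmod (a * f1 x + b * f2 x) \<le> g1 x + g2 x"
        using norm_triangle_ineq[of "a * f1 x" "b * f2 x"] f1(2)[of x] f2(2)[of x] a b
        by (simp add: norm_mult)
    qed
    finally show ?thesis .
  qed
  have "variation_at \<mu> g1 \<le> ?v - cmod (\<mu> f2)" if "f2 \<in> Cc" "\<And>x. cmod (f2 x) \<le> g2 x" for f2
    using *[OF _ _ that] by (intro variation_least g) (auto simp: le_diff_eq)
  then have "variation_at \<mu> g2 \<le> ?v - variation_at \<mu> g1"
    by (intro variation_least g) (force simp: le_diff_eq add.commute)
  then show ?thesis by simp
qed

text \<open>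
  A competitor \<open>f\<close> for \<open>g\<^sub>1 + g\<^sub>2\<close> is split in the proportion of \<open>g\<^sub>1\<close> to \<open>g\<^sub>2\<close>.  The parts are continuous
  also at the zeros of \<open>g\<^sub>1 + g\<^sub>2\<close>, where they are squeezed by \<open>g\<^sub>1\<close> and \<open>g\<^sub>2\<close>.
\<close>

lemma variation_subadditive:
  assumes g: "g1 \<in> Cc_nonneg" "g2 \<in> Cc_nonneg"
  shows "variation_at \<mu> (\<lambda>x. g1 x + g2 x) \<le> variation_at \<mu> g1 + variation_at \<mu> g2"
proof (rule variation_least[OF Cc_nonneg_add[OF g]])
  fix f :: "'a \<Rightarrow> complex"
  assume f: "f \<in> Cc" "\<And>x. cmod (f x) \<le> g1 x + g2 x"
  note g0 = Cc_nonnegD(2)[OF g(1)] Cc_nonnegD(2)[OF g(2)]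
  \<comment> \<open>Division by zero yields 0, which is the right value where g1 + g2 vanishes.\<close>
  define part where "part g x = f x * complex_of_real (g x / (g1 x + g2 x))" for g :: "'a \<Rightarrow> real" and x
  have part_le: "cmod (part g x) \<le> g x" if "g \<in> {g1, g2}" for g x
  proof (cases "g1 x + g2 x = 0")
    case False
    then have pos: "0 < g1 x + g2 x" using g0[of x] by linarith
    have "cmod (part g x) = cmod (f x) * (g x / (g1 x + g2 x))"
      using that g0[of x] unfolding part_def norm_mult norm_of_real
      by (subst abs_of_nonneg) (auto intro: divide_nonneg_nonneg add_nonneg_nonneg)
    also have "\<dots> \<le> (g1 x + g2 x) * (g x / (g1 x + g2 x))"
      using that f(2)[of x] g0[of x] by (intro mult_right_mono) auto
    also have "\<dots> = g x" using pos by simp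
    finally show ?thesis .
  qed (use that g0 in \<open>auto simp: part_def\<close>)
  have part_in: "part g \<in> Cc" if gg: "g \<in> {g1, g2}" for g
  proof -
    have gin: "g \<in> Cc_nonneg" using gg g by auto
    have c: "isCont g1 x" "isCont g2 x" "isCont f x" "isCont g x" for x
      using Cc_nonnegD(1)[OF g(1)] Cc_nonnegD(1)[OF g(2)] CcD(1)[OF f(1)] Cc_nonnegD(1)[OF gin]
      by (auto simp: continuous_on_eq_continuous_at)
    have "isCont (part g) x" for x
    proof (cases "g1 x + g2 x = 0")
      case True
      then have "g x = 0" using gg g0[of x] by auto
      have "(part g \<longlongrightarrow> 0) (at x)"
      proof (rule tendsto_norm_zero_cancel, rule tendsto_sandwich[OF _ _ tendsto_const])
        show "(g \<longlongrightarrow> 0) (at x)" using c(4)[of x] \<open>g x = 0\<close> by (simp add: isCont_def)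
        show "\<forall>\<^sub>F y in at x. cmod (part g y) \<le> g y" using part_le[OF gg] by simp
      qed simp
      then show ?thesis using True by (simp add: isCont_def part_def)
    next
      case False
      then show ?thesis unfolding part_def[abs_def] by (intro continuous_intros c) auto
    qed
    then have "continuous_on UNIV (part g)" by (simp add: continuous_at_imp_continuous_on)
    moreover have "bounded {x. part g x \<noteq> 0}"
      by (rule bounded_subset[OF CcD(2)[OF f(1)]]) (auto simp: part_def)
    ultimately show ?thesis by (simp add: Cc_iff)
  qed
  have "f x = part g1 x + part g2 x" for x
  proof (cases "g1 x + g2 x = 0")
    case True
    then show ?thesis using f(2)[of x] by (simp add: part_def)
  next
    case False
    have "part g1 x + part g2 x = f x * complex_of_real (g1 x / (g1 x + g2 x) + g2 x / (g1 x + g2 x))"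
      by (simp only: part_def of_real_add distrib_left)
    also have "\<dots> = f x" using False by (simp flip: add_divide_distrib)
    finally show ?thesis by simp
  qed
  then have "f = (\<lambda>x. part g1 x + part g2 x)" by (simp add: fun_eq_iff)
  then have "\<mu> f = \<mu> (\<lambda>x. part g1 x + part g2 x)" by (rule arg_cong)
  also have "\<dots> = \<mu> (part g1) + \<mu> (part g2)"
    by (rule clinear_on_add[OF clinear part_in part_in]) auto
  finally have "\<mu> f = \<mu> (part g1) + \<mu> (part g2)" .
  then have "cmod (\<mu> f) \<le> cmod (\<mu> (part g1)) + cmod (\<mu> (part g2))"
    by (simp add: norm_triangle_ineq)
  also have "\<dots> \<le> variation_at \<mu> g1 + variation_at \<mu> g2"
    by (intro add_mono variation_upper g part_in part_le) auto
  finally show "cmod (\<mu> f) \<le> variation_at \<mu> g1 + variation_at \<mu> g2" .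
qed

lemma variation_scale_le:
  assumes g: "g \<in> Cc_nonneg" and c: "0 < c"
  shows "variation_at \<mu> (\<lambda>x. c * g x) \<le> c * variation_at \<mu> g"
proof (rule variation_least)
  show "(\<lambda>x. c * g x) \<in> Cc_nonneg" using g c by (intro Cc_nonneg_scale) auto
  fix f assume f: "f \<in> Cc" "\<And>x. cmod (f x) \<le> c * g x"
  have "cmod (\<mu> (\<lambda>x. complex_of_real (inverse c) * f x)) \<le> variation_at \<mu> g"
  proof (rule variation_upper[OF g])
    show "(\<lambda>x. complex_of_real (inverse c) * f x) \<in> Cc"
      using Cc_lincomb[OF f(1) f(1), of "complex_of_real (inverse c)" 0] by simp
    show "cmod (complex_of_real (inverse c) * f x) \<le> g x" for x
      using f(2)[of x] c by (simp add: norm_mult norm_divide field_simps)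
  qed
  then have "cmod (complex_of_real (inverse c) * \<mu> f) \<le> variation_at \<mu> g"
    by (simp only: clinear_on_scale[OF clinear f(1)])
  then show "cmod (\<mu> f) \<le> c * variation_at \<mu> g"
    using c by (simp add: norm_mult norm_divide field_simps)
qed

sublocale variation: positive_functional "variation_at \<mu>"
proof
  fix f g :: "'a \<Rightarrow> real" and c :: real assume g: "g \<in> Cc_nonneg"
  have "cmod (\<mu> (\<lambda>x. 0)) \<le> variation_at \<mu> g"
    by (intro variation_upper[OF g] Cc_zero) (simp add: Cc_nonnegD(2)[OF g])
  then show "0 \<le> variation_at \<mu> g" using norm_ge_zero order_trans by blast
  show "variation_at \<mu> (\<lambda>x. f x + g x) = variation_at \<mu> f + variation_at \<mu> g" if "f \<in> Cc_nonneg"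
    using that g by (intro antisym variation_superadditive variation_subadditive)
  assume c: "0 \<le> c"
  show "variation_at \<mu> (\<lambda>x. c * g x) = c * variation_at \<mu> g"
  proof (cases "c = 0")
    case True
    have "{f \<in> Cc. \<forall>x. f x = 0} = {\<lambda>x::'a. 0::complex}" using Cc_zero by auto
    then show ?thesis using True clinear_on_zero[OF clinear Cc_zero] by (simp add: variation_at_def)
  next
    case False
    then have c: "0 < c" using c by simp
    have "variation_at \<mu> (\<lambda>x. inverse c * (c * g x)) \<le> inverse c * variation_at \<mu> (\<lambda>x. c * g x)"
      using c by (intro variation_scale_le Cc_nonneg_scale g) auto
    moreover have "(\<lambda>x. inverse c * (c * g x)) = g" using c by (simp add: fun_eq_iff)
    ultimately have "c * variation_at \<mu> g \<le> variation_at \<mu> (\<lambda>x. c * g x)"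
      using c by (simp add: field_simps)
    then show ?thesis using variation_scale_le[OF g c] by simp
  qed
qed

end

definition locally_finite_borel :: "'a::euclidean_space measure \<Rightarrow> bool" where
  "locally_finite_borel M \<longleftrightarrow> sets M = sets borel \<and> (\<forall>K. compact K \<longrightarrow> emeasure M K < \<infinity>)"

lemma locally_finite_borelD:
  assumes "locally_finite_borel M"
  shows "sets M = sets borel" "compact K \<Longrightarrow> emeasure M K < \<infinity>" "g \<in> Cc_nonneg \<Longrightarrow> integrable M g"
  using assms Cc_nonneg_integrable[of M g] by (auto simp: locally_finite_borel_def)

lemma borel_measurable_continuous_locally_finite:
  fixes f :: "'a::euclidean_space \<Rightarrow> 'b::real_normed_vector"
  assumes "locally_finite_borel M" "continuous_on UNIV f"
  shows "f \<in> borel_measurable M"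
  using borel_measurable_continuous_onI[OF assms(2)] locally_finite_borelD(1)[OF assms(1)]
  by (simp cong: measurable_cong_sets)

lemma Cc_integrable:
  fixes f :: "'a::euclidean_space \<Rightarrow> complex"
  assumes M: "locally_finite_borel M" and f: "f \<in> Cc"
  shows "integrable M f"
  by (rule Bochner_Integration.integrable_bound[OF locally_finite_borelD(3)[OF M Cc_nonneg_parts(1)[OF f]]])
     (auto intro: borel_measurable_continuous_locally_finite[OF M CcD(1)[OF f]])

lemma integral_Cc_parts:
  fixes f :: "'a::euclidean_space \<Rightarrow> complex"
  assumes M: "locally_finite_borel M" and f: "f \<in> Cc"
  shows "(\<integral>x. f x \<partial>M) = Complex
     ((\<integral>x. max 0 (Re (f x)) \<partial>M) - (\<integral>x. max 0 (- Re (f x)) \<partial>M))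
     ((\<integral>x. max 0 (Im (f x)) \<partial>M) - (\<integral>x. max 0 (- Im (f x)) \<partial>M))"
proof -
  note int = locally_finite_borelD(3)[OF M] and p = Cc_nonneg_parts[OF f]
  have eq: "r = max 0 r - max 0 (- r)" for r :: real by simp
  have "(\<integral>x. Re (f x) \<partial>M) = (\<integral>x. max 0 (Re (f x)) - max 0 (- Re (f x)) \<partial>M)"
    by (rule Bochner_Integration.integral_cong[OF refl eq])
  moreover have "(\<integral>x. Im (f x) \<partial>M) = (\<integral>x. max 0 (Im (f x)) - max 0 (- Im (f x)) \<partial>M)"
    by (rule Bochner_Integration.integral_cong[OF refl eq])
  ultimately show ?thesis
    using Cc_integrable[OF M f] by (simp add: complex_eq_iff int[OF p(2)] int[OF p(3)] int[OF p(4)] int[OF p(5)])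
qed

lemma riesz_measure_eqI:
  assumes M: "locally_finite_borel M" and rep: "\<And>f. f \<in> Cc \<Longrightarrow> \<nu> f = (\<integral>x. f x \<partial>M)"
  shows "riesz_measure \<nu> = M"
  unfolding riesz_measure_def
proof (rule the_equality)
  show "sets M = sets borel \<and> (\<forall>K. compact K \<longrightarrow> emeasure M K < \<infinity>) \<and> (\<forall>f\<in>Cc. \<nu> f = (\<integral>x. f x \<partial>M))"
    using M rep by (simp add: locally_finite_borel_def)
  fix N assume N: "sets N = sets borel \<and> (\<forall>K. compact K \<longrightarrow> emeasure N K < \<infinity>) \<and>
      (\<forall>f\<in>Cc. \<nu> f = (\<integral>x. f x \<partial>N))"
  show "N = M"
  proof (rule measure_eqI_Cc_nonneg)
    fix g :: "'a \<Rightarrow> real" assume "g \<in> Cc_nonneg"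
    then have "(\<integral>x. complex_of_real (g x) \<partial>N) = (\<integral>x. complex_of_real (g x) \<partial>M)"
      using N rep Cc_of_Cc_nonneg by metis
    then show "(\<integral>x. g x \<partial>N) = (\<integral>x. g x \<partial>M)" by simp
  qed (use M N in \<open>auto simp: locally_finite_borel_def\<close>)
qed

text \<open>
  For a positive measure the supremum that defines the variation at \<open>g\<close> is attained at \<open>g\<close> itself.
  Hence \<open>\<bar>\<mu>\<bar>\<close> is its own total variation and has the same variation measure as \<open>\<mu>\<close>.
\<close>

lemma total_variation_positive:
  fixes \<nu> :: "('a::euclidean_space \<Rightarrow> complex) \<Rightarrow> complex"
  assumes M: "locally_finite_borel M" and rep: "\<And>f. f \<in> Cc \<Longrightarrow> \<nu> f = (\<integral>x. f x \<partial>M)"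
    and f: "f \<in> Cc"
  shows "total_variation \<nu> f = (\<integral>x. f x \<partial>M)"
proof -
  have "variation_at \<nu> g = (\<integral>x. g x \<partial>M)" if g: "g \<in> Cc_nonneg" for g
    unfolding variation_at_def
  proof (rule cSup_eq_maximum)
    have "cmod (\<nu> (\<lambda>x. complex_of_real (g x))) = (\<integral>x. g x \<partial>M)"
      using rep[OF Cc_of_Cc_nonneg[OF g]] Cc_nonnegD(2)[OF g] by simp
    then show "(\<integral>x. g x \<partial>M) \<in> (\<lambda>f. cmod (\<nu> f)) ` {f \<in> Cc. \<forall>x. cmod (f x) \<le> g x}"
      using Cc_of_Cc_nonneg[OF g] Cc_nonnegD(2)[OF g]
      by (intro image_eqI[of _ _ "\<lambda>x. complex_of_real (g x)"]) auto
    fix z assume "z \<in> (\<lambda>f. cmod (\<nu> f)) ` {f \<in> Cc. \<forall>x. cmod (f x) \<le> g x}"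
    then obtain h where h: "h \<in> Cc" "\<And>x. cmod (h x) \<le> g x" "z = cmod (\<nu> h)" by auto
    have "z \<le> (\<integral>x. cmod (h x) \<partial>M)" using rep[OF h(1)] h(3) by simp
    also have "\<dots> \<le> (\<integral>x. g x \<partial>M)"
      using h by (intro integral_mono integrable_norm Cc_integrable[OF M] locally_finite_borelD(3)[OF M] g)
    finally show "z \<le> (\<integral>x. g x \<partial>M)" .
  qed
  then show ?thesis
    using integral_Cc_parts[OF M f] Cc_nonneg_parts[OF f] by (simp add: total_variation_def)
qed

text \<open>
  What \<open>\<mu>\<close> and \<open>\<bar>\<mu>\<bar>\<close> have in common: both are dominated by the same measure \<open>M\<close>, which is the variation
  measure of both.
\<close>

locale dominated_functional =
  fixes \<mu> :: "('a::euclidean_space \<Rightarrow> complex) \<Rightarrow> complex" and M :: "'a measure"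
  assumes clinear: "clinear_on Cc \<mu>"
    and locally_finite: "locally_finite_borel M"
    and dominated: "f \<in> Cc \<Longrightarrow> cmod (\<mu> f) \<le> (\<integral>x. cmod (f x) \<partial>M)"
    and variation_measure_eq: "variation_measure \<mu> = M"

theorem radon_variation_measure:
  assumes "radon_measure \<mu>"
  shows "locally_finite_borel (variation_measure \<mu>)"
    and "f \<in> Cc \<Longrightarrow> total_variation \<mu> f = (\<integral>x. f x \<partial>variation_measure \<mu>)"
    and "dominated_functional \<mu> (variation_measure \<mu>)"
    and "dominated_functional (total_variation \<mu>) (variation_measure \<mu>)"
proof -
  interpret radon \<mu> by unfold_locales fact
  obtain M where M: "locally_finite_borel M"
    and rep: "\<And>g. g \<in> Cc_nonneg \<Longrightarrow> variation_at \<mu> g = (\<integral>x. g x \<partial>M)"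
    using variation.riesz_representation unfolding locally_finite_borel_def by blast
  have tv: "total_variation \<mu> f = (\<integral>x. f x \<partial>M)" if "f \<in> Cc" for f
    using integral_Cc_parts[OF M that] rep Cc_nonneg_parts[OF that] by (simp add: total_variation_def)
  have vm: "variation_measure \<mu> = M" by (rule riesz_measure_eqI[OF M tv])
  show "locally_finite_borel (variation_measure \<mu>)" unfolding vm by (rule M)
  show "f \<in> Cc \<Longrightarrow> total_variation \<mu> f = (\<integral>x. f x \<partial>variation_measure \<mu>)"
    unfolding vm by (rule tv)
  show "dominated_functional \<mu> (variation_measure \<mu>)"
  proof
    show "cmod (\<mu> f) \<le> (\<integral>x. cmod (f x) \<partial>variation_measure \<mu>)" if "f \<in> Cc" for f
      using variation_upper[OF Cc_nonneg_parts(1)[OF that] that] rep[OF Cc_nonneg_parts(1)[OF that]]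
      by (simp add: vm)
  qed (simp_all add: vm M clinear)
  show "dominated_functional (total_variation \<mu>) (variation_measure \<mu>)"
    unfolding vm
  proof
    show "clinear_on Cc (total_variation \<mu>)"
      unfolding clinear_on_def
      using Cc_integrable[OF M] by (simp add: tv Cc_lincomb)
    show "cmod (total_variation \<mu> f) \<le> (\<integral>x. cmod (f x) \<partial>M)" if "f \<in> Cc" for f
      using that by (simp add: tv)
    show "variation_measure (total_variation \<mu>) = M"
      by (rule riesz_measure_eqI[OF M], rule total_variation_positive[OF M tv])
  qed (rule M)
qed

section \<open>The extension of a Radon measure to integrable continuous functions\<close>

context dominated_functional
begin

lemma measurable_continuous:
  "continuous_on UNIV f \<Longrightarrow> f \<in> borel_measurable M" for f :: "'a \<Rightarrow> 'b::real_normed_vector"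
  by (rule borel_measurable_continuous_locally_finite[OF locally_finite])

lemma cutoff_L1_approximation:
  fixes \<psi> :: "'a \<Rightarrow> complex"
  assumes cont: "continuous_on UNIV \<psi>" and int: "integrable M (\<lambda>x. cmod (\<psi> x))"
  shows "(\<lambda>n. \<integral>\<^sup>+x. ennreal (cmod (\<psi> x - complex_of_real (cutoff (real n) x) * \<psi> x)) \<partial>M) \<longlonglongrightarrow> 0"
proof -
  have [measurable]: "\<psi> \<in> borel_measurable M" by (rule measurable_continuous[OF cont])
  have [measurable]: "cutoff R \<in> borel_measurable M" for R
    by (rule measurable_continuous[OF continuous_on_cutoff])
  have "(\<lambda>n. \<integral>\<^sup>+x. ennreal (cmod (\<psi> x - complex_of_real (cutoff (real n) x) * \<psi> x)) \<partial>M) \<longlonglongrightarrow> (\<integral>\<^sup>+x. 0 \<partial>M)"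
  proof (rule nn_integral_dominated_convergence[where w = "\<lambda>x. ennreal (cmod (\<psi> x))"])
    show "(\<integral>\<^sup>+x. ennreal (cmod (\<psi> x)) \<partial>M) < \<infinity>"
      using int by (simp add: integrable_iff_bounded)
    show "AE x in M. ennreal (cmod (\<psi> x - complex_of_real (cutoff (real n) x) * \<psi> x)) \<le> ennreal (cmod (\<psi> x))" for n
    proof (rule AE_I2, rule ennreal_leI)
      fix x
      have "\<psi> x - complex_of_real (cutoff (real n) x) * \<psi> x = complex_of_real (1 - cutoff (real n) x) * \<psi> x"
        by (simp add: algebra_simps)
      then have "cmod (\<psi> x - complex_of_real (cutoff (real n) x) * \<psi> x) = (1 - cutoff (real n) x) * cmod (\<psi> x)"
        using cutoff_bounds[of "real n" x] by (simp only: norm_mult norm_of_real)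
      also have "\<dots> \<le> 1 * cmod (\<psi> x)"
        using cutoff_bounds[of "real n" x] by (intro mult_right_mono) auto
      finally show "cmod (\<psi> x - complex_of_real (cutoff (real n) x) * \<psi> x) \<le> cmod (\<psi> x)" by simp
    qed
    show "AE x in M. (\<lambda>n. ennreal (cmod (\<psi> x - complex_of_real (cutoff (real n) x) * \<psi> x))) \<longlonglongrightarrow> 0"
    proof (rule AE_I2)
      fix x :: 'a
      obtain m where m: "norm x \<le> real m" using real_arch_simple by blast
      have "ennreal (cmod (\<psi> x - complex_of_real (cutoff (real n) x) * \<psi> x)) = 0" if "m \<le> n" for n
        using that m by (simp add: cutoff_eq_1)
      then have "\<forall>\<^sub>F n in sequentially. ennreal (cmod (\<psi> x - complex_of_real (cutoff (real n) x) * \<psi> x)) = 0"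
        unfolding eventually_sequentially by blast
      then show "(\<lambda>n. ennreal (cmod (\<psi> x - complex_of_real (cutoff (real n) x) * \<psi> x))) \<longlonglongrightarrow> 0"
        by (rule tendsto_eventually)
    qed
  qed measurable
  then show ?thesis by simp
qed

lemma diff_le_L1_distances:
  fixes \<psi> :: "'a \<Rightarrow> complex"
  assumes f: "f \<in> Cc" and g: "g \<in> Cc" and cont: "continuous_on UNIV \<psi>"
  shows "ennreal (cmod (\<mu> f - \<mu> g)) \<le>
    (\<integral>\<^sup>+x. ennreal (cmod (\<psi> x - f x)) \<partial>M) + (\<integral>\<^sup>+x. ennreal (cmod (\<psi> x - g x)) \<partial>M)"
proof -
  have [measurable]: "\<psi> \<in> borel_measurable M" "f \<in> borel_measurable M" "g \<in> borel_measurable M"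
    by (intro measurable_continuous cont CcD f g)+
  have fg: "(\<lambda>x. f x - g x) \<in> Cc" using Cc_lincomb[OF f g, of 1 "-1"] by simp
  have "cmod (\<mu> f - \<mu> g) \<le> (\<integral>x. cmod (f x - g x) \<partial>M)"
    using dominated[OF fg] by (simp add: clinear_on_diff[OF clinear f g])
  then have "ennreal (cmod (\<mu> f - \<mu> g)) \<le> ennreal (\<integral>x. cmod (f x - g x) \<partial>M)"
    by (rule ennreal_leI)
  also have "\<dots> = (\<integral>\<^sup>+x. ennreal (cmod (f x - g x)) \<partial>M)"
    by (rule nn_integral_eq_integral[symmetric]) (auto intro!: integrable_norm Cc_integrable[OF locally_finite fg])
  also have "\<dots> \<le> (\<integral>\<^sup>+x. ennreal (cmod (\<psi> x - f x)) + ennreal (cmod (\<psi> x - g x)) \<partial>M)"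
  proof (rule nn_integral_mono)
    fix x
    have "cmod (f x - g x) \<le> cmod (\<psi> x - f x) + cmod (\<psi> x - g x)"
      using norm_triangle_ineq4[of "\<psi> x - g x" "\<psi> x - f x"] by simp
    then show "ennreal (cmod (f x - g x)) \<le> ennreal (cmod (\<psi> x - f x)) + ennreal (cmod (\<psi> x - g x))"
      by (simp flip: ennreal_plus)
  qed
  also have "\<dots> = (\<integral>\<^sup>+x. ennreal (cmod (\<psi> x - f x)) \<partial>M) + (\<integral>\<^sup>+x. ennreal (cmod (\<psi> x - g x)) \<partial>M)"
    by (rule nn_integral_add) measurable
  finally show ?thesis .
qed

text \<open>
  The functional is a contraction from the \<open>L\<^sup>1(M)\<close> distance, so its values along an approximating
  sequence form a Cauchy sequence and the limit is the same for all sequences.  For continuous functions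
  the cutoffs already provide such a sequence, so the limit in the definition of \<^const>\<open>radon_integral\<close>
  exists.
\<close>

lemma radon_integral_limit:
  fixes \<psi> :: "'a \<Rightarrow> complex"
  assumes cont: "continuous_on UNIV \<psi>" and int: "integrable M (\<lambda>x. cmod (\<psi> x))"
    and f: "\<And>n. f n \<in> Cc" "(\<lambda>n. \<integral>\<^sup>+x. ennreal (cmod (\<psi> x - f n x)) \<partial>M) \<longlonglongrightarrow> 0"
  shows "(\<lambda>n. \<mu> (f n)) \<longlonglongrightarrow> radon_integral \<mu> \<psi>"
proof -
  define c where "c n x = complex_of_real (cutoff (real n) x) * \<psi> x" for n x
  let ?d = "\<lambda>f. \<integral>\<^sup>+x. ennreal (cmod (\<psi> x - f x)) \<partial>M"
  have c_in: "c n \<in> Cc" for n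
    unfolding c_def[abs_def] by (rule cutoff_mult_in_Cc[OF cont])
  have c_lim: "(\<lambda>n. ?d (c n)) \<longlonglongrightarrow> 0"
    unfolding c_def by (rule cutoff_L1_approximation[OF cont int])
  have "Cauchy (\<lambda>n. \<mu> (c n))"
  proof (rule metric_CauchyI)
    fix e :: real assume e: "0 < e"
    have "\<forall>\<^sub>F n in sequentially. ?d (c n) < ennreal (e / 2)"
      using c_lim e by (intro order_tendstoD) auto
    then obtain N where N: "\<And>n. N \<le> n \<Longrightarrow> ?d (c n) < ennreal (e / 2)"
      unfolding eventually_sequentially by blast
    have "dist (\<mu> (c m)) (\<mu> (c n)) < e" if "N \<le> m" "N \<le> n" for m n
    proof -
      have "ennreal (cmod (\<mu> (c m) - \<mu> (c n))) \<le> ?d (c m) + ?d (c n)"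
        by (rule diff_le_L1_distances[OF c_in c_in cont])
      also have "\<dots> < ennreal (e / 2) + ennreal (e / 2)"
        by (intro add_strict_mono N that)
      also have "\<dots> = ennreal e" using e by (simp flip: ennreal_plus)
      finally show ?thesis by (simp add: dist_norm ennreal_less_iff)
    qed
    then show "\<exists>N. \<forall>m\<ge>N. \<forall>n\<ge>N. dist (\<mu> (c m)) (\<mu> (c n)) < e" by blast
  qed
  then obtain z where z: "(\<lambda>n. \<mu> (c n)) \<longlonglongrightarrow> z"
    using Cauchy_convergent_iff convergent_def by blast
  have all: "(\<lambda>n. \<mu> (h n)) \<longlonglongrightarrow> z" if h: "\<And>n. h n \<in> Cc" "(\<lambda>n. ?d (h n)) \<longlonglongrightarrow> 0" for h
  proof -
    have "(\<lambda>n. ennreal (cmod (\<mu> (h n) - \<mu> (c n)))) \<longlonglongrightarrow> 0"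
    proof (rule tendsto_sandwich[OF _ _ tendsto_const])
      show "\<forall>\<^sub>F n in sequentially. ennreal (cmod (\<mu> (h n) - \<mu> (c n))) \<le> ?d (h n) + ?d (c n)"
        using diff_le_L1_distances[OF h(1) c_in cont] by (intro always_eventually) simp
      show "(\<lambda>n. ?d (h n) + ?d (c n)) \<longlonglongrightarrow> 0"
        using tendsto_add[OF h(2) c_lim] by simp
    qed simp
    then have "(\<lambda>n. ennreal (cmod (\<mu> (h n) - \<mu> (c n)))) \<longlonglongrightarrow> ennreal 0"
      by (simp only: ennreal_0)
    then have "(\<lambda>n. cmod (\<mu> (h n) - \<mu> (c n))) \<longlonglongrightarrow> 0"
      by (rule tendsto_ennrealD) auto
    then have "(\<lambda>n. \<mu> (h n) - \<mu> (c n)) \<longlonglongrightarrow> 0" by (rule tendsto_norm_zero_cancel)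
    from tendsto_add[OF this z] show ?thesis by simp
  qed
  have "radon_integral \<mu> \<psi> = z"
    unfolding radon_integral_def variation_measure_eq
  proof (rule the_equality)
    show "\<forall>f. (\<forall>n. f n \<in> Cc) \<and> (\<lambda>n. ?d (f n)) \<longlonglongrightarrow> 0 \<longrightarrow> (\<lambda>n. \<mu> (f n)) \<longlonglongrightarrow> z"
      using all by blast
    fix w assume "\<forall>f. (\<forall>n. f n \<in> Cc) \<and> (\<lambda>n. ?d (f n)) \<longlonglongrightarrow> 0 \<longrightarrow> (\<lambda>n. \<mu> (f n)) \<longlonglongrightarrow> w"
    then have "(\<lambda>n. \<mu> (c n)) \<longlonglongrightarrow> w" using c_in c_lim by blast
    then show "w = z" using z by (rule LIMSEQ_unique)
  qed
  then show ?thesis using all[OF f] by simp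
qed

lemma radon_integral_cutoff_limit:
  fixes \<psi> :: "'a \<Rightarrow> complex"
  assumes "continuous_on UNIV \<psi>" "integrable M (\<lambda>x. cmod (\<psi> x))"
  shows "(\<lambda>n. \<mu> (\<lambda>x. complex_of_real (cutoff (real n) x) * \<psi> x)) \<longlonglongrightarrow> radon_integral \<mu> \<psi>"
  by (intro radon_integral_limit assms cutoff_mult_in_Cc cutoff_L1_approximation)

lemma radon_integral_Cc: "f \<in> Cc \<Longrightarrow> radon_integral \<mu> f = \<mu> f"
  using radon_integral_limit[of f "\<lambda>n. f"] CcD(1)[of f] Cc_integrable[OF locally_finite, of f]
  by (intro LIMSEQ_unique[OF _ tendsto_const]) auto

lemma radon_integral_lincomb:
  fixes \<psi> \<phi> :: "'a \<Rightarrow> complex"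
  assumes \<psi>: "continuous_on UNIV \<psi>" "integrable M (\<lambda>x. cmod (\<psi> x))"
    and \<phi>: "continuous_on UNIV \<phi>" "integrable M (\<lambda>x. cmod (\<phi> x))"
  shows "radon_integral \<mu> (\<lambda>x. a * \<psi> x + b * \<phi> x) = a * radon_integral \<mu> \<psi> + b * radon_integral \<mu> \<phi>"
proof -
  let ?c = "\<lambda>n x. complex_of_real (cutoff (real n) x)"
  have cont: "continuous_on UNIV (\<lambda>x. a * \<psi> x + b * \<phi> x)"
    using \<psi> \<phi> by (intro continuous_intros)
  have int: "integrable M (\<lambda>x. cmod (a * \<psi> x + b * \<phi> x))"
    using \<psi> \<phi> measurable_continuous[OF \<psi>(1)] measurable_continuous[OF \<phi>(1)]
    by (intro integrable_norm integrable_add integrable_mult_right) (auto simp: integrable_norm_iff)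
  have "(\<lambda>n. a * \<mu> (\<lambda>x. ?c n x * \<psi> x) + b * \<mu> (\<lambda>x. ?c n x * \<phi> x)) \<longlonglongrightarrow>
      a * radon_integral \<mu> \<psi> + b * radon_integral \<mu> \<phi>"
    by (intro tendsto_intros radon_integral_cutoff_limit \<psi> \<phi>)
  moreover have "a * \<mu> (\<lambda>x. ?c n x * \<psi> x) + b * \<mu> (\<lambda>x. ?c n x * \<phi> x) =
      \<mu> (\<lambda>x. ?c n x * (a * \<psi> x + b * \<phi> x))" for n
    using clinear_onD[OF clinear cutoff_mult_in_Cc[OF \<psi>(1)] cutoff_mult_in_Cc[OF \<phi>(1)], of a "real n" b "real n"]
    by (simp add: algebra_simps)
  ultimately show ?thesis
    using radon_integral_cutoff_limit[OF cont int] by (auto intro: LIMSEQ_unique)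
qed

lemma norm_radon_integral_le:
  fixes \<psi> :: "'a \<Rightarrow> complex"
  assumes \<psi>: "continuous_on UNIV \<psi>" "integrable M (\<lambda>x. cmod (\<psi> x))"
  shows "cmod (radon_integral \<mu> \<psi>) \<le> (\<integral>x. cmod (\<psi> x) \<partial>M)"
proof (rule LIMSEQ_le_const2[OF tendsto_norm[OF radon_integral_cutoff_limit[OF \<psi>]]], intro exI allI impI)
  fix n :: nat
  let ?f = "\<lambda>x. complex_of_real (cutoff (real n) x) * \<psi> x"
  have f: "?f \<in> Cc" by (rule cutoff_mult_in_Cc[OF \<psi>(1)])
  have "cmod (\<mu> ?f) \<le> (\<integral>x. cmod (?f x) \<partial>M)" by (rule dominated[OF f])
  also have "\<dots> \<le> (\<integral>x. cmod (\<psi> x) \<partial>M)"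
    by (intro integral_mono \<psi> integrable_norm Cc_integrable[OF locally_finite f])
       (auto simp: norm_mult abs_of_nonneg cutoff_bounds mult_left_le_one_le)
  finally show "cmod (\<mu> ?f) \<le> (\<integral>x. cmod (\<psi> x) \<partial>M)" .
qed

end

section \<open>Schwartz functions and tempered distributions\<close>

lemma partial_eq: "(f has_derivative f') (at x) \<Longrightarrow> partial i f x = f' (axis i 1)"
  unfolding partial_def by (simp flip: frechet_derivative_at)

lemma iter_partial_simps [simp]:
  "iter_partial [] f = f" "iter_partial (i # is) f = partial i (iter_partial is f)"
  by (simp_all add: iter_partial_def)

text \<open>
  Smoothness of a concrete function is shown by exhibiting a set of differentiable functions that
  contains it and is closed under partial derivatives.
\<close>

lemma smooth_coinduct:
  assumes "f \<in> S" and "\<And>g. g \<in> S \<Longrightarrow> g differentiable_on UNIV" "\<And>g i. g \<in> S \<Longrightarrow> partial i g \<in> S"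
  shows "smooth f"
proof -
  have "iter_partial is f \<in> S" for "is"
    by (induction "is") (auto simp: assms)
  then show ?thesis using assms(2) by (simp add: smooth_def)
qed

lemma smooth_has_derivative:
  assumes "smooth f"
  obtains D where "\<And>x. (iter_partial is f has_derivative D x) (at x)"
  using assms unfolding smooth_def differentiable_on_def differentiable_def by (metis UNIV_I)

lemma smooth_continuous: "smooth f \<Longrightarrow> continuous_on UNIV (iter_partial is f)"
  unfolding smooth_def by (intro differentiable_imp_continuous_on) blast

lemma iter_partial_lincomb:
  assumes "smooth f" "smooth g"
  shows "iter_partial is (\<lambda>x. a * f x + b * g x) = (\<lambda>x. a * iter_partial is f x + b * iter_partial is g x)"
proof (induction "is")
  case (Cons i "is")
  obtain D E where D: "\<And>x. (iter_partial is f has_derivative D x) (at x)"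
    and E: "\<And>x. (iter_partial is g has_derivative E x) (at x)"
    using assms smooth_has_derivative by metis
  show ?case
  proof
    fix x
    have "((\<lambda>x. a * iter_partial is f x + b * iter_partial is g x) has_derivative (\<lambda>v. a * D x v + b * E x v)) (at x)"
      by (intro has_derivative_add has_derivative_mult_right D E)
    from partial_eq[OF this] show "iter_partial (i # is) (\<lambda>x. a * f x + b * g x) x =
        a * iter_partial (i # is) f x + b * iter_partial (i # is) g x"
      by (simp add: Cons partial_eq[OF D] partial_eq[OF E])
  qed
qed simp

lemma smooth_lincomb:
  assumes "smooth f" "smooth g"
  shows "smooth (\<lambda>x. a * f x + b * g x)"
  using assms unfolding smooth_def iter_partial_lincomb[OF assms]
  by (intro allI differentiable_on_add differentiable_on_mult) auto

lemma schwartz_iff: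
  "\<psi> \<in> schwartz \<longleftrightarrow> smooth \<psi> \<and> (\<forall>m is. \<exists>B. \<forall>x. cmod (monom_eval m x * iter_partial is \<psi> x) \<le> B)"
  by (auto simp: schwartz_def bounded_iff)

lemma schwartz_smooth: "\<psi> \<in> schwartz \<Longrightarrow> smooth \<psi>"
  by (simp add: schwartz_def)

lemma schwartz_continuous: "\<psi> \<in> schwartz \<Longrightarrow> continuous_on UNIV \<psi>"
  using smooth_continuous[of \<psi> "[]"] by (simp add: schwartz_smooth)

lemma schwartz_lincomb:
  assumes "f \<in> schwartz" "g \<in> schwartz"
  shows "(\<lambda>x. a * f x + b * g x) \<in> schwartz"
  unfolding schwartz_iff
proof (intro conjI allI)
  note s = schwartz_smooth[OF assms(1)] schwartz_smooth[OF assms(2)]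
  show "smooth (\<lambda>x. a * f x + b * g x)" by (rule smooth_lincomb[OF s])
  fix m "is"
  obtain A where A: "\<And>x. cmod (monom_eval m x * iter_partial is f x) \<le> A"
    using assms(1) unfolding schwartz_iff by blast
  obtain B where B: "\<And>x. cmod (monom_eval m x * iter_partial is g x) \<le> B"
    using assms(2) unfolding schwartz_iff by blast
  have "cmod (monom_eval m x * iter_partial is (\<lambda>x. a * f x + b * g x) x) \<le> cmod a * A + cmod b * B" for x
  proof -
    have "monom_eval m x * iter_partial is (\<lambda>x. a * f x + b * g x) x =
        a * (monom_eval m x * iter_partial is f x) + b * (monom_eval m x * iter_partial is g x)"
      by (simp add: iter_partial_lincomb[OF s] algebra_simps)
    also have "cmod \<dots> \<le> cmod a * cmod (monom_eval m x * iter_partial is f x) + cmod b * cmod (monom_eval m x * iter_partial is g x)"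
      by (rule norm_triangle_le) (simp add: norm_mult)
    also have "\<dots> \<le> cmod a * A + cmod b * B"
      by (intro add_mono mult_left_mono A B) auto
    finally show ?thesis .
  qed
  then show "\<exists>C. \<forall>x. cmod (monom_eval m x * iter_partial is (\<lambda>x. a * f x + b * g x) x) \<le> C" by blast
qed

lemma schwartz_seminorm_upper:
  assumes "\<psi> \<in> schwartz"
  shows "cmod (monom_eval m x * iter_partial is \<psi> x) \<le> schwartz_seminorm m is \<psi>"
proof -
  obtain B where "\<And>x. cmod (monom_eval m x * iter_partial is \<psi> x) \<le> B"
    using assms unfolding schwartz_iff by blast
  then show ?thesis
    unfolding schwartz_seminorm_def by (intro cSUP_upper bdd_aboveI2) auto
qed

lemma schwartz_seminorm_least:
  "(\<And>x. cmod (monom_eval m x * iter_partial is \<psi> x) \<le> B) \<Longrightarrow> schwartz_seminorm m is \<psi> \<le> B"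
  unfolding schwartz_seminorm_def by (intro cSUP_least) auto

lemma tempered_distributionI:
  fixes T :: "(real ^ 'd::finite \<Rightarrow> complex) \<Rightarrow> complex"
  assumes lin: "clinear_on schwartz T" and F: "finite F" and C: "0 \<le> C"
    and bound: "\<And>\<psi>. \<psi> \<in> schwartz \<Longrightarrow> cmod (T \<psi>) \<le> C * (\<Sum>(m, is)\<in>F. schwartz_seminorm m is \<psi>)"
  shows "tempered_distribution T"
  unfolding tempered_distribution_def
proof
  show "continuous_map schwartz_topology euclidean T"
    unfolding continuous_map_def topspace_schwartz_topology openin_schwartz_topology
  proof (intro conjI allI impI)
    fix U :: "complex set" assume "openin euclidean U"
    then have U: "open U" by simp
    show "schwartz_open {\<psi> \<in> schwartz. T \<psi> \<in> U}"
      unfolding schwartz_open_def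
    proof (intro conjI ballI)
      fix \<psi> assume \<psi>: "\<psi> \<in> {\<psi> \<in> schwartz. T \<psi> \<in> U}"
      then obtain e where e: "0 < e" "ball (T \<psi>) e \<subseteq> U"
        using U open_contains_ball by blast
      define d where "d = e / (C * real (card F) + 1)"
      have pos: "0 < C * real (card F) + 1" using C by (intro add_nonneg_pos) auto
      have d: "0 < d" using e pos by (simp add: d_def)
      have "schwartz_nhd F d \<psi> \<subseteq> {\<psi> \<in> schwartz. T \<psi> \<in> U}"
      proof
        fix \<phi> assume \<phi>: "\<phi> \<in> schwartz_nhd F d \<psi>"
        then have \<phi>s: "\<phi> \<in> schwartz" by (simp add: schwartz_nhd_def)
        have diff: "(\<lambda>x. \<phi> x - \<psi> x) \<in> schwartz"
          using schwartz_lincomb[OF \<phi>s, of \<psi> 1 "-1"] \<psi> by simp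
        have "cmod (T \<phi> - T \<psi>) \<le> C * (\<Sum>(m, is)\<in>F. schwartz_seminorm m is (\<lambda>x. \<phi> x - \<psi> x))"
          using bound[OF diff] clinear_on_diff[OF lin \<phi>s, of \<psi>] \<psi> by simp
        also have "\<dots> \<le> C * (\<Sum>(m, is)\<in>F. d)"
          using \<phi> C by (intro mult_left_mono sum_mono) (auto simp: schwartz_nhd_def less_imp_le)
        also have "\<dots> = (C * real (card F)) * d" by (simp add: split_def)
        also have "\<dots> < (C * real (card F) + 1) * d" using d by simp
        also have "\<dots> = e" using pos by (simp add: d_def)
        finally have "T \<phi> \<in> ball (T \<psi>) e" by (simp add: dist_norm norm_minus_commute)
        then show "\<phi> \<in> {\<psi> \<in> schwartz. T \<psi> \<in> U}" using e \<phi>s by blast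
      qed
      then show "\<exists>F \<epsilon>. finite F \<and> 0 < \<epsilon> \<and> schwartz_nhd F \<epsilon> \<psi> \<subseteq> {\<psi> \<in> schwartz. T \<psi> \<in> U}"
        using F d by blast
    qed auto
  qed auto
qed (rule lin)

lemma schwartz_zero: "(\<lambda>x. 0) \<in> schwartz"
proof -
  have "partial i (\<lambda>x. 0) = (\<lambda>x. 0 :: complex)" for i :: 'a
    by (simp add: fun_eq_iff partial_eq[OF has_derivative_const])
  then have "iter_partial is (\<lambda>x. 0) = (\<lambda>x. 0 :: complex)" for "is" :: "'a list"
    by (induction "is") simp_all
  then show ?thesis by (auto simp: schwartz_iff smooth_def)
qed

text \<open>
  This is continuity at \<open>0\<close>; the usual bound by seminorms follows by rescaling \<open>\<psi>\<close>.
\<close>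

lemma tempered_distribution_locally_bounded:
  assumes "tempered_distribution T"
  obtains F e where "finite F" "0 < e"
    "\<And>\<psi>. \<psi> \<in> schwartz \<Longrightarrow> (\<And>m is. (m, is) \<in> F \<Longrightarrow> schwartz_seminorm m is \<psi> < e) \<Longrightarrow> cmod (T \<psi>) < 1"
proof -
  have lin: "clinear_on schwartz T" and cont: "continuous_map schwartz_topology euclidean T"
    using assms by (auto simp: tempered_distribution_def)
  have "openin schwartz_topology {\<psi> \<in> topspace schwartz_topology. T \<psi> \<in> ball 0 1}"
    by (rule openin_continuous_map_preimage[OF cont]) simp
  then have op: "schwartz_open {\<psi> \<in> schwartz. T \<psi> \<in> ball 0 1}"
    by (simp add: openin_schwartz_topology topspace_schwartz_topology)
  have zero: "(\<lambda>x. 0) \<in> {\<psi> \<in> schwartz. T \<psi> \<in> ball 0 1}"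
    using clinear_on_zero[OF lin schwartz_zero] by (simp add: schwartz_zero)
  from bspec[OF conjunct2[OF op[unfolded schwartz_open_def]] zero]
  obtain F e where F: "finite F" "0 < e" "schwartz_nhd F e (\<lambda>x. 0) \<subseteq> {\<psi> \<in> schwartz. T \<psi> \<in> ball 0 1}"
    by (elim exE conjE)
  show thesis
  proof (rule that[OF F(1,2)])
    fix \<psi> assume "\<psi> \<in> schwartz" "\<And>m is. (m, is) \<in> F \<Longrightarrow> schwartz_seminorm m is \<psi> < e"
    then have "\<psi> \<in> schwartz_nhd F e (\<lambda>x. 0)" by (auto simp: schwartz_nhd_def)
    then show "cmod (T \<psi>) < 1" using F(3) by auto
  qed
qed

lemma iter_partial_dilate:
  assumes "smooth f"
  shows "iter_partial is (\<lambda>x. f (c *\<^sub>R x)) = (\<lambda>x. complex_of_real (c ^ length is) * iter_partial is f (c *\<^sub>R x))"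
proof (induction "is")
  case (Cons i "is")
  obtain D where D: "\<And>x. (iter_partial is f has_derivative D x) (at x)"
    using assms smooth_has_derivative by metis
  show ?case
  proof
    fix x
    let ?k = "complex_of_real (c ^ length is)"
    have "((\<lambda>x. ?k * iter_partial is f (c *\<^sub>R x)) has_derivative (\<lambda>v. ?k * D (c *\<^sub>R x) (c *\<^sub>R v))) (at x)"
      by (intro has_derivative_mult_right has_derivative_compose[OF has_derivative_scaleR_right[OF has_derivative_ident] D])
    from partial_eq[OF this]
    show "iter_partial (i # is) (\<lambda>x. f (c *\<^sub>R x)) x =
        complex_of_real (c ^ length (i # is)) * iter_partial (i # is) f (c *\<^sub>R x)"
      by (simp add: Cons partial_eq[OF D] linear_scale[OF has_derivative_linear[OF D]] scaleR_conv_of_real[where 'a = complex])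
  qed
qed simp

lemma smooth_dilate:
  assumes "smooth f"
  shows "smooth (\<lambda>x. f (c *\<^sub>R x))"
  unfolding smooth_def iter_partial_dilate[OF assms]
proof (intro allI)
  fix "is"
  obtain D where D: "\<And>x. (iter_partial is f has_derivative D x) (at x)"
    using assms smooth_has_derivative by metis
  have "((\<lambda>x. complex_of_real (c ^ length is) * iter_partial is f (c *\<^sub>R x)) has_derivative
      (\<lambda>v. complex_of_real (c ^ length is) * D (c *\<^sub>R x) (c *\<^sub>R v))) (at x)" for x
    by (intro has_derivative_mult_right has_derivative_compose[OF has_derivative_scaleR_right[OF has_derivative_ident] D])
  then show "(\<lambda>x. complex_of_real (c ^ length is) * iter_partial is f (c *\<^sub>R x)) differentiable_on UNIV"
    unfolding differentiable_on_def differentiable_def by blast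
qed

lemma iter_partial_vanishes:
  assumes "\<And>x. R < norm x \<Longrightarrow> f x = 0" "R < norm x"
  shows "iter_partial is f x = 0"
  using assms(2)
proof (induction "is" arbitrary: x)
  case (Cons i "is")
  have "open {x :: real ^ 'a. R < norm x}" by (intro open_Collect_less continuous_intros)
  then have "(iter_partial is f has_derivative (\<lambda>v. 0)) (at x)"
    using Cons by (intro has_derivative_transform_within_open[OF has_derivative_const, of _ x]) auto
  from partial_eq[OF this] show ?case by simp
qed (use assms in auto)

lemma continuous_on_monom_eval: "continuous_on A (monom_eval m)"
  unfolding monom_eval_def[abs_def] by (intro continuous_intros)

lemma monom_eval_zero [simp]: "monom_eval 0 x = 1"
  by (simp add: monom_eval_def)

definition total_degree :: "('d::finite \<Rightarrow>\<^sub>0 nat) \<Rightarrow> nat" where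
  "total_degree m = (\<Sum>i\<in>UNIV. Poly_Mapping.lookup m i)"

lemma monom_eval_scaleR: "monom_eval m (c *\<^sub>R x) = complex_of_real (c ^ total_degree m) * monom_eval m x"
  by (simp add: monom_eval_def total_degree_def power_mult_distrib prod.distrib power_sum)

lemma norm_monom_eval_le:
  assumes "norm x \<le> R" "1 \<le> R"
  shows "cmod (monom_eval m x) \<le> R ^ total_degree m"
proof -
  have "cmod (monom_eval m x) = (\<Prod>i\<in>UNIV. \<bar>x $ i\<bar> ^ Poly_Mapping.lookup m i)"
    by (simp add: monom_eval_def prod_norm[symmetric] norm_power)
  also have "\<dots> \<le> (\<Prod>i\<in>UNIV. R ^ Poly_Mapping.lookup m i)"
    using assms component_le_norm_cart[of x]
    by (intro prod_mono conjI power_mono) (auto intro: order_trans)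
  also have "\<dots> = R ^ total_degree m" by (simp add: total_degree_def power_sum)
  finally show ?thesis .
qed

lemma Cc_smooth_subset_Cc: "Cc_smooth \<subseteq> Cc"
  using smooth_continuous[of _ "[]"] by (auto simp: Cc_smooth_def Cc_def)

lemma Cc_smooth_subset_schwartz: "Cc_smooth \<subseteq> schwartz"
proof
  fix f :: "real ^ 'd \<Rightarrow> complex" assume f: "f \<in> Cc_smooth"
  then have s: "smooth f" by (simp add: Cc_smooth_def)
  have "bounded {x. f x \<noteq> 0}" using f Cc_smooth_subset_Cc CcD(2) by blast
  then obtain R where R: "\<And>x. f x \<noteq> 0 \<Longrightarrow> norm x \<le> R" by (auto simp: bounded_iff)
  have "\<exists>B. \<forall>x. cmod (monom_eval m x * iter_partial is f x) \<le> B" for m "is"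
  proof -
    let ?g = "\<lambda>x. monom_eval m x * iter_partial is f x"
    have "continuous_on (cball 0 R) ?g"
      by (intro continuous_on_mult continuous_on_monom_eval continuous_on_subset[OF smooth_continuous[OF s]]) auto
    then have "bounded (?g ` cball 0 R)"
      by (intro compact_imp_bounded compact_continuous_image) auto
    then obtain B where B: "0 < B" "\<And>x. norm x \<le> R \<Longrightarrow> cmod (?g x) \<le> B" by (auto simp: bounded_pos)
    have "cmod (?g x) \<le> B" for x
    proof (cases "norm x \<le> R")
      case False
      then have "iter_partial is f x = 0"
        using R by (intro iter_partial_vanishes[of R]) (meson not_le)+
      then show ?thesis using B(1) by simp
    qed (rule B)
    then show ?thesis by blast
  qed
  with s show "f \<in> schwartz" by (simp add: schwartz_iff)
qed

section \<open>A smooth bump function\<close>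

text \<open>
  The functions \<open>p(1/s) exp(-1/s)\<close>, extended by \<open>0\<close> to \<open>s \<le> 0\<close>, are closed under differentiation.
\<close>

definition flat :: "real poly \<Rightarrow> real \<Rightarrow> real" where
  "flat p s = (if 0 < s then poly p (1 / s) * exp (- (1 / s)) else 0)"

lemma flat_tendsto_0:
  fixes p :: "real poly"
  shows "((\<lambda>s. poly p (1 / s) * exp (- (1 / s))) \<longlongrightarrow> 0) (at_right 0)"
proof -
  have "((\<lambda>y::real. \<Sum>i\<le>degree p. coeff p i * (y ^ i / exp y)) \<longlongrightarrow> (\<Sum>i\<le>degree p. coeff p i * 0)) at_top"
    by (intro tendsto_intros tendsto_power_div_exp_0)
  then have "((\<lambda>y::real. poly p y * exp (- y)) \<longlongrightarrow> 0) at_top"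
    by (simp add: poly_altdef sum_distrib_right exp_minus divide_inverse mult.assoc)
  then have "((\<lambda>s. poly p (inverse s) * exp (- inverse s)) \<longlongrightarrow> 0) (at_right 0)"
    by (rule filterlim_compose[OF _ filterlim_inverse_at_top_right])
  then show ?thesis by (simp add: divide_inverse)
qed

definition flat_deriv :: "real poly \<Rightarrow> real poly" where
  "flat_deriv p = [:0, 0, 1:] * (p - pderiv p)"

text \<open>
  At \<open>s = 0\<close> the difference quotient of \<open>flat p\<close> from the right has the form \<open>q(1/s) exp(-1/s)\<close> with
  \<open>q(y) = y p(y)\<close>, which tends to \<open>0\<close> because \<open>exp\<close> beats every polynomial.
\<close>

lemma flat_has_derivative: "(flat p has_real_derivative flat (flat_deriv p) s) (at s)"
proof -
  consider "0 < s" | "s < 0" | "s = 0" by linarith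
  then show ?thesis
  proof cases
    case 1
    have "((\<lambda>s. poly p (1 / s) * exp (- (1 / s))) has_real_derivative flat (flat_deriv p) s) (at s)"
      using 1 by (auto intro!: derivative_eq_intros poly_DERIV[THEN DERIV_chain2]
          simp: flat_def flat_deriv_def field_simps power2_eq_square)
    then show ?thesis
      by (rule has_field_derivative_transform_within_open[of _ _ _ "{0<..}"])
         (use 1 in \<open>auto simp: flat_def\<close>)
  next
    case 2
    have "((\<lambda>s. 0) has_real_derivative flat (flat_deriv p) s) (at s)"
      using 2 by (auto intro!: derivative_eq_intros simp: flat_def)
    then show ?thesis
      by (rule has_field_derivative_transform_within_open[of _ _ _ "{..<0}"])
         (use 2 in \<open>auto simp: flat_def\<close>)
  next
    case 3
    have "((\<lambda>y. flat p y / y) \<longlongrightarrow> 0) (at_left 0)"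
      by (rule tendsto_eventually) (auto simp: flat_def eventually_at_left_field intro!: exI[of _ "-1"])
    moreover have "((\<lambda>y. flat p y / y) \<longlongrightarrow> 0) (at_right 0)"
    proof (rule Lim_transform_eventually[OF flat_tendsto_0[of "pCons 0 p"]])
      show "\<forall>\<^sub>F s in at_right 0. poly (pCons 0 p) (1 / s) * exp (- (1 / s)) = flat p s / s"
        by (auto simp: flat_def eventually_at_right_field intro!: exI[of _ 1])
    qed
    ultimately have "((\<lambda>y. flat p y / y) \<longlongrightarrow> 0) (at 0)" by (rule filterlim_split_at)
    then show ?thesis using 3 by (simp add: has_field_derivative_iff flat_def)
  qed
qed

text \<open>
  The algebra generated by the coordinates and the functions \<open>flat p (c - \<bar>x\<bar>\<^sup>2)\<close>.  It is closed under
  partial derivatives by the product and chain rules, and so consists of smooth functions.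
\<close>

inductive_set bump_algebra :: "(real ^ 'd::finite \<Rightarrow> complex) set" where
  const: "(\<lambda>x. c) \<in> bump_algebra"
| coord: "(\<lambda>x. complex_of_real (x $ i)) \<in> bump_algebra"
| flat: "(\<lambda>x. complex_of_real (flat p (c - x \<bullet> x))) \<in> bump_algebra"
| add: "f \<in> bump_algebra \<Longrightarrow> g \<in> bump_algebra \<Longrightarrow> (\<lambda>x. f x + g x) \<in> bump_algebra"
| mult: "f \<in> bump_algebra \<Longrightarrow> g \<in> bump_algebra \<Longrightarrow> (\<lambda>x. f x * g x) \<in> bump_algebra"

lemma bump_algebra_derivative:
  fixes f :: "real ^ 'd::finite \<Rightarrow> complex"
  assumes "f \<in> bump_algebra"
  shows "\<exists>f'. (\<forall>x. (f has_derivative f' x) (at x)) \<and> (\<forall>i. (\<lambda>x. f' x (axis i 1)) \<in> bump_algebra)"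
  using assms
proof induction
  case (const c)
  show ?case
    by (rule exI[of _ "\<lambda>x v. 0"]) (auto intro: bump_algebra.const)
next
  case (coord i)
  show ?case
  proof (intro exI conjI allI)
    show "((\<lambda>x. complex_of_real (x $ i)) has_derivative (\<lambda>v. complex_of_real (v $ i))) (at x)" for x :: "real ^ 'd"
      by (intro has_derivative_of_real bounded_linear.has_derivative[OF bounded_linear_vec_nth] has_derivative_ident)
  qed (rule bump_algebra.const)
next
  case (flat p c)
  show ?case
  proof (intro exI conjI allI)
    let ?f' = "\<lambda>x v. complex_of_real (flat (flat_deriv p) (c - x \<bullet> x) * (- 2 * (x \<bullet> v)))"
    show "((\<lambda>x. complex_of_real (flat p (c - x \<bullet> x))) has_derivative ?f' x) (at x)" for x :: "real ^ 'd"
    proof (intro has_derivative_of_real)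
      have "((\<lambda>x. c - x \<bullet> x) has_derivative (\<lambda>v. - 2 * (x \<bullet> v))) (at x)"
        by (auto intro!: derivative_eq_intros simp: inner_commute)
      then show "((\<lambda>x. flat p (c - x \<bullet> x)) has_derivative
          (\<lambda>v. flat (flat_deriv p) (c - x \<bullet> x) * (- 2 * (x \<bullet> v)))) (at x)"
        by (rule has_derivative_compose[OF _ flat_has_derivative[unfolded has_field_derivative_def]])
    qed
    have "(\<lambda>x. (-2) * (complex_of_real (x $ i) * complex_of_real (flat (flat_deriv p) (c - x \<bullet> x)))) \<in> bump_algebra" for i
      by (intro bump_algebra.intros)
    then show "(\<lambda>x. ?f' x (axis i 1)) \<in> bump_algebra" for i
      by (simp add: inner_axis mult_ac)
  qed
next
  case (add f g)
  then obtain f' g' where *: "\<And>x. (f has_derivative f' x) (at x)" "\<And>i. (\<lambda>x. f' x (axis i 1)) \<in> bump_algebra"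
    "\<And>x. (g has_derivative g' x) (at x)" "\<And>i. (\<lambda>x. g' x (axis i 1)) \<in> bump_algebra" by blast
  show ?case
    by (rule exI[of _ "\<lambda>x v. f' x v + g' x v"]) (auto intro!: has_derivative_add bump_algebra.add *)
next
  case (mult f g)
  then obtain f' g' where *: "\<And>x. (f has_derivative f' x) (at x)" "\<And>i. (\<lambda>x. f' x (axis i 1)) \<in> bump_algebra"
    "\<And>x. (g has_derivative g' x) (at x)" "\<And>i. (\<lambda>x. g' x (axis i 1)) \<in> bump_algebra" by blast
  show ?case
    by (rule exI[of _ "\<lambda>x v. f x * g' x v + f' x v * g x"])
       (intro conjI allI has_derivative_mult bump_algebra.add bump_algebra.mult * mult.hyps)
qed

lemma bump_algebra_smooth:
  fixes f :: "real ^ 'd::finite \<Rightarrow> complex"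
  assumes "f \<in> bump_algebra"
  shows "smooth f"
proof (rule smooth_coinduct[OF assms])
  fix g :: "real ^ 'd \<Rightarrow> complex" assume g: "g \<in> bump_algebra"
  obtain g' where g': "\<And>x. (g has_derivative g' x) (at x)" "\<And>i. (\<lambda>x. g' x (axis i 1)) \<in> bump_algebra"
    using bump_algebra_derivative[OF g] by blast
  show "g differentiable_on UNIV"
    using g'(1) unfolding differentiable_on_def differentiable_def by blast
  have "partial i g = (\<lambda>x. g' x (axis i 1))" for i
    using partial_eq[OF g'(1)] by (simp add: fun_eq_iff)
  then show "partial i g \<in> bump_algebra" for i using g'(2) by simp
qed

definition bump :: "real ^ 'd::finite \<Rightarrow> real" where
  "bump x = flat 1 (2 - x \<bullet> x)"

lemma bump_nonneg: "0 \<le> bump x"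
  by (simp add: bump_def flat_def)

lemma bump_ge: "norm x \<le> 1 \<Longrightarrow> exp (-1) \<le> bump x"
proof -
  assume "norm x \<le> 1"
  then have "x \<bullet> x \<le> 1" by (simp add: dot_square_norm power_le_one)
  then show ?thesis by (simp add: bump_def flat_def divide_le_eq)
qed

lemma bump_Cc_smooth: "(\<lambda>x. complex_of_real (bump x)) \<in> Cc_smooth"
proof -
  have "smooth (\<lambda>x::real ^ 'a. complex_of_real (bump x))"
    unfolding bump_def by (intro bump_algebra_smooth bump_algebra.flat)
  moreover have "norm x \<le> 2" if "bump x \<noteq> 0" for x :: "real ^ 'a"
  proof -
    have "(norm x)\<^sup>2 \<le> 2\<^sup>2" using that by (simp add: bump_def flat_def dot_square_norm split: if_splits)
    then show ?thesis by (rule power2_le_imp_le) simp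
  qed
  then have "bounded {x :: real ^ 'a. complex_of_real (bump x) \<noteq> 0}" by (auto simp: bounded_iff)
  ultimately show ?thesis by (simp add: Cc_smooth_def fun_support_def)
qed

section \<open>Superpositions of dilated Schwartz functions\<close>

text \<open>
  The Weierstrass test: the summable bound makes the series of derivatives converge uniformly in \<open>x\<close>.
\<close>

lemma has_derivative_suminf:
  fixes f :: "nat \<Rightarrow> 'a::real_normed_vector \<Rightarrow> 'b::banach"
  assumes f: "\<And>n x. (f n has_derivative f' n x) (at x)"
    and bound: "\<And>n x v. norm (f' n x v) \<le> M n * norm v" and M: "summable M"
    and summ: "\<And>x. summable (\<lambda>n. f n x)"
  shows "((\<lambda>x. suminf (\<lambda>n. f n x)) has_derivative (\<lambda>v. suminf (\<lambda>n. f' n x v))) (at x)"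
proof -
  have "\<exists>g. \<forall>x\<in>UNIV. (\<lambda>n. f n x) sums g x \<and> (g has_derivative (\<lambda>v. suminf (\<lambda>n. f' n x v))) (at x within UNIV)"
  proof (rule has_derivative_series)
    show "(\<lambda>n. f n 0) sums suminf (\<lambda>n. f n 0)" using summ by (rule summable_sums)
    fix e :: real assume e: "0 < e"
    obtain N where N: "\<And>n. N \<le> n \<Longrightarrow> norm (suminf (\<lambda>i. M (i + n))) < e"
      using suminf_exist_split[OF e M] by blast
    show "\<forall>\<^sub>F n in sequentially. \<forall>x\<in>UNIV. \<forall>v. norm ((\<Sum>i<n. f' i x v) - suminf (\<lambda>n. f' n x v)) \<le> e * norm v"
      unfolding eventually_sequentially
    proof (intro exI allI impI ballI)
      fix n and x v :: 'a assume n: "N \<le> n"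
      have Mv: "summable (\<lambda>i. M i * norm v)" using M by (rule summable_mult2)
      have s: "summable (\<lambda>i. f' i x v)" by (rule summable_comparison_test'[OF Mv bound])
      have Mn: "summable (\<lambda>i. M (i + n))" using M by (rule summable_ignore_initial_segment)
      have "norm ((\<Sum>i<n. f' i x v) - suminf (\<lambda>n. f' n x v)) = norm (suminf (\<lambda>i. f' (i + n) x v))"
        using suminf_split_initial_segment[OF s, of n] by (simp add: norm_minus_commute)
      also have "\<dots> \<le> suminf (\<lambda>i. M (i + n) * norm v)"
        using Mn by (intro norm_suminf_le bound summable_mult2)
      also have "\<dots> = suminf (\<lambda>i. M (i + n)) * norm v"
        using suminf_mult2[OF Mn] by simp
      also have "\<dots> \<le> e * norm v"
        using N[OF n] by (intro mult_right_mono) auto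
      finally show "norm ((\<Sum>i<n. f' i x v) - suminf (\<lambda>n. f' n x v)) \<le> e * norm v" .
    qed
  qed (use f in auto)
  then obtain g where g: "\<And>x. (\<lambda>n. f n x) sums g x" "\<And>x. (g has_derivative (\<lambda>v. suminf (\<lambda>n. f' n x v))) (at x)"
    by auto
  then have "g = (\<lambda>x. suminf (\<lambda>n. f n x))" by (simp add: fun_eq_iff sums_unique)
  with g(2) show ?thesis by simp
qed

lemma norm_derivative_le_partials:
  fixes f :: "real ^ 'd::finite \<Rightarrow> complex"
  assumes D: "(f has_derivative D) (at x)" and B: "\<And>i. cmod (partial i f x) \<le> B"
  shows "cmod (D v) \<le> real CARD('d) * B * norm v"
proof -
  have "D v = D (\<Sum>i\<in>UNIV. (v $ i) *\<^sub>R axis i 1)"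
    using basis_expansion[of v] by (simp add: scalar_mult_eq_scaleR)
  also have "\<dots> = (\<Sum>i\<in>UNIV. (v $ i) *\<^sub>R partial i f x)"
    using has_derivative_linear[OF D] by (simp add: linear_sum linear_scale partial_eq[OF D])
  also have "cmod \<dots> \<le> (\<Sum>i\<in>(UNIV::'d set). norm v * B)"
    by (intro sum_norm_le) (auto intro!: mult_mono B component_le_norm_cart)
  finally show ?thesis by (simp add: mult_ac)
qed

lemma dilation_series_derivative:
  fixes g :: "real ^ 'd::finite \<Rightarrow> complex"
  assumes D: "\<And>x. (g has_derivative D x) (at x)"
    and A: "\<And>x. cmod (g x) \<le> A" and B: "\<And>i x. cmod (partial i g x) \<le> B"
    and b: "summable (\<lambda>j. \<bar>b j\<bar>)" and c: "\<And>j. 0 \<le> c j" "\<And>j. c j \<le> 1"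
  shows "((\<lambda>x. suminf (\<lambda>j. complex_of_real (b j) * g (c j *\<^sub>R x))) has_derivative
      (\<lambda>v. suminf (\<lambda>j. complex_of_real (b j) * D (c j *\<^sub>R x) (c j *\<^sub>R v)))) (at x)"
proof (rule has_derivative_suminf[where M = "\<lambda>j. \<bar>b j\<bar> * (real CARD('d) * B)"])
  show "((\<lambda>x. complex_of_real (b j) * g (c j *\<^sub>R x)) has_derivative
      (\<lambda>v. complex_of_real (b j) * D (c j *\<^sub>R x) (c j *\<^sub>R v))) (at x)" for j x
    by (intro has_derivative_mult_right has_derivative_compose[OF has_derivative_scaleR_right[OF has_derivative_ident] D])
  show "summable (\<lambda>j. \<bar>b j\<bar> * (real CARD('d) * B))" using b by (rule summable_mult2)
  have B0: "0 \<le> B" using B norm_ge_zero order_trans by blast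
  show "cmod (complex_of_real (b j) * D (c j *\<^sub>R x) (c j *\<^sub>R v)) \<le> \<bar>b j\<bar> * (real CARD('d) * B) * norm v" for j x v
  proof -
    have "cmod (D (c j *\<^sub>R x) (c j *\<^sub>R v)) \<le> real CARD('d) * B * norm (c j *\<^sub>R v)"
      by (rule norm_derivative_le_partials[OF D B])
    also have "\<dots> \<le> real CARD('d) * B * norm v"
      using B0 c[of j] by (intro mult_left_mono) (auto intro: mult_left_le_one_le)
    finally show ?thesis by (simp add: norm_mult mult_left_mono mult.assoc)
  qed
  show "summable (\<lambda>j. complex_of_real (b j) * g (c j *\<^sub>R x))" for x
  proof (rule summable_comparison_test')
    show "summable (\<lambda>j. \<bar>b j\<bar> * A)" using b by (rule summable_mult2)
    show "cmod (complex_of_real (b j) * g (c j *\<^sub>R x)) \<le> \<bar>b j\<bar> * A" for j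
      using A by (simp add: norm_mult mult_left_mono)
  qed
qed

text \<open>
  A derivative of order \<open>r\<close> of \<open>h(c\<^sub>j x)\<close> gains the factor \<open>c\<^sub>j\<^sup>r \<le> 1\<close>, while a monomial of degree \<open>N\<close>
  costs a factor \<open>c\<^sub>j\<^bsup>-N\<^esup>\<close>, as \<open>x\<^sup>m = c\<^sub>j\<^bsup>-N\<^esup> (c\<^sub>j x)\<^sup>m\<close>.  The summability condition pays for this for
  all \<open>N\<close> at once.
\<close>

lemma dilation_series_schwartz:
  fixes h :: "real ^ 'd::finite \<Rightarrow> complex"
  assumes h: "h \<in> schwartz" and c: "\<And>j. 0 < c j" "\<And>j. c j \<le> 1"
    and a: "\<And>N. summable (\<lambda>j. \<bar>a j\<bar> / c j ^ N)"
  shows "(\<lambda>x. suminf (\<lambda>j. complex_of_real (a j) * h (c j *\<^sub>R x))) \<in> schwartz"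
proof -
  let ?F = "\<lambda>x. suminf (\<lambda>j. complex_of_real (a j) * h (c j *\<^sub>R x))"
  let ?G = "\<lambda>is x. suminf (\<lambda>j. complex_of_real (a j * c j ^ length is) * iter_partial is h (c j *\<^sub>R x))"
  note hs = schwartz_smooth[OF h]
  have bd: "cmod (iter_partial is h x) \<le> schwartz_seminorm 0 is h" for "is" x
    using schwartz_seminorm_upper[OF h, of 0 x "is"] by simp
  have ac: "summable (\<lambda>j. \<bar>a j * c j ^ k\<bar>)" for k
  proof (rule summable_comparison_test'[OF a[of 0]])
    fix j
    have "\<bar>a j\<bar> * c j ^ k \<le> \<bar>a j\<bar>" using c[of j] by (simp add: mult_left_le power_le_one)
    then show "norm \<bar>a j * c j ^ k\<bar> \<le> \<bar>a j\<bar> / c j ^ 0" using c(1)[of j] by (simp add: abs_mult)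
  qed
  have deriv: "\<exists>D'. (\<forall>x. (?G is has_derivative D' x) (at x)) \<and> (\<forall>i x. D' x (axis i 1) = ?G (i # is) x)" for "is"
  proof -
    obtain D where D: "\<And>x. (iter_partial is h has_derivative D x) (at x)"
      using hs smooth_has_derivative by metis
    define B where "B = Max (range (\<lambda>i. schwartz_seminorm 0 (i # is) h))"
    have B: "cmod (partial i (iter_partial is h) x) \<le> B" for i x
    proof -
      have "schwartz_seminorm 0 (i # is) h \<le> B" unfolding B_def by (intro Max_ge) auto
      then show ?thesis using bd[of "i # is" x] by simp
    qed
    have lin: "D y (c j *\<^sub>R axis i 1) = complex_of_real (c j) * iter_partial (i # is) h y" for y i j
      by (simp add: linear_scale[OF has_derivative_linear[OF D]] partial_eq[OF D] scaleR_conv_of_real[where 'a = complex])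
    show ?thesis
    proof (intro exI conjI allI)
      show "(?G is has_derivative
        (\<lambda>v. suminf (\<lambda>j. complex_of_real (a j * c j ^ length is) * D (c j *\<^sub>R x) (c j *\<^sub>R v)))) (at x)" for x
        by (rule dilation_series_derivative[OF D bd B ac]) (use c in \<open>auto intro: less_imp_le\<close>)
      show "suminf (\<lambda>j. complex_of_real (a j * c j ^ length is) * D (c j *\<^sub>R x) (c j *\<^sub>R axis i 1)) = ?G (i # is) x" for i x
        unfolding lin by (simp add: mult_ac)
    qed
  qed
  have eq: "iter_partial is ?F = ?G is" for "is"
  proof (induction "is")
    case (Cons i "is")
    obtain D' where D': "\<And>x. (?G is has_derivative D' x) (at x)" "\<And>i x. D' x (axis i 1) = ?G (i # is) x"
      using deriv[of "is"] by blast
    have "iter_partial (i # is) ?F = partial i (?G is)" using Cons by simp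
    also have "\<dots> = ?G (i # is)" by (rule ext) (simp only: partial_eq[OF D'(1)] D'(2))
    finally show ?case .
  qed simp
  show ?thesis
    unfolding schwartz_iff
  proof (intro conjI allI)
    show "smooth ?F"
      unfolding smooth_def eq
    proof
      fix "is"
      show "?G is differentiable_on UNIV"
        using deriv[of "is"] unfolding differentiable_on_def differentiable_def by blast
    qed
    fix m "is"
    let ?B = "schwartz_seminorm m is h"
    have s: "summable (\<lambda>j. \<bar>a j\<bar> / c j ^ total_degree m * ?B)" using a by (rule summable_mult2)
    have "cmod (monom_eval m x * ?G is x) \<le> suminf (\<lambda>j. \<bar>a j\<bar> / c j ^ total_degree m * ?B)" for x
    proof -
      have "summable (\<lambda>j. \<bar>a j * c j ^ length is\<bar> * schwartz_seminorm 0 is h)"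
        using ac by (rule summable_mult2)
      then have "summable (\<lambda>j. complex_of_real (a j * c j ^ length is) * iter_partial is h (c j *\<^sub>R x))"
        by (rule summable_comparison_test') (use bd in \<open>simp add: norm_mult abs_mult mult_left_mono norm_power power_abs\<close>)
      then have "monom_eval m x * ?G is x =
          suminf (\<lambda>j. monom_eval m x * (complex_of_real (a j * c j ^ length is) * iter_partial is h (c j *\<^sub>R x)))"
        by (rule suminf_mult[symmetric])
      also have "cmod \<dots> \<le> suminf (\<lambda>j. \<bar>a j\<bar> / c j ^ total_degree m * ?B)"
      proof (rule norm_suminf_le[OF _ s])
        fix j
        let ?d = "total_degree m"
        have "cmod (monom_eval m x * (complex_of_real (a j * c j ^ length is) * iter_partial is h (c j *\<^sub>R x)))
            = \<bar>a j\<bar> / c j ^ ?d * c j ^ length is * cmod (monom_eval m (c j *\<^sub>R x) * iter_partial is h (c j *\<^sub>R x))"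
          using c(1)[of j] by (simp add: monom_eval_scaleR norm_mult abs_mult norm_power field_simps)
        also have "\<dots> \<le> \<bar>a j\<bar> / c j ^ ?d * 1 * ?B"
          using c[of j] by (intro mult_mono schwartz_seminorm_upper[OF h]) (auto intro: power_le_one less_imp_le)
        finally show "cmod (monom_eval m x * (complex_of_real (a j * c j ^ length is) * iter_partial is h (c j *\<^sub>R x)))
            \<le> \<bar>a j\<bar> / c j ^ ?d * ?B" by simp
      qed
      finally show ?thesis .
    qed
    then show "\<exists>B. \<forall>x. cmod (monom_eval m x * iter_partial is ?F x) \<le> B" unfolding eq by blast
  qed
qed

section \<open>Polynomial growth and the temperedness conditions\<close>

definition polynomial_growth :: "'a::euclidean_space measure \<Rightarrow> bool" where
  "polynomial_growth M \<longleftrightarrow> (\<exists>C N. \<forall>R\<ge>1. measure M (cball 0 R) \<le> C * R ^ N)"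

lemma locally_finite_emeasure_cball:
  "locally_finite_borel M \<Longrightarrow> emeasure M (cball x R) = ennreal (measure M (cball x R))"
  using locally_finite_borelD(2)[of M "cball x R"] by (intro emeasure_eq_ennreal_measure) auto

lemma poly_eval_bound:
  fixes P :: "('d::finite \<Rightarrow>\<^sub>0 nat) \<Rightarrow>\<^sub>0 complex"
  obtains A N where "0 \<le> A" "\<And>x R. norm x \<le> R \<Longrightarrow> 1 \<le> R \<Longrightarrow> cmod (poly_eval P x) \<le> A * R ^ N"
proof
  let ?K = "Poly_Mapping.keys P" and ?c = "\<lambda>m. cmod (Poly_Mapping.lookup P m)"
  let ?N = "\<Sum>m\<in>?K. total_degree m"
  show "0 \<le> (\<Sum>m\<in>?K. ?c m)" by (intro sum_nonneg) auto
  fix x :: "real ^ 'd" and R :: real assume x: "norm x \<le> R" "1 \<le> R"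
  have "cmod (poly_eval P x) \<le> (\<Sum>m\<in>?K. ?c m * R ^ ?N)"
    unfolding poly_eval_def
  proof (rule sum_norm_le)
    fix m assume m: "m \<in> ?K"
    have "cmod (monom_eval m x) \<le> R ^ total_degree m" by (rule norm_monom_eval_le[OF x])
    also have "\<dots> \<le> R ^ ?N" using x m by (intro power_increasing member_le_sum) auto
    finally show "cmod (Poly_Mapping.lookup P m * monom_eval m x) \<le> ?c m * R ^ ?N"
      by (simp add: norm_mult mult_left_mono)
  qed
  then show "cmod (poly_eval P x) \<le> (\<Sum>m\<in>?K. ?c m) * R ^ ?N" by (simp add: sum_distrib_right)
qed

text \<open>
  On the ball of radius \<open>R\<close> the integrand is at least \<open>1 / (1 + A R\<^sup>N)\<close>.
\<close>

lemma slow_integral_imp_polynomial_growth: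
  fixes M :: "(real ^ 'd::finite) measure"
  assumes M: "locally_finite_borel M"
    and fin: "(\<integral>\<^sup>+x. ennreal (1 / (1 + cmod (poly_eval P x))) \<partial>M) < \<infinity>"
  shows "polynomial_growth M"
proof -
  obtain A N where A: "0 \<le> A" "\<And>x R. norm x \<le> R \<Longrightarrow> 1 \<le> R \<Longrightarrow> cmod (poly_eval P x) \<le> A * R ^ N"
    using poly_eval_bound by blast
  obtain I where I: "0 \<le> I" "(\<integral>\<^sup>+x. ennreal (1 / (1 + cmod (poly_eval P x))) \<partial>M) = ennreal I"
    using fin by (cases "\<integral>\<^sup>+x. ennreal (1 / (1 + cmod (poly_eval P x))) \<partial>M") auto
  have "measure M (cball 0 R) \<le> (I * (1 + A)) * R ^ N" if R: "1 \<le> R" for R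
  proof -
    let ?w = "1 / (1 + A * R ^ N)"
    have pos: "0 < 1 + A * R ^ N" using A R by (intro add_pos_nonneg) auto
    have "ennreal (?w * measure M (cball 0 R)) = ennreal ?w * emeasure M (cball 0 R)"
      unfolding locally_finite_emeasure_cball[OF M] by (rule ennreal_mult) (use pos in auto)
    also have "\<dots> = (\<integral>\<^sup>+x. ennreal ?w * indicator (cball 0 R) x \<partial>M)"
      using locally_finite_borelD(1)[OF M] by (subst nn_integral_cmult_indicator) auto
    also have "\<dots> \<le> (\<integral>\<^sup>+x. ennreal (1 / (1 + cmod (poly_eval P x))) \<partial>M)"
    proof (rule nn_integral_mono)
      fix x
      show "ennreal ?w * indicator (cball 0 R) x \<le> ennreal (1 / (1 + cmod (poly_eval P x)))"
      proof (cases "x \<in> cball 0 R")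
        case True
        then have "cmod (poly_eval P x) \<le> A * R ^ N" using R by (intro A) auto
        then have "?w \<le> 1 / (1 + cmod (poly_eval P x))"
          by (intro divide_left_mono mult_pos_pos pos add_pos_nonneg) auto
        then show ?thesis using True by (simp add: ennreal_leI)
      qed simp
    qed
    finally have "?w * measure M (cball 0 R) \<le> I" using I pos by (simp add: ennreal_le_iff)
    then have "measure M (cball 0 R) \<le> I * (1 + A * R ^ N)" using pos by (simp add: field_simps)
    also have "\<dots> \<le> I * (R ^ N + A * R ^ N)" using I R by (intro mult_left_mono add_right_mono) auto
    finally show ?thesis by (simp add: algebra_simps)
  qed
  then show ?thesis unfolding polynomial_growth_def by blast
qed

definition power_sum_poly :: "nat \<Rightarrow> ('d::finite \<Rightarrow>\<^sub>0 nat) \<Rightarrow>\<^sub>0 complex" where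
  "power_sum_poly k = (\<Sum>i\<in>UNIV. Poly_Mapping.single (Poly_Mapping.single i k) 1)"

lemma monom_eval_single: "monom_eval (Poly_Mapping.single i k) x = complex_of_real (x $ i) ^ k"
proof -
  have "monom_eval (Poly_Mapping.single i k) x = (\<Prod>j\<in>UNIV. if j = i then complex_of_real (x $ j) ^ k else 1)"
    unfolding monom_eval_def by (rule prod.cong) (auto simp: lookup_single when_def)
  then show ?thesis by simp
qed

lemma poly_eval_power_sum_poly:
  assumes "0 < k"
  shows "poly_eval (power_sum_poly k) x = complex_of_real (\<Sum>i\<in>UNIV. (x $ i) ^ k)"
proof -
  let ?s = "\<lambda>i::'a. Poly_Mapping.single i k" and ?P = "power_sum_poly k :: ('a \<Rightarrow>\<^sub>0 nat) \<Rightarrow>\<^sub>0 complex"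
  have inj: "inj ?s"
  proof
    fix i j assume "?s i = ?s j"
    then have "Poly_Mapping.lookup (?s i) i = Poly_Mapping.lookup (?s j) i" by simp
    then show "i = j" using assms by (auto simp: lookup_single when_def split: if_splits)
  qed
  have coeff: "Poly_Mapping.lookup ?P (?s j) = 1" for j
  proof -
    have "(?s i = ?s j) = (i = j)" for i using inj by (auto dest: injD)
    then show ?thesis by (simp add: power_sum_poly_def lookup_sum lookup_single when_def)
  qed
  have keys: "Poly_Mapping.keys ?P \<subseteq> range ?s"
    unfolding power_sum_poly_def by (rule order_trans[OF keys_sum]) auto
  have "poly_eval ?P x = (\<Sum>m\<in>range ?s. Poly_Mapping.lookup ?P m * monom_eval m x)"
    unfolding poly_eval_def using keys by (intro sum.mono_neutral_left) (auto simp: in_keys_iff)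
  also have "\<dots> = (\<Sum>i\<in>UNIV. complex_of_real (x $ i) ^ k)"
    by (simp add: sum.reindex[OF inj] coeff monom_eval_single)
  finally show ?thesis by simp
qed

text \<open>
  The norm is at most \<open>CARD('d)\<close> times the largest coordinate in absolute value.
\<close>

lemma norm_power_le_power_sum:
  fixes x :: "real ^ 'd::finite"
  shows "(1 + norm x) ^ L \<le> (2 * real CARD('d)) ^ L * (1 + (\<Sum>i\<in>UNIV. (x $ i) ^ (2 * L)))"
proof -
  let ?m = "Max (range (\<lambda>i. \<bar>x $ i\<bar>))" and ?d = "real CARD('d)"
  have "?m \<in> range (\<lambda>i. \<bar>x $ i\<bar>)" by (rule Max_in) auto
  then obtain i where i: "?m = \<bar>x $ i\<bar>" by blast
  have "norm x \<le> (\<Sum>j\<in>UNIV. \<bar>x $ j\<bar>)" by (rule norm_le_l1_cart)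
  also have "\<dots> \<le> (\<Sum>j\<in>(UNIV::'d set). \<bar>x $ i\<bar>)"
    unfolding i[symmetric] by (intro sum_mono Max_ge) auto
  finally have n: "norm x \<le> ?d * \<bar>x $ i\<bar>" by simp
  have d: "1 \<le> ?d" by (simp add: Suc_le_eq)
  have "1 + norm x \<le> ?d * 1 + ?d * \<bar>x $ i\<bar>" using n d by linarith
  also have "\<dots> \<le> ?d * (2 * max 1 \<bar>x $ i\<bar>)"
    unfolding distrib_left[symmetric] using d by (intro mult_left_mono) auto
  finally have "(1 + norm x) ^ L \<le> (2 * ?d * max 1 \<bar>x $ i\<bar>) ^ L"
    by (intro power_mono) (auto simp: mult_ac)
  also have "\<dots> = (2 * ?d) ^ L * max 1 \<bar>x $ i\<bar> ^ L" by (simp only: power_mult_distrib)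
  also have "max 1 \<bar>x $ i\<bar> ^ L \<le> 1 + (x $ i) ^ (2 * L)"
  proof (cases "1 \<le> \<bar>x $ i\<bar>")
    case True
    then have "\<bar>x $ i\<bar> ^ L \<le> \<bar>x $ i\<bar> ^ (2 * L)" by (intro power_increasing) auto
    also have "\<dots> = (x $ i) ^ (2 * L)" by (simp add: power_mult)
    finally show ?thesis using True by (simp add: max_absorb2)
  qed (simp add: max_absorb1 power_mult)
  also have "(x $ i) ^ (2 * L) \<le> (\<Sum>i\<in>UNIV. (x $ i) ^ (2 * L))"
    by (rule member_le_sum) (auto simp: power_mult)
  finally show ?thesis by (simp add: mult_left_mono)
qed

lemma summable_inverse_squares: "summable (\<lambda>n. inverse (real (Suc n) ^ 2))"
  using inverse_power_summable[of 2, where 'a = real]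
    summable_Suc_iff[of "\<lambda>n. inverse (real n ^ 2)"] by simp

text \<open>
  Where \<open>k \<le> \<bar>x\<bar> \<le> k + 1\<close> the integrand is at most \<open>K / (k + 1)\<^sup>L\<close>, and that shell has mass at most
  \<open>C (k + 1)\<^sup>N\<close>; so \<open>L = N + 2\<close> makes the sum over the shells converge.
\<close>

lemma polynomial_growth_imp_slow_integral:
  fixes M :: "(real ^ 'd::finite) measure"
  assumes M: "locally_finite_borel M" and G: "polynomial_growth M"
  obtains L where "0 < L" "(\<integral>\<^sup>+x. ennreal (1 / (1 + (\<Sum>i\<in>UNIV. (x $ i) ^ (2 * L)))) \<partial>M) < \<infinity>"
proof -
  obtain C N where C: "\<And>R. 1 \<le> R \<Longrightarrow> measure M (cball 0 R) \<le> C * R ^ N"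
    using G unfolding polynomial_growth_def by blast
  have C0: "0 \<le> C" using order_trans[OF measure_nonneg C[of 1]] by simp
  define L where "L = N + 2"
  define K where "K = (2 * real CARD('d)) ^ L"
  have K: "0 < K" by (simp add: K_def)
  let ?Q = "\<lambda>x::real ^ 'd. \<Sum>i\<in>UNIV. (x $ i) ^ (2 * L)"
  let ?t = "\<lambda>k x. ennreal (K / real (Suc k) ^ L) * indicator (cball 0 (real (Suc k))) x"
  have "(\<integral>\<^sup>+x. ennreal (1 / (1 + ?Q x)) \<partial>M) \<le> (\<integral>\<^sup>+x. suminf (\<lambda>k. ?t k x) \<partial>M)"
  proof (rule nn_integral_mono)
    fix x :: "real ^ 'd"
    define k where "k = nat \<lfloor>norm x\<rfloor>"
    have k: "real k \<le> norm x" "norm x \<le> real (Suc k)"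
      unfolding k_def by (auto simp: le_nat_floor intro: less_imp_le) linarith+
    have Q: "0 \<le> ?Q x" by (intro sum_nonneg) (simp add: power_mult)
    have "real (Suc k) ^ L \<le> (1 + norm x) ^ L" using k by (intro power_mono) auto
    also have "\<dots> \<le> K * (1 + ?Q x)" unfolding K_def by (rule norm_power_le_power_sum)
    finally have "1 / (1 + ?Q x) \<le> K / real (Suc k) ^ L"
      using Q by (simp add: field_simps del: of_nat_Suc)
    then have "ennreal (1 / (1 + ?Q x)) \<le> ?t k x" using k by (simp add: ennreal_leI)
    also have "\<dots> = (\<Sum>j\<in>{k}. ?t j x)" by (subst sum.insert) simp_all
    also have "\<dots> \<le> suminf (\<lambda>k. ?t k x)" by (rule sum_le_suminf) auto
    finally show "ennreal (1 / (1 + ?Q x)) \<le> suminf (\<lambda>k. ?t k x)" .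
  qed
  also have "\<dots> = suminf (\<lambda>k. ennreal (K / real (Suc k) ^ L) * emeasure M (cball 0 (real (Suc k))))"
  proof -
    have [measurable]: "cball 0 r \<in> sets M" for r :: real using locally_finite_borelD(1)[OF M] by simp
    show ?thesis by (subst nn_integral_suminf) (auto simp: nn_integral_cmult_indicator simp del: of_nat_Suc)
  qed
  also have "\<dots> \<le> suminf (\<lambda>k. ennreal (K * C * inverse (real (Suc k) ^ 2)))"
  proof (rule suminf_le)
    fix k
    have "K / real (Suc k) ^ L * measure M (cball 0 (real (Suc k))) \<le> K / real (Suc k) ^ L * (C * real (Suc k) ^ N)"
      using K by (intro mult_left_mono C) auto
    also have "\<dots> = K * C * inverse (real (Suc k) ^ 2)"
      by (simp add: L_def power_add power2_eq_square field_simps del: of_nat_Suc)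
    finally show "ennreal (K / real (Suc k) ^ L) * emeasure M (cball 0 (real (Suc k)))
        \<le> ennreal (K * C * inverse (real (Suc k) ^ 2))"
      using K by (simp add: locally_finite_emeasure_cball[OF M] ennreal_leI flip: ennreal_mult del: of_nat_Suc)
  qed auto
  also have "\<dots> < \<infinity>"
  proof -
    have "summable (\<lambda>k. K * C * inverse (real (Suc k) ^ 2))"
      by (intro summable_mult summable_inverse_squares)
    then show ?thesis using K C0 by (subst suminf_ennreal2) auto
  qed
  finally show thesis by (intro that[of L]) (auto simp: L_def)
qed

text \<open>
  Multiplication of \<open>\<psi>\<close> by \<open>1 + \<Sum>\<^sub>i x\<^sub>i\<^bsup>2L\<^esup>\<close> is controlled by the seminorms of order \<open>0\<close> with the
  monomials \<open>1\<close> and \<open>x\<^sub>i\<^bsup>2L\<^esup>\<close>, and the reciprocal of that polynomial is integrable.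
\<close>

lemma polynomial_growth_imp_schwartz_integrable:
  fixes M :: "(real ^ 'd::finite) measure"
  assumes M: "locally_finite_borel M" and G: "polynomial_growth M"
  obtains C F where "0 \<le> C" "finite F"
    "\<And>\<psi>. \<psi> \<in> schwartz \<Longrightarrow> integrable M (\<lambda>x. cmod (\<psi> x))"
    "\<And>\<psi>. \<psi> \<in> schwartz \<Longrightarrow> (\<integral>x. cmod (\<psi> x) \<partial>M) \<le> C * (\<Sum>(m, is)\<in>F. schwartz_seminorm m is \<psi>)"
proof -
  obtain L where L: "0 < L" "(\<integral>\<^sup>+x. ennreal (1 / (1 + (\<Sum>i\<in>UNIV. (x $ i) ^ (2 * L)))) \<partial>M) < \<infinity>"
    using polynomial_growth_imp_slow_integral[OF M G] by blast
  define w where "w x = 1 / (1 + (\<Sum>i\<in>UNIV. (x $ i) ^ (2 * L)))" for x :: "real ^ 'd"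
  have Q: "0 \<le> (\<Sum>i\<in>UNIV. (x $ i) ^ (2 * L))" for x :: "real ^ 'd"
    by (intro sum_nonneg) (simp add: power_mult)
  have w0: "0 \<le> w x" for x using Q[of x] by (simp add: w_def)
  have "continuous_on UNIV w"
    unfolding w_def[abs_def]
    by (intro continuous_intros) (metis Q add_pos_nonneg less_irrefl zero_less_one)
  then have wint: "integrable M w"
    using L(2) w0 by (intro integrableI_nonneg) (auto simp: w_def[symmetric] intro: borel_measurable_continuous_locally_finite[OF M])
  define F :: "(('d \<Rightarrow>\<^sub>0 nat) \<times> 'd list) set" where "F = insert (0, []) (range (\<lambda>i. (Poly_Mapping.single i (2 * L), [])))"
  have bound: "cmod (\<psi> x) \<le> (\<Sum>(m, is)\<in>F. schwartz_seminorm m is \<psi>) * w x" if \<psi>: "\<psi> \<in> schwartz" for \<psi> x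
  proof -
    let ?p = "\<lambda>q. schwartz_seminorm (fst q) (snd q) \<psi>" and ?v = "\<lambda>q. cmod (monom_eval (fst q) x * iter_partial (snd q) \<psi> x)"
    have inj: "inj (\<lambda>i::'d. (Poly_Mapping.single i (2 * L), [] :: 'd list))"
    proof
      fix i j :: 'd
      assume "(Poly_Mapping.single i (2 * L), [] :: 'd list) = (Poly_Mapping.single j (2 * L), [])"
      then have "Poly_Mapping.lookup (Poly_Mapping.single i (2 * L)) i = Poly_Mapping.lookup (Poly_Mapping.single j (2 * L)) i" by simp
      then show "i = j" using L(1) by (auto simp: lookup_single when_def split: if_splits)
    qed
    have notin: "(0, []) \<notin> range (\<lambda>i::'d. (Poly_Mapping.single i (2 * L), [] :: 'd list))"
    proof
      assume "(0, []) \<in> range (\<lambda>i::'d. (Poly_Mapping.single i (2 * L), [] :: 'd list))"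
      then obtain i where "(0 :: 'd \<Rightarrow>\<^sub>0 nat) = Poly_Mapping.single i (2 * L)" by auto
      from arg_cong[OF this, of "\<lambda>m. Poly_Mapping.lookup m i"] show False
        using L(1) by simp
    qed
    have "(\<Sum>q\<in>F. ?v q) = ?v (0, []) + (\<Sum>i\<in>UNIV. ?v (Poly_Mapping.single i (2 * L), []))"
      unfolding F_def by (subst sum.insert) (use notin in \<open>auto simp: sum.reindex[OF inj]\<close>)
    also have "\<dots> = cmod (\<psi> x) * (1 + (\<Sum>i\<in>UNIV. (x $ i) ^ (2 * L)))"
      by (simp add: monom_eval_single norm_mult norm_power power_mult sum_distrib_left distrib_left mult.commute
          flip: power_abs)
    finally have "cmod (\<psi> x) * (1 + (\<Sum>i\<in>UNIV. (x $ i) ^ (2 * L))) = (\<Sum>q\<in>F. ?v q)" ..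
    also have "\<dots> \<le> (\<Sum>q\<in>F. ?p q)" by (intro sum_mono schwartz_seminorm_upper[OF \<psi>])
    finally show ?thesis using Q[of x] by (simp add: w_def split_def pos_le_divide_eq add_pos_nonneg)
  qed
  have int: "integrable M (\<lambda>x. cmod (\<psi> x))" if \<psi>: "\<psi> \<in> schwartz" for \<psi>
  proof (rule Bochner_Integration.integrable_bound[OF integrable_mult_right[OF wint]])
    show "AE x in M. norm (cmod (\<psi> x)) \<le> norm ((\<Sum>(m, is)\<in>F. schwartz_seminorm m is \<psi>) * w x)"
      using order_trans[OF bound[OF \<psi>] abs_ge_self] by simp
    show "(\<lambda>x. cmod (\<psi> x)) \<in> borel_measurable M"
      by (intro borel_measurable_continuous_locally_finite[OF M] continuous_on_norm schwartz_continuous \<psi>)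
  qed
  show thesis
  proof (rule that[OF _ _ int])
    show "0 \<le> (\<integral>x. w x \<partial>M)" using w0 by simp
    show "finite F" by (simp add: F_def)
    fix \<psi> :: "real ^ 'd \<Rightarrow> complex" assume \<psi>: "\<psi> \<in> schwartz"
    have "(\<integral>x. cmod (\<psi> x) \<partial>M) \<le> (\<integral>x. (\<Sum>(m, is)\<in>F. schwartz_seminorm m is \<psi>) * w x \<partial>M)"
      by (intro integral_mono int \<psi> integrable_mult_right wint bound)
    then show "(\<integral>x. cmod (\<psi> x) \<partial>M) \<le> (\<integral>x. w x \<partial>M) * (\<Sum>(m, is)\<in>F. schwartz_seminorm m is \<psi>)"
      by (simp add: mult.commute)
  qed
qed

lemma polynomial_growth_imp_slowly_increasing:
  fixes \<mu> :: "(real ^ 'd::finite \<Rightarrow> complex) \<Rightarrow> complex"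
  assumes M: "locally_finite_borel (variation_measure \<mu>)" and G: "polynomial_growth (variation_measure \<mu>)"
  shows "slowly_increasing \<mu>"
proof -
  obtain L where L: "0 < L"
    "(\<integral>\<^sup>+x. ennreal (1 / (1 + (\<Sum>i\<in>UNIV. (x $ i) ^ (2 * L)))) \<partial>variation_measure \<mu>) < \<infinity>"
    using polynomial_growth_imp_slow_integral[OF M G] by blast
  have "cmod (poly_eval (power_sum_poly (2 * L)) x) = (\<Sum>i\<in>UNIV. (x $ i) ^ (2 * L))" for x :: "real ^ 'd"
  proof -
    have "0 \<le> (\<Sum>i\<in>UNIV. (x $ i) ^ (2 * L))" by (intro sum_nonneg) (simp add: power_mult)
    then show ?thesis using L(1) by (subst poly_eval_power_sum_poly) (simp_all only: norm_of_real abs_of_nonneg)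
  qed
  then show ?thesis using L(2) unfolding slowly_increasing_def by (intro exI[of _ "power_sum_poly (2 * L)"]) simp
qed

context
  fixes \<mu> :: "(real ^ 'd::finite \<Rightarrow> complex) \<Rightarrow> complex" and M :: "(real ^ 'd) measure"
  assumes dom: "dominated_functional \<mu> M"
begin

interpretation dominated_functional \<mu> M by (rule dom)

lemma polynomial_growth_imp_strongly_tempered:
  assumes G: "polynomial_growth M"
  shows "strongly_tempered \<mu>"
proof -
  obtain C F where C: "0 \<le> C" and F: "finite F"
    and int: "\<And>\<psi> :: real ^ 'd \<Rightarrow> complex. \<psi> \<in> schwartz \<Longrightarrow> integrable M (\<lambda>x. cmod (\<psi> x))"
    and bound: "\<And>\<psi>. \<psi> \<in> schwartz \<Longrightarrow> (\<integral>x. cmod (\<psi> x) \<partial>M) \<le> C * (\<Sum>(m, is)\<in>F. schwartz_seminorm m is \<psi>)"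
    using polynomial_growth_imp_schwartz_integrable[OF locally_finite G] by metis
  have "tempered_distribution (radon_integral \<mu>)"
  proof (rule tempered_distributionI[OF _ F C])
    show "clinear_on schwartz (radon_integral \<mu>)"
      unfolding clinear_on_def by (intro ballI allI radon_integral_lincomb schwartz_continuous int)
    show "cmod (radon_integral \<mu> \<psi>) \<le> C * (\<Sum>(m, is)\<in>F. schwartz_seminorm m is \<psi>)" if "\<psi> \<in> schwartz" for \<psi>
      by (rule order_trans[OF norm_radon_integral_le[OF schwartz_continuous[OF that] int[OF that]] bound[OF that]])
  qed
  then show ?thesis using int unfolding strongly_tempered_def variation_measure_eq by simp
qed

lemma strongly_tempered_imp_tempered: "strongly_tempered \<mu> \<Longrightarrow> tempered \<mu>"
  using Cc_smooth_subset_Cc radon_integral_Cc unfolding strongly_tempered_def tempered_def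
  by (intro exI[of _ "radon_integral \<mu>"]) auto

end

lemma bump_dilated_Cc_smooth:
  assumes "c \<noteq> 0"
  shows "(\<lambda>x::real ^ 'd::finite. complex_of_real (bump (c *\<^sub>R x))) \<in> Cc_smooth"
proof -
  have b: "(\<lambda>x::real ^ 'd. complex_of_real (bump x)) \<in> Cc_smooth" by (rule bump_Cc_smooth)
  then have s: "smooth (\<lambda>x::real ^ 'd. complex_of_real (bump x))"
    by (simp add: Cc_smooth_def)
  have "bounded {x::real ^ 'd. complex_of_real (bump x) \<noteq> 0}"
    using b by (simp add: Cc_smooth_def fun_support_def)
  then have "bounded ((\<lambda>x. inverse c *\<^sub>R x) ` {x::real ^ 'd. complex_of_real (bump x) \<noteq> 0})"
    by (rule bounded_scaling)
  then have "bounded {x::real ^ 'd. complex_of_real (bump (c *\<^sub>R x)) \<noteq> 0}"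
    by (rule bounded_subset) (use assms in \<open>auto intro!: image_eqI[of _ _ "c *\<^sub>R _"]\<close>)
  then show ?thesis using smooth_dilate[OF s, of c] by (simp add: Cc_smooth_def fun_support_def)
qed

lemma measure_cball_le_integral_bump:
  fixes M :: "(real ^ 'd::finite) measure"
  assumes M: "locally_finite_borel M" and R: "0 < R"
  shows "exp (-1) * measure M (cball 0 R) \<le> (\<integral>x. bump ((1 / R) *\<^sub>R x) \<partial>M)"
proof -
  have int: "integrable M (\<lambda>x. bump ((1 / R) *\<^sub>R x))"
    using Cc_integrable[OF M subsetD[OF Cc_smooth_subset_Cc bump_dilated_Cc_smooth[of "1 / R"]]] R
    by (simp only: complex_of_real_integrable_eq) simp
  have "(\<integral>x. exp (-1) * indicator (cball 0 R) x \<partial>M) \<le> (\<integral>x. bump ((1 / R) *\<^sub>R x) \<partial>M)"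
  proof (rule integral_mono[OF _ int])
    show "integrable M (\<lambda>x. exp (- 1) * indicator (cball 0 R) x :: real)"
      using locally_finite_borelD(1)[OF M] locally_finite_borelD(2)[OF M, of "cball 0 R"] by simp
    show "exp (- 1) * indicator (cball 0 R) x \<le> bump ((1 / R) *\<^sub>R x)" for x :: "real ^ 'd"
      using R bump_nonneg[of "(1 / R) *\<^sub>R x"] bump_ge[of "(1 / R) *\<^sub>R x"] by (auto simp: indicator_def divide_simps)
  qed
  then show ?thesis using locally_finite_borelD(1)[OF M] by simp
qed

text \<open>
  The seminorm of \<open>h(x / R)\<close> for a monomial of degree \<open>n\<close> is at most \<open>R\<^sup>n\<close> times that of \<open>h\<close>, because the
  derivatives only shrink for \<open>R \<ge> 1\<close>.  Hence \<open>T\<close> grows at most polynomially along these dilates, and so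
  do the masses of the balls on which they are bounded below.
\<close>

lemma tempered_imp_polynomial_growth:
  fixes M :: "(real ^ 'd::finite) measure"
  assumes M: "locally_finite_borel M" and T: "tempered_distribution T"
    and rep: "\<And>\<phi>. \<phi> \<in> Cc_smooth \<Longrightarrow> T \<phi> = (\<integral>x. \<phi> x \<partial>M)"
  shows "polynomial_growth M"
proof -
  have lin: "clinear_on schwartz T" using T by (simp add: tempered_distribution_def)
  obtain F e where F: "finite F" "0 < e"
    "\<And>\<psi>. \<psi> \<in> schwartz \<Longrightarrow> (\<And>m is. (m, is) \<in> F \<Longrightarrow> schwartz_seminorm m is \<psi> < e) \<Longrightarrow> cmod (T \<psi>) < 1"
    using tempered_distribution_locally_bounded[OF T] by blast
  let ?h = "\<lambda>x::real ^ 'd. complex_of_real (bump x)"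
  have h: "?h \<in> schwartz" using bump_Cc_smooth Cc_smooth_subset_schwartz by blast
  let ?p = "\<lambda>q. schwartz_seminorm (fst q) (snd q) ?h"
  have p0: "0 \<le> ?p q" for q
    using order_trans[OF norm_ge_zero schwartz_seminorm_upper[OF h]] .
  define N where "N = (\<Sum>q\<in>F. total_degree (fst q))"
  define A where "A = 1 + (\<Sum>q\<in>F. ?p q)"
  have A: "0 < A" unfolding A_def by (intro add_pos_nonneg sum_nonneg p0) auto
  have "measure M (cball 0 R) \<le> (exp 1 * (2 * A / e)) * R ^ N" if R: "1 \<le> R" for R
  proof -
    let ?c = "1 / R" and ?hR = "\<lambda>x::real ^ 'd. complex_of_real (bump ((1 / R) *\<^sub>R x))"
    \<comment> \<open>This factor brings all seminorms in F below e / 2.\<close>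
    define s where "s = e / (2 * A * R ^ N)"
    have s: "0 < s" using F(2) A R by (simp add: s_def)
    have hR: "?hR \<in> Cc_smooth" using R by (intro bump_dilated_Cc_smooth) auto
    then have hRs: "?hR \<in> schwartz" using Cc_smooth_subset_schwartz by blast
    have shR: "(\<lambda>x. complex_of_real s * ?hR x) \<in> schwartz"
      using schwartz_lincomb[OF hRs hRs, of "complex_of_real s" 0] by simp
    have "cmod (T (\<lambda>x. complex_of_real s * ?hR x)) < 1"
    proof (rule F(3)[OF shR])
      fix m "is" assume q: "(m, is) \<in> F"
      have "schwartz_seminorm m is (\<lambda>x. complex_of_real s * ?hR x) \<le> s * (A * R ^ N)"
      proof (rule schwartz_seminorm_least)
        fix x :: "real ^ 'd"
        have "iter_partial is (\<lambda>x. complex_of_real s * ?hR x) x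
            = complex_of_real s * (complex_of_real (?c ^ length is) * iter_partial is ?h (?c *\<^sub>R x))"
          using iter_partial_lincomb[OF schwartz_smooth[OF hRs] schwartz_smooth[OF hRs], of "is" "complex_of_real s" 0]
            iter_partial_dilate[OF schwartz_smooth[OF h], of "is" ?c] by simp
        moreover have "monom_eval m x = complex_of_real (R ^ total_degree m) * monom_eval m (?c *\<^sub>R x)"
          using R monom_eval_scaleR[of m R "?c *\<^sub>R x"] by simp
        ultimately have "cmod (monom_eval m x * iter_partial is (\<lambda>x. complex_of_real s * ?hR x) x)
            = s * (?c ^ length is * R ^ total_degree m * cmod (monom_eval m (?c *\<^sub>R x) * iter_partial is ?h (?c *\<^sub>R x)))"
          using s R by (simp add: norm_mult norm_power norm_divide)
        also have "\<dots> \<le> s * (1 * R ^ N * A)"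
        proof (intro mult_left_mono mult_mono)
          show "?c ^ length is \<le> 1" using R by (intro power_le_one) auto
          show "R ^ total_degree m \<le> R ^ N"
            using R F(1) member_le_sum[OF q, of "\<lambda>q. total_degree (fst q)"]
            by (intro power_increasing) (auto simp: N_def)
          have "cmod (monom_eval m (?c *\<^sub>R x) * iter_partial is ?h (?c *\<^sub>R x)) \<le> ?p (m, is)"
            using schwartz_seminorm_upper[OF h] by simp
          also have "\<dots> \<le> A" unfolding A_def using member_le_sum[OF q, of ?p] F(1) p0 by fastforce
          finally show "cmod (monom_eval m (?c *\<^sub>R x) * iter_partial is ?h (?c *\<^sub>R x)) \<le> A" .
        qed (use s R in auto)
        finally show "cmod (monom_eval m x * iter_partial is (\<lambda>x. complex_of_real s * ?hR x) x) \<le> s * (A * R ^ N)"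
          by (simp add: mult_ac)
      qed
      also have "\<dots> = e / 2" using A R by (simp add: s_def field_simps)
      also have "\<dots> < e" using F(2) by simp
      finally show "schwartz_seminorm m is (\<lambda>x. complex_of_real s * ?hR x) < e" .
    qed
    moreover have "T (\<lambda>x. complex_of_real s * ?hR x) = complex_of_real (s * (\<integral>x. bump ((1 / R) *\<^sub>R x) \<partial>M))"
      unfolding clinear_on_scale[OF lin hRs] rep[OF hR] by simp
    ultimately have "\<bar>s * (\<integral>x. bump ((1 / R) *\<^sub>R x) \<partial>M)\<bar> < 1" by (simp only: norm_of_real)
    then have "s * (\<integral>x. bump ((1 / R) *\<^sub>R x) \<partial>M) \<le> 1" by simp
    moreover have "s * (exp (-1) * measure M (cball 0 R)) \<le> s * (\<integral>x. bump ((1 / R) *\<^sub>R x) \<partial>M)"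
      using s R by (intro mult_left_mono measure_cball_le_integral_bump[OF M]) auto
    ultimately have "s * (exp (-1) * measure M (cball 0 R)) \<le> 1" by simp
    then show ?thesis using A R F(2) by (simp add: s_def exp_minus field_simps)
  qed
  then show ?thesis unfolding polynomial_growth_def by blast
qed

text \<open>
  Otherwise some balls have mass \<open>M (cball 0 R\<^sub>j) > (2 R\<^sub>j)\<^sup>j\<close>.  The weights \<open>a\<^sub>j = (2 R\<^sub>j)\<^bsup>-j\<^esup>\<close> are small
  enough for \<open>\<Sum>\<^sub>j a\<^sub>j h(x / R\<^sub>j)\<close> to be a Schwartz function, since \<open>a\<^sub>j R\<^sub>j\<^sup>N \<le> 2\<^bsup>-j\<^esup>\<close> for \<open>j \<ge> N\<close>, and large
  enough for every summand to have integral at least \<open>exp(-1)\<close>, the minimum of \<open>h\<close> on the unit ball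
  being at least \<open>exp(-1)\<close>.
\<close>

lemma schwartz_integrable_imp_polynomial_growth:
  fixes M :: "(real ^ 'd::finite) measure"
  assumes M: "locally_finite_borel M"
    and int: "\<And>\<psi> :: real ^ 'd \<Rightarrow> complex. \<psi> \<in> schwartz \<Longrightarrow> integrable M (\<lambda>x. cmod (\<psi> x))"
  shows "polynomial_growth M"
proof (rule ccontr)
  assume "\<not> polynomial_growth M"
  then have "\<exists>R\<ge>1. 2 ^ j * R ^ j < measure M (cball 0 R)" for j
    unfolding polynomial_growth_def not_ex not_all not_le by (metis not_le_imp_less)
  then obtain R where R: "\<And>j. 1 \<le> R j" "\<And>j. 2 ^ j * R j ^ j < measure M (cball 0 (R j))" by metis
  define a where "a j = 1 / (2 ^ j * R j ^ j)" for j
  define c where "c j = 1 / R j" for j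
  have pos: "0 < R j" for j using R(1)[of j] by linarith
  have a: "0 < a j" for j using pos by (simp add: a_def)
  let ?b = "\<lambda>j x. a j * bump (c j *\<^sub>R x)"
  have summ: "summable (\<lambda>j. \<bar>a j\<bar> / c j ^ N)" for N
  proof (rule summable_comparison_test'[of "\<lambda>j. (1 / 2) ^ j" N])
    show "summable (\<lambda>j. (1 / 2 :: real) ^ j)" by (simp add: summable_geometric)
    fix j assume "N \<le> j"
    then have "R j ^ N \<le> R j ^ j" using R by (intro power_increasing) auto
    then have "R j ^ N / R j ^ j \<le> 1" using pos by (simp add: divide_le_eq_1)
    then have "(1 / 2) ^ j * (R j ^ N / R j ^ j) \<le> (1 / 2) ^ j * 1" by (intro mult_left_mono) auto
    then show "norm (\<bar>a j\<bar> / c j ^ N) \<le> (1 / 2) ^ j"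
      using pos[of j] by (simp add: a_def c_def power_divide abs_mult power_abs mult.commute)
  qed
  let ?h = "\<lambda>x::real ^ 'd. complex_of_real (bump x)"
  have h: "?h \<in> schwartz" using bump_Cc_smooth Cc_smooth_subset_schwartz by blast
  define F where "F x = suminf (\<lambda>j. complex_of_real (a j) * ?h (c j *\<^sub>R x))" for x
  have "F \<in> schwartz"
    unfolding F_def[abs_def]
    by (rule dilation_series_schwartz[OF h _ _ summ]) (use R pos in \<open>auto simp: c_def\<close>)
  then have F_int: "integrable M (\<lambda>x. cmod (F x))" by (rule int)
  have lower: "(\<Sum>j<n. ?b j x) \<le> cmod (F x)" for n x
  proof -
    have bnn: "0 \<le> ?b j x" for j using a[of j] bump_nonneg[of "c j *\<^sub>R x"] by simp
    have "summable (\<lambda>j. \<bar>a j\<bar> * schwartz_seminorm 0 [] ?h)"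
      using summable_mult2[OF summ[of 0]] by simp
    then have s: "summable (\<lambda>j. ?b j x)"
    proof (rule summable_comparison_test')
      show "norm (?b j x) \<le> \<bar>a j\<bar> * schwartz_seminorm 0 [] ?h" for j
        using schwartz_seminorm_upper[OF h, of 0 "c j *\<^sub>R x" "[]"] by (simp add: abs_mult mult_left_mono)
    qed
    have "(\<Sum>j<n. ?b j x) \<le> suminf (\<lambda>j. ?b j x)" by (rule sum_le_suminf[OF s finite_lessThan bnn])
    also have "\<dots> \<le> cmod (complex_of_real (suminf (\<lambda>j. ?b j x)))" by simp
    also have "complex_of_real (suminf (\<lambda>j. ?b j x)) = F x"
      unfolding F_def using suminf_of_real[OF s, where 'a = complex] by simp
    finally show ?thesis .
  qed
  have b_int: "integrable M (?b j)" for j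
    using Cc_integrable[OF M subsetD[OF Cc_smooth_subset_Cc bump_dilated_Cc_smooth[of "c j"]]] pos[of j]
    by (intro integrable_mult_right) (simp add: c_def complex_of_real_integrable_eq)
  have "real n * exp (-1) \<le> (\<integral>x. cmod (F x) \<partial>M)" for n
  proof -
    have "exp (-1) \<le> (\<integral>x. ?b j x \<partial>M)" for j
    proof -
      have "exp (-1) * 1 \<le> exp (-1) * (a j * measure M (cball 0 (R j)))"
        using R(2)[of j] pos[of j] by (intro mult_left_mono) (auto simp: a_def field_simps)
      also have "\<dots> = a j * (exp (-1) * measure M (cball 0 (R j)))" by simp
      also have "\<dots> \<le> a j * (\<integral>x. bump (c j *\<^sub>R x) \<partial>M)"
        unfolding c_def using a[of j] by (intro mult_left_mono measure_cball_le_integral_bump[OF M pos]) auto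
      finally show ?thesis by simp
    qed
    then have "(\<Sum>j<n. exp (-1)) \<le> (\<Sum>j<n. \<integral>x. ?b j x \<partial>M)" by (intro sum_mono)
    also have "\<dots> = (\<integral>x. (\<Sum>j<n. ?b j x) \<partial>M)"
      by (rule Bochner_Integration.integral_sum[symmetric]) (rule b_int)
    also have "\<dots> \<le> (\<integral>x. cmod (F x) \<partial>M)"
      by (intro integral_mono Bochner_Integration.integrable_sum b_int F_int lower)
    finally show ?thesis by simp
  qed
  moreover obtain n where "(\<integral>x. cmod (F x) \<partial>M) / exp (-1) < real n"
    using reals_Archimedean2 by blast
  then have "(\<integral>x. cmod (F x) \<partial>M) < real n * exp (-1)" by (simp add: pos_divide_less_eq)
  ultimately show False by (meson not_le)
qed

section \<open>A tempered measure that is not strongly tempered\<close>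

lemma radon_measureI:
  fixes \<mu> :: "('a::euclidean_space \<Rightarrow> complex) \<Rightarrow> complex"
  assumes lin: "clinear_on Cc \<mu>"
    and bound: "\<And>R. \<exists>C\<ge>0. \<forall>f\<in>Cc. \<forall>b. (\<forall>x. f x \<noteq> 0 \<longrightarrow> norm x \<le> R) \<longrightarrow> (\<forall>x. cmod (f x) \<le> b) \<longrightarrow> cmod (\<mu> f) \<le> C * b"
  shows "radon_measure \<mu>"
proof -
  have nhd: "Cc_zero_nhd {g \<in> Cc. cmod (\<mu> g) < e}" if e: "0 < e" for e
    unfolding Cc_zero_nhd_def
  proof (intro conjI allI impI)
    show "absolutely_convex {g \<in> Cc. cmod (\<mu> g) < e}"
      unfolding absolutely_convex_def
    proof (intro ballI allI impI)
      fix f g a b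
      assume fg: "f \<in> {g \<in> Cc. cmod (\<mu> g) < e}" "g \<in> {g \<in> Cc. cmod (\<mu> g) < e}" and ab: "cmod a + cmod b \<le> 1"
      have "cmod (a * \<mu> f + b * \<mu> g) < e"
      proof -
        have "cmod (a * \<mu> f + b * \<mu> g) \<le> cmod a * cmod (\<mu> f) + cmod b * cmod (\<mu> g)"
          by (rule norm_triangle_le) (simp add: norm_mult)
        also have "\<dots> \<le> cmod a * max (cmod (\<mu> f)) (cmod (\<mu> g)) + cmod b * max (cmod (\<mu> f)) (cmod (\<mu> g))"
          by (intro add_mono mult_left_mono) auto
        also have "\<dots> = (cmod a + cmod b) * max (cmod (\<mu> f)) (cmod (\<mu> g))" by (simp add: distrib_right)
        also have "\<dots> \<le> 1 * max (cmod (\<mu> f)) (cmod (\<mu> g))"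
          using ab by (intro mult_right_mono) (auto simp: le_max_iff_disj)
        also have "\<dots> < e" using fg by simp
        finally show ?thesis .
      qed
      then show "(\<lambda>x. a * f x + b * g x) \<in> {g \<in> Cc. cmod (\<mu> g) < e}"
        using fg by (simp add: clinear_onD[OF lin] Cc_lincomb)
    qed
    fix K :: "'a set" assume "compact K"
    then obtain R where R: "\<And>x. x \<in> K \<Longrightarrow> norm x \<le> R"
      using compact_imp_bounded[OF \<open>compact K\<close>] unfolding bounded_iff by blast
    obtain C where C: "0 \<le> C" "\<And>f b. f \<in> Cc \<Longrightarrow> (\<And>x. f x \<noteq> 0 \<Longrightarrow> norm x \<le> R) \<Longrightarrow> (\<And>x. cmod (f x) \<le> b) \<Longrightarrow> cmod (\<mu> f) \<le> C * b"
      using bound[of R] by blast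
    show "\<exists>d>0. \<forall>f\<in>Cc. fun_support f \<subseteq> K \<and> (\<forall>x. cmod (f x) \<le> d) \<longrightarrow> f \<in> {g \<in> Cc. cmod (\<mu> g) < e}"
    proof (intro exI[of _ "e / (C + 1)"] conjI ballI impI)
      show "0 < e / (C + 1)" using e C by simp
      fix f assume f: "f \<in> Cc" "fun_support f \<subseteq> K \<and> (\<forall>x. cmod (f x) \<le> e / (C + 1))"
      have "cmod (\<mu> f) \<le> C * (e / (C + 1))"
      proof (rule C(2)[OF f(1)])
        fix x assume "f x \<noteq> 0"
        then have "x \<in> fun_support f" unfolding fun_support_def using closure_subset by fastforce
        then show "norm x \<le> R" using f R by blast
      qed (use f in blast)
      also have "\<dots> < e" using e C(1) by (simp add: field_simps)
      finally show "f \<in> {g \<in> Cc. cmod (\<mu> g) < e}" using f(1) by simp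
    qed
  qed auto
  have "continuous_map Cc_topology euclidean \<mu>"
    unfolding continuous_map_def topspace_Cc_topology openin_Cc_topology
  proof (intro conjI allI impI)
    fix U :: "complex set" assume "openin euclidean U"
    then have U: "open U" by simp
    show "Cc_open {f \<in> Cc. \<mu> f \<in> U}"
      unfolding Cc_open_def
    proof (intro conjI ballI)
      fix f assume f: "f \<in> {f \<in> Cc. \<mu> f \<in> U}"
      then obtain e where e: "0 < e" "ball (\<mu> f) e \<subseteq> U" using U open_contains_ball by blast
      have "(\<lambda>x. f x + g x) \<in> {f \<in> Cc. \<mu> f \<in> U}" if g: "g \<in> {g \<in> Cc. cmod (\<mu> g) < e}" for g
      proof -
        have "\<mu> (\<lambda>x. f x + g x) = \<mu> f + \<mu> g" using f g by (intro clinear_on_add[OF lin]) auto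
        then have "\<mu> (\<lambda>x. f x + g x) \<in> ball (\<mu> f) e" using g by (simp add: dist_norm)
        moreover have "(\<lambda>x. f x + g x) \<in> Cc" using Cc_lincomb[of f g 1 1] f g by simp
        ultimately show ?thesis using e by blast
      qed
      then show "\<exists>V. Cc_zero_nhd V \<and> (\<forall>g\<in>V. (\<lambda>x. f x + g x) \<in> {f \<in> Cc. \<mu> f \<in> U})"
        using nhd[OF e(1)] by blast
    qed auto
  qed auto
  with lin show ?thesis by (simp add: radon_measure_def)
qed

definition dipole_axis :: "'d::finite" where
  "dipole_axis = (SOME k. True)"

text \<open>
  The index is shifted by one: the \<open>n\<close>-th dipole sits at the points \<open>n + 1\<close> and \<open>n + 1 + 2\<^bsup>-(n+1)\<^esup>\<close> of the
  axis, so that the points of different dipoles keep a distance of at least \<open>1/2\<close>.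
\<close>

definition dipole_term :: "(real ^ 'd::finite \<Rightarrow> complex) \<Rightarrow> nat \<Rightarrow> complex" where
  "dipole_term f n = 2 ^ Suc n *
     (f (axis dipole_axis (real (Suc n))) - f (axis dipole_axis (real (Suc n) + 1 / 2 ^ Suc n)))"

definition dipole_series :: "(real ^ 'd::finite \<Rightarrow> complex) \<Rightarrow> complex" where
  "dipole_series f = suminf (dipole_term f)"

lemma dipole_term_lincomb:
  "dipole_term (\<lambda>x. a * f x + b * g x) n = a * dipole_term f n + b * dipole_term g n"
  by (simp add: dipole_term_def algebra_simps)

lemma clinear_on_dipole_series:
  assumes "\<And>f. f \<in> S \<Longrightarrow> summable (dipole_term f)"
  shows "clinear_on S dipole_series"
  unfolding clinear_on_def dipole_series_def
proof (intro ballI allI)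
  fix f g :: "real ^ 'a \<Rightarrow> complex" and a b
  assume "f \<in> S" "g \<in> S"
  then have s: "summable (dipole_term f)" "summable (dipole_term g)" using assms by auto
  have "dipole_term (\<lambda>x. a * f x + b * g x) = (\<lambda>n. a * dipole_term f n + b * dipole_term g n)"
    by (rule ext) (rule dipole_term_lincomb)
  then show "suminf (dipole_term (\<lambda>x. a * f x + b * g x)) = a * suminf (dipole_term f) + b * suminf (dipole_term g)"
    using s by (simp add: suminf_add[symmetric] suminf_mult summable_mult)
qed

lemma axis_eq_scaleR: "axis k t = t *\<^sub>R axis k (1::real)"
  by (simp add: vec_eq_iff axis_def)

lemma norm_axis_real [simp]: "norm (axis k t :: real ^ 'd::finite) = \<bar>t\<bar>"
  by (subst axis_eq_scaleR) (simp add: norm_axis_1)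

lemma dipole_term_eq_0:
  assumes "\<And>x. f x \<noteq> 0 \<Longrightarrow> norm x \<le> R" "R < real (Suc n)"
  shows "dipole_term f n = 0"
proof -
  have z: "f (axis k t) = 0" if "real (Suc n) \<le> t" for k t
    using assms(1)[of "axis k t"] assms(2) that by (auto simp del: of_nat_Suc)
  show ?thesis unfolding dipole_term_def by (simp add: z del: of_nat_Suc power_Suc)
qed

lemma norm_dipole_term_le:
  assumes "\<And>x. cmod (f x) \<le> b"
  shows "cmod (dipole_term f n) \<le> 2 ^ Suc n * (2 * b)"
proof -
  let ?y = "axis dipole_axis (real (Suc n))" and ?z = "axis dipole_axis (real (Suc n) + 1 / 2 ^ Suc n)"
  have "cmod (f ?y - f ?z) \<le> b + b"
    by (rule order_trans[OF norm_triangle_ineq4 add_mono]) (rule assms)+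
  then show ?thesis by (simp add: dipole_term_def norm_mult norm_power mult_left_mono del: power_Suc of_nat_Suc)
qed

lemma dipole_series_bounded_support:
  assumes "\<And>x. f x \<noteq> 0 \<Longrightarrow> norm x \<le> R" "R \<le> real N"
  shows "summable (dipole_term f)" "dipole_series f = (\<Sum>n<N. dipole_term f n)"
proof -
  have z: "dipole_term f n = 0" if "n \<notin> {..<N}" for n
    by (rule dipole_term_eq_0[OF assms(1)]) (use that assms(2) in auto)
  show "summable (dipole_term f)" by (rule summable_finite[OF finite_lessThan z])
  show "dipole_series f = (\<Sum>n<N. dipole_term f n)"
    unfolding dipole_series_def by (rule suminf_finite[OF finite_lessThan z])
qed

lemma radon_measure_dipole_series: "radon_measure (dipole_series :: (real ^ 'd::finite \<Rightarrow> complex) \<Rightarrow> complex)"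
proof (rule radon_measureI)
  show "clinear_on Cc (dipole_series :: (real ^ 'd \<Rightarrow> complex) \<Rightarrow> complex)"
  proof (rule clinear_on_dipole_series)
    fix f :: "real ^ 'd \<Rightarrow> complex" assume "f \<in> Cc"
    then obtain R where R: "\<And>x. f x \<noteq> 0 \<Longrightarrow> norm x \<le> R" using CcD(2) by (auto simp: bounded_iff)
    obtain N where "R \<le> real N" using real_arch_simple by blast
    with R show "summable (dipole_term f)" by (rule dipole_series_bounded_support)
  qed
  fix R :: real
  obtain N where N: "R \<le> real N" using real_arch_simple by blast
  have "cmod (dipole_series f) \<le> (\<Sum>n<N. 2 ^ Suc n * 2) * b"
    if f: "\<forall>x. f x \<noteq> 0 \<longrightarrow> norm x \<le> R" "\<forall>x. cmod (f x) \<le> b" for f :: "real ^ 'd \<Rightarrow> complex" and b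
  proof -
    have "dipole_series f = (\<Sum>n<N. dipole_term f n)"
      using f(1) N by (intro dipole_series_bounded_support(2)) auto
    also have "cmod \<dots> \<le> (\<Sum>n<N. 2 ^ Suc n * (2 * b))"
      using f(2) by (intro sum_norm_le norm_dipole_term_le) auto
    also have "\<dots> = (\<Sum>n<N. 2 ^ Suc n * 2) * b"
      by (simp add: sum_distrib_right mult.assoc)
    finally show ?thesis .
  qed
  then show "\<exists>C\<ge>0. \<forall>f\<in>Cc. \<forall>b. (\<forall>x::real ^ 'd. f x \<noteq> 0 \<longrightarrow> norm x \<le> R) \<longrightarrow>
      (\<forall>x. cmod (f x) \<le> b) \<longrightarrow> cmod (dipole_series f) \<le> C * b"
    by (intro exI[of _ "\<Sum>n<N. 2 ^ Suc n * 2"] conjI sum_nonneg) auto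
qed

text \<open>
  The weight \<open>2\<^bsup>n+1\<^esup>\<close> cancels the distance of the two points in the mean value theorem; what remains is the
  derivative along the axis, which a seminorm with the monomial \<open>x\<^sub>k\<^sup>2\<close> bounds by a multiple of
  \<open>(n + 1)\<^bsup>-2\<^esup>\<close>.
\<close>

lemma norm_dipole_term_schwartz:
  fixes \<psi> :: "real ^ 'd::finite \<Rightarrow> complex"
  assumes \<psi>: "\<psi> \<in> schwartz"
  shows "cmod (dipole_term \<psi> n) \<le>
    schwartz_seminorm (Poly_Mapping.single dipole_axis 2) [dipole_axis] \<psi> * inverse (real (Suc n) ^ 2)"
proof -
  let ?k = "dipole_axis :: 'd"
  let ?p = "schwartz_seminorm (Poly_Mapping.single ?k 2) [?k] \<psi>"
  let ?a = "real (Suc n)" and ?b = "real (Suc n) + 1 / 2 ^ Suc n"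
  obtain D where "\<And>x. (iter_partial [] \<psi> has_derivative D x) (at x)"
    using smooth_has_derivative[OF schwartz_smooth[OF \<psi>]] by metis
  then have D: "(\<psi> has_derivative D x) (at x)" for x by simp
  have a: "0 < ?a" by simp
  have "cmod (\<psi> (axis ?k ?a) - \<psi> (axis ?k ?b)) \<le> ?p * inverse (?a ^ 2) * norm (?a - ?b)"
  proof (rule differentiable_bound[where S = "{?a..?b}" and f = "\<lambda>t. \<psi> (axis ?k t)" and f' = "\<lambda>t h. D (axis ?k t) (axis ?k h)"])
    fix t assume t: "t \<in> {?a..?b}"
    have lin: "bounded_linear (\<lambda>t::real. axis ?k t)"
    proof -
      have "(\<lambda>t::real. axis ?k t) = (\<lambda>t. t *\<^sub>R axis ?k 1)"
        by (auto simp: fun_eq_iff vec_eq_iff axis_def)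
      then show ?thesis using bounded_linear_scaleR_left by metis
    qed
    have "((\<lambda>t. \<psi> (axis ?k t)) has_derivative (\<lambda>h. D (axis ?k t) (axis ?k h))) (at t)"
      by (rule has_derivative_compose[OF bounded_linear.has_derivative[OF lin has_derivative_ident] D])
    then show "((\<lambda>t. \<psi> (axis ?k t)) has_derivative (\<lambda>h. D (axis ?k t) (axis ?k h))) (at t within {?a..?b})"
      by (rule has_derivative_at_withinI)
    have "cmod (partial ?k \<psi> (axis ?k t)) * t ^ 2 \<le> ?p"
      using schwartz_seminorm_upper[OF \<psi>, of "Poly_Mapping.single ?k 2" "axis ?k t" "[?k]"]
      by (simp add: monom_eval_single norm_mult norm_power mult.commute)
    moreover have "cmod (partial ?k \<psi> (axis ?k t)) * ?a ^ 2 \<le> cmod (partial ?k \<psi> (axis ?k t)) * t ^ 2"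
      using t a by (intro mult_left_mono power_mono) auto
    ultimately have *: "cmod (partial ?k \<psi> (axis ?k t)) \<le> ?p * inverse (?a ^ 2)"
      using a by (simp add: divide_inverse[symmetric] pos_le_divide_eq del: of_nat_Suc)
    show "onorm (\<lambda>h. D (axis ?k t) (axis ?k h)) \<le> ?p * inverse (?a ^ 2)"
    proof (rule onorm_le)
      fix h :: real
      have "axis ?k h = h *\<^sub>R axis ?k (1::real)" by (simp add: vec_eq_iff axis_def)
      then have "D (axis ?k t) (axis ?k h) = h *\<^sub>R partial ?k \<psi> (axis ?k t)"
        by (simp only: linear_scale[OF has_derivative_linear[OF D]] partial_eq[OF D])
      then show "cmod (D (axis ?k t) (axis ?k h)) \<le> ?p * inverse (?a ^ 2) * norm h"
        using mult_left_mono[OF *, of "\<bar>h\<bar>"] by (simp add: mult.commute)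
    qed
  qed (simp_all add: convex_closed_interval)
  also have "norm (?a - ?b) = 1 / 2 ^ Suc n" by simp
  finally have "2 ^ Suc n * cmod (\<psi> (axis ?k ?a) - \<psi> (axis ?k ?b)) \<le> ?p * inverse (?a ^ 2)"
    by (simp add: pos_le_divide_eq mult.commute del: of_nat_Suc power_Suc)
  then show ?thesis by (simp add: dipole_term_def norm_mult norm_power del: power_Suc of_nat_Suc)
qed

lemma tempered_distribution_dipole_series:
  "tempered_distribution (dipole_series :: (real ^ 'd::finite \<Rightarrow> complex) \<Rightarrow> complex)"
proof -
  let ?k = "dipole_axis :: 'd"
  let ?p = "schwartz_seminorm (Poly_Mapping.single ?k 2) [?k]"
  note sq = summable_inverse_squares
  have summ: "summable (dipole_term \<psi>)" if "\<psi> \<in> schwartz" for \<psi> :: "real ^ 'd \<Rightarrow> complex"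
    by (rule summable_comparison_test'[OF summable_mult[OF sq] norm_dipole_term_schwartz[OF that]])
  show ?thesis
  proof (rule tempered_distributionI[where F = "{(Poly_Mapping.single ?k 2, [?k])}"])
    show "clinear_on schwartz (dipole_series :: (real ^ 'd \<Rightarrow> complex) \<Rightarrow> complex)"
      by (rule clinear_on_dipole_series[OF summ])
    show "0 \<le> suminf (\<lambda>n. inverse (real (Suc n) ^ 2))" by (intro suminf_nonneg sq) auto
    fix \<psi> :: "real ^ 'd \<Rightarrow> complex" assume \<psi>: "\<psi> \<in> schwartz"
    have "cmod (dipole_series \<psi>) \<le> suminf (\<lambda>n. ?p \<psi> * inverse (real (Suc n) ^ 2))"
      unfolding dipole_series_def
      by (rule norm_suminf_le[OF norm_dipole_term_schwartz[OF \<psi>] summable_mult[OF sq]])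
    also have "\<dots> = ?p \<psi> * suminf (\<lambda>n. inverse (real (Suc n) ^ 2))" by (rule suminf_mult[OF sq])
    finally show "cmod (dipole_series \<psi>) \<le> suminf (\<lambda>n. inverse (real (Suc n) ^ 2)) *
        (\<Sum>(m, is)\<in>{(Poly_Mapping.single ?k 2, [?k])}. schwartz_seminorm m is \<psi>)"
      by (simp add: mult.commute)
  qed simp
qed

text \<open>
  A tent function of height \<open>1\<close> and radius \<open>2\<^bsup>-(n+1)\<^esup>\<close> around the positive pole of the \<open>n\<close>-th dipole vanishes
  at all other poles.  It separates the positive from the negative mass, so the cancellation that makes
  the series tempered is lost in the variation.
\<close>

lemma dipole_series_variation_lower_bound:
  fixes M :: "(real ^ 'd::finite) measure"
  assumes "dominated_functional dipole_series M"
  shows "2 ^ Suc n \<le> measure M (cball 0 (real n + 2))"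
proof -
  interpret dominated_functional dipole_series M by fact
  let ?y = "axis dipole_axis (real (Suc n)) :: real ^ 'd"
  define g where "g x = max 0 (1 - 2 ^ Suc n * norm (x - ?y))" for x
  have supp: "norm x \<le> real n + 2" if "g x \<noteq> 0" for x
  proof -
    have "2 ^ Suc n * norm (x - ?y) \<le> 1" using that by (auto simp: g_def max_def split: if_splits)
    moreover have "1 * norm (x - ?y) \<le> 2 ^ Suc n * norm (x - ?y)" by (intro mult_right_mono one_le_power) auto
    ultimately have "norm (x - ?y) \<le> 1" by simp
    then show ?thesis using norm_triangle_sub[of x ?y] by simp
  qed
  have g_in: "g \<in> Cc_nonneg"
  proof -
    have "bounded {x. g x \<noteq> 0}" unfolding bounded_iff using supp by blast
    then show ?thesis by (auto simp: Cc_nonneg_def g_def intro!: continuous_intros)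
  qed
  let ?f = "\<lambda>x. complex_of_real (g x)"
  have f_in: "?f \<in> Cc" by (rule Cc_of_Cc_nonneg[OF g_in])
  have far: "g (axis dipole_axis t) = 0" if "1 \<le> 2 ^ Suc n * \<bar>t - real (Suc n)\<bar>" for t
  proof -
    have "axis dipole_axis t - ?y = axis dipole_axis (t - real (Suc n))"
      by (simp add: vec_eq_iff axis_def)
    then show ?thesis using that by (simp add: g_def del: power_Suc of_nat_Suc)
  qed
  have half: "1 \<le> 2 ^ Suc n * r" if "1 / 2 \<le> r" for r :: real
  proof -
    have "(1::real) \<le> 2 ^ n" by simp
    also have "\<dots> = 2 ^ Suc n * (1 / 2)" by simp
    also have "\<dots> \<le> 2 ^ Suc n * r" using that by (intro mult_left_mono) auto
    finally show ?thesis .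
  qed
  have other: "dipole_term ?f m = 0" if mn: "m \<noteq> n" for m
  proof -
    define u :: real where "u = 1 / 2 ^ Suc m"
    have u: "0 < u" "u \<le> 1 / 2" by (simp_all add: u_def divide_simps)
    have "real m + 1 \<le> real n \<or> real n + 1 \<le> real m" using mn by (cases "m < n") auto
    then have d: "1 / 2 \<le> \<bar>real (Suc m) - real (Suc n)\<bar>"
        "1 / 2 \<le> \<bar>real (Suc m) + u - real (Suc n)\<bar>"
      unfolding of_nat_Suc using u by linarith+
    have "g (axis dipole_axis (real (Suc m))) = 0" "g (axis dipole_axis (real (Suc m) + u)) = 0"
      by (rule far, rule half, rule d)+
    then show ?thesis unfolding dipole_term_def u_def by (simp only: diff_self of_real_0 mult_zero_right)
  qed
  have "dipole_term ?f n = 2 ^ Suc n"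
  proof -
    have "g ?y = 1" by (simp add: g_def)
    moreover have "g (axis dipole_axis (real (Suc n) + 1 / 2 ^ Suc n)) = 0"
      by (rule far) (simp del: power_Suc)
    ultimately show ?thesis by (simp add: dipole_term_def del: power_Suc of_nat_Suc)
  qed
  moreover have "dipole_series ?f = (\<Sum>m\<in>{n}. dipole_term ?f m)"
    unfolding dipole_series_def by (rule suminf_finite) (use other in auto)
  ultimately have "2 ^ Suc n = cmod (dipole_series ?f)" by (simp add: norm_power norm_mult)
  also have "\<dots> \<le> (\<integral>x. g x \<partial>M)" using dominated[OF f_in] Cc_nonnegD(2)[OF g_in] by simp
  also have "\<dots> \<le> (\<integral>x. indicator (cball 0 (real n + 2)) x \<partial>M)"
  proof (rule integral_mono[OF locally_finite_borelD(3)[OF locally_finite g_in]])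
    show "integrable M (indicator (cball 0 (real n + 2)) :: _ \<Rightarrow> real)"
      using locally_finite_borelD(1)[OF locally_finite] locally_finite_borelD(2)[OF locally_finite, of "cball 0 (real n + 2)"]
      by simp
    show "g x \<le> indicator (cball 0 (real n + 2)) x" for x
      using supp[of x] by (cases "g x = 0") (auto simp: g_def)
  qed
  also have "\<dots> = measure M (cball 0 (real n + 2))"
    using locally_finite_borelD(1)[OF locally_finite] by simp
  finally show ?thesis .
qed

lemma not_polynomial_growth_dipole_series:
  assumes dom: "dominated_functional dipole_series M"
  shows "\<not> polynomial_growth M"
proof
  assume "polynomial_growth M"
  then obtain C N where C: "\<And>R. 1 \<le> R \<Longrightarrow> measure M (cball 0 R) \<le> C * R ^ N"
    unfolding polynomial_growth_def by blast
  let ?x = "\<lambda>n. ln 2 * (2 + real n)"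
  have "filterlim ?x at_top sequentially"
    by (intro filterlim_tendsto_pos_mult_at_top[OF tendsto_const]
          filterlim_tendsto_add_at_top[OF tendsto_const] filterlim_real_sequentially) auto
  then have "(\<lambda>n. ?x n ^ N / exp (?x n)) \<longlonglongrightarrow> 0"
    by (rule filterlim_compose[OF tendsto_power_div_exp_0])
  from tendsto_mult_right_zero[OF this, of "2 * C / ln 2 ^ N"]
  have "(\<lambda>n. 2 * C / ln 2 ^ N * (?x n ^ N / exp (?x n))) \<longlonglongrightarrow> 0" .
  then have "\<forall>\<^sub>F n in sequentially. 2 * C / ln 2 ^ N * (?x n ^ N / exp (?x n)) < 1"
    by (rule order_tendstoD) simp
  then obtain n where n: "2 * C / ln 2 ^ N * (?x n ^ N / exp (?x n)) < 1"
    unfolding eventually_sequentially by blast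
  have e: "exp (?x n) = 2 * 2 ^ Suc n"
    using exp_of_nat_mult[of "n + 2" "ln (2::real)"] by (simp add: mult.commute add.commute)
  have "2 * C / ln 2 ^ N * (?x n ^ N / exp (?x n)) = C * (real n + 2) ^ N / 2 ^ Suc n"
    unfolding e by (simp add: power_mult_distrib add.commute)
  with n have "C * (real n + 2) ^ N / 2 ^ Suc n < 1" by (simp only:)
  then have "C * (real n + 2) ^ N < 2 ^ Suc n" by (simp add: pos_divide_less_eq del: power_Suc)
  also have "\<dots> \<le> measure M (cball 0 (real n + 2))" by (rule dipole_series_variation_lower_bound[OF dom])
  also have "\<dots> \<le> C * (real n + 2) ^ N" by (rule C) simp
  finally show False by simp
qed

theorem theorem2p7:
  shows "(\<forall>\<mu> :: (real ^ 'd::finite \<Rightarrow> complex) \<Rightarrow> complex. radon_measure \<mu> \<longrightarrow>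
            (slowly_increasing \<mu> \<longleftrightarrow> strongly_tempered (total_variation \<mu>)) \<and>
            (strongly_tempered (total_variation \<mu>) \<longleftrightarrow> tempered (total_variation \<mu>)) \<and>
            (tempered (total_variation \<mu>) \<longleftrightarrow>
               (\<forall>\<psi>\<in>schwartz. integrable (variation_measure \<mu>) (\<lambda>x. cmod (\<psi> x)))) \<and>
            ((\<forall>\<psi>\<in>schwartz. integrable (variation_measure \<mu>) (\<lambda>x. cmod (\<psi> x))) \<longleftrightarrow>
               strongly_tempered \<mu>) \<and>
            (strongly_tempered \<mu> \<longrightarrow> tempered \<mu>)) \<and>
         (\<exists>\<mu> :: (real ^ 'd \<Rightarrow> complex) \<Rightarrow> complex.
            radon_measure \<mu> \<and> tempered \<mu> \<and> \<not> strongly_tempered \<mu>)"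
proof (intro conjI allI impI)
  fix \<mu> :: "(real ^ 'd \<Rightarrow> complex) \<Rightarrow> complex" assume \<mu>: "radon_measure \<mu>"
  let ?M = "variation_measure \<mu>"
  let ?int = "\<forall>\<psi>\<in>schwartz. integrable ?M (\<lambda>x. cmod (\<psi> x))"
  note M = radon_variation_measure(1)[OF \<mu>] and rep = radon_variation_measure(2)[OF \<mu>]
    and dom = radon_variation_measure(3)[OF \<mu>] and dom_tv = radon_variation_measure(4)[OF \<mu>]
  have int_imp: "polynomial_growth ?M" if ?int
    using that by (intro schwartz_integrable_imp_polynomial_growth[OF M]) auto
  have 1: "slowly_increasing \<mu> \<longleftrightarrow> polynomial_growth ?M"
    using slow_integral_imp_polynomial_growth[OF M] polynomial_growth_imp_slowly_increasing[OF M]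
    unfolding slowly_increasing_def by blast
  have 5: "strongly_tempered \<mu> \<longleftrightarrow> polynomial_growth ?M"
    using int_imp polynomial_growth_imp_strongly_tempered[OF dom] by (auto simp: strongly_tempered_def)
  have 4: "?int \<longleftrightarrow> polynomial_growth ?M"
    using int_imp 5 by (auto simp: strongly_tempered_def)
  have 3: "polynomial_growth ?M" if "tempered (total_variation \<mu>)"
  proof -
    obtain T where T: "tempered_distribution T" "\<forall>\<phi>\<in>Cc_smooth. total_variation \<mu> \<phi> = T \<phi>"
      using \<open>tempered (total_variation \<mu>)\<close> unfolding tempered_def by blast
    show ?thesis
    proof (rule tempered_imp_polynomial_growth[OF M T(1)])
      fix \<phi> :: "real ^ 'd \<Rightarrow> complex" assume "\<phi> \<in> Cc_smooth"
      then have "T \<phi> = total_variation \<mu> \<phi>" "\<phi> \<in> Cc" using T(2) Cc_smooth_subset_Cc by auto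
      then show "T \<phi> = (\<integral>x. \<phi> x \<partial>?M)" using rep by simp
    qed
  qed
  note 2 = polynomial_growth_imp_strongly_tempered[OF dom_tv] and 23 = strongly_tempered_imp_tempered[OF dom_tv]
  show "slowly_increasing \<mu> \<longleftrightarrow> strongly_tempered (total_variation \<mu>)" using 1 2 3 23 by blast
  show "strongly_tempered (total_variation \<mu>) \<longleftrightarrow> tempered (total_variation \<mu>)" using 2 3 23 by blast
  show "tempered (total_variation \<mu>) \<longleftrightarrow> ?int" using 4 2 3 23 by blast
  show "?int \<longleftrightarrow> strongly_tempered \<mu>" using 4 5 by blast
  show "tempered \<mu>" if "strongly_tempered \<mu>" by (rule strongly_tempered_imp_tempered[OF dom that])
next
  let ?\<mu> = "dipole_series :: (real ^ 'd \<Rightarrow> complex) \<Rightarrow> complex"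
  have rad: "radon_measure ?\<mu>" by (rule radon_measure_dipole_series)
  moreover have "tempered ?\<mu>"
    unfolding tempered_def using tempered_distribution_dipole_series by blast
  moreover have "\<not> strongly_tempered ?\<mu>"
    using not_polynomial_growth_dipole_series[OF radon_variation_measure(3)[OF rad]]
      schwartz_integrable_imp_polynomial_growth[OF radon_variation_measure(1)[OF rad]]
    unfolding strongly_tempered_def by blast
  ultimately show "\<exists>\<mu> :: (real ^ 'd \<Rightarrow> complex) \<Rightarrow> complex.
      radon_measure \<mu> \<and> tempered \<mu> \<and> \<not> strongly_tempered \<mu>" by blast
qed

end
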